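(* Let $\mathcal{C}$ be a congruence-modular and semi-degenerate variety and let $A$ be a member of $\mathcal{C}$ such that $\mathcal{K}(A)$ is closed with respect to the commutator of $A$. Then: (1) The Boolean morphism $\lambda_A|_{\mathcal{B}(\mathrm{Con}(A))}:\mathcal{B}(\mathrm{Con}(A))\to\mathcal{B}(\mathcal{L}(A))$ is injective. (2) If the commutator of $A$ is associative, then $\lambda_A(\mathcal{B}(\mathrm{Con}(A)))=\mathcal{B}(\mathcal{L}(A))=\mathcal{B}(\mathrm{Con}(A))/{\equiv_A}\subseteq\mathcal{B}(\mathrm{Con}(A)/{\equiv_A})$ and $\lambda_A|_{\mathcal{B}(\mathrm{Con}(A))}:\mathcal{B}(\mathrm{Con}(A))\to\mathcal{B}(\mathcal{L}(A))$ is a Boolean isomorphism. (3) If $A$ is semiprime, then $\lambda_A(\mathcal{B}(\mathrm{Con}(A)))=\mathcal{B}(\mathcal{L}(A))=\mathcal{B}(\mathrm{Con}(A))/{\equiv_A}=\mathcal{B}(\mathrm{Con}(A)/{\equiv_A})$ and $\lambda_A|_{\mathcal{B}(\mathrm{Con}(A))}:\mathcal{B}(\mathrm{Con}(A))\to\mathcal{B}(\mathcal{L}(A))$ is a Boolean isomorphism.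
   Context: $\mathcal{C}$ is a variety (equational class) of algebras of some signature; congruence-modular means every member has a modular congruence lattice; semi-degenerate means no non-trivial (more than one element) algebra in $\mathcal{C}$ has one-element subalgebras (equivalently, $\nabla_M$ is a compact congruence for all members $M$). $\mathrm{Con}(A)$ is the complete lattice of congruences of $A$, with meet $\cap$, join $\vee$, least element $\Delta_A$ and greatest element $\nabla_A=A^2$. $\mathcal{K}(A)$ is the set of finitely generated (equivalently, compact) congruences of $A$. Commutator: for $\alpha,\beta,\mu\in\mathrm{Con}(A)$, $C(\alpha,\beta;\mu)$ means: for all $n,k\in\mathbb{N}$ and every term $t$ of arity $n+k$, if $(a_i,b_i)\in\alpha$ for $1\le i\le n$ and $(c_j,d_j)\in\beta$ for $1\le j\le k$, then $(t^A(\vec a,\vec c),t^A(\vec a,\vec d))\in\mu$ iff $(t^A(\vec b,\vec c),t^A(\vec b,\vec d))\in\mu$. Put $[\alpha,\beta]_A=\bigcap\{\mu\mid C(\alpha,\beta;\mu)\}$. Known facts: in a congruence-modular variety the commutator is commutative and distributive with respect to arbitrary joins in both arguments; if the variety is moreover semi-degenerate, then $[\theta,\nabla_A]_A=\theta$ for all $\theta$, every proper congruence is contained in a maximal one, and maximal congruences are prime. Associative means that $[\cdot,\cdot]_A$ is an associative operation on $\mathrm{Con}(A)$. A congruence $\phi\neq\nabla_A$ is prime iff $[\alpha,\beta]_A\subseteq\phi$ implies $\alpha\subseteq\phi$ or $\beta\subseteq\phi$; $\mathrm{Spec}(A)$ is the set of prime congruences; $\rho_A(\theta)=\bigcap\{\phi\in\mathrm{Spec}(A)\mid\theta\subseteq\phi\}$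 (empty intersection $=\nabla_A$). $A$ is semiprime iff $\rho_A(\Delta_A)=\Delta_A$. $\alpha\equiv_A\beta$ iff $\rho_A(\alpha)=\rho_A(\beta)$; $\widehat\alpha$ is the class of $\alpha$, and $\lambda_A(\alpha)=\widehat\alpha$. $\mathrm{Con}(A)/{\equiv_A}$ is a bounded distributive lattice with $\widehat\alpha\vee\widehat\beta=\widehat{\alpha\vee\beta}$, $\widehat\alpha\wedge\widehat\beta=\widehat{\alpha\cap\beta}=\widehat{[\alpha,\beta]_A}$, $\mathbf 0=\widehat{\Delta_A}$, $\mathbf 1=\widehat{\nabla_A}$, and $\mathcal{L}(A)=\{\widehat\alpha\mid\alpha\in\mathcal{K}(A)\}$ is a bounded sublattice of it. For a bounded lattice $L$, $\mathcal{B}(L)$ is the set of complemented elements of $L$. $\mathcal{B}(\mathrm{Con}(A))/{\equiv_A}=\{\widehat\alpha\mid\alpha\in\mathcal{B}(\mathrm{Con}(A))\}$. In this setting $\mathcal{B}(\mathrm{Con}(A))$ is a Boolean algebra with operations $\vee,\cap$ (and there $\cap$ coincides with $[\cdot,\cdot]_A$), $\mathcal{B}(\mathrm{Con}(A))\subseteq\mathcal{K}(A)$, and $\lambda_A$ restricts to a Boolean morphism $\mathcal{B}(\mathrm{Con}(A))\to\mathcal{B}(\mathcal{L}(A))$. *)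

theory Defs
  imports "HOL-Algebra.Lattice"
begin

section \<open>Algebras, terms and equational classes\<close>

text \<open>
  A signature is a set of pairs (operation symbol, arity). It may be empty, infinite, or contain
  constants (arity 0). Operations take their arguments as a list; the values of
  \<open>interp\<close> on lists of the wrong length or outside the carrier are irrelevant.
\<close>

type_synonym 'f signature = "('f \<times> nat) set"

record ('f, 'a) algebra = "'a partial_object" +
  interp :: "'f \<Rightarrow> 'a list \<Rightarrow> 'a"

definition is_algebra :: "'f signature \<Rightarrow> ('f, 'a) algebra \<Rightarrow> bool" where
  "is_algebra \<Sigma> A \<longleftrightarrow>
     carrier A \<noteq> {} \<and>
     (\<forall>(f, n)\<in>\<Sigma>. \<forall>xs\<in>lists (carrier A). length xs = n \<longrightarrow> interp A f xs \<in> carrier A)"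

datatype (symbols_trm: 'f, vars_trm: 'v) trm = Var 'v | App 'f "('f, 'v) trm list"

fun wf_trm :: "'f signature \<Rightarrow> ('f, 'v) trm \<Rightarrow> bool" where
  "wf_trm \<Sigma> (Var x) \<longleftrightarrow> True"
| "wf_trm \<Sigma> (App f ts) \<longleftrightarrow> (f, length ts) \<in> \<Sigma> \<and> (\<forall>t\<in>set ts. wf_trm \<Sigma> t)"

fun eval_trm :: "('f, 'a) algebra \<Rightarrow> ('v \<Rightarrow> 'a) \<Rightarrow> ('f, 'v) trm \<Rightarrow> 'a" where
  "eval_trm A \<sigma> (Var x) = \<sigma> x"
| "eval_trm A \<sigma> (App f ts) = interp A f (map (eval_trm A \<sigma>) ts)"

definition terms_of_arity :: "'f signature \<Rightarrow> nat \<Rightarrow> ('f, nat) trm set" where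
  "terms_of_arity \<Sigma> m = {t. wf_trm \<Sigma> t \<and> vars_trm t \<subseteq> {..<m}}"

definition term_op :: "('f, 'a) algebra \<Rightarrow> ('f, nat) trm \<Rightarrow> 'a list \<Rightarrow> 'a" where
  "term_op A t xs = eval_trm A ((!) xs) t"

type_synonym 'f identities = "(('f, nat) trm \<times> ('f, nat) trm) set"

definition wf_identities :: "'f signature \<Rightarrow> 'f identities \<Rightarrow> bool" where
  "wf_identities \<Sigma> E \<longleftrightarrow> (\<forall>(s, t)\<in>E. wf_trm \<Sigma> s \<and> wf_trm \<Sigma> t)"

text \<open>
  The equational class axiomatised by \<open>E\<close>, restricted to algebras whose carrier is a
  (nonempty) set of elements of the type \<open>'a\<close>.
\<close>

definition variety :: "'f signature \<Rightarrow> 'f identities \<Rightarrow> ('f, 'a) algebra set" where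
  "variety \<Sigma> E = {A. is_algebra \<Sigma> A \<and>
     (\<forall>(s, t)\<in>E. \<forall>\<sigma>. range \<sigma> \<subseteq> carrier A \<longrightarrow> eval_trm A \<sigma> s = eval_trm A \<sigma> t)}"

definition subalgebra :: "'f signature \<Rightarrow> 'a set \<Rightarrow> ('f, 'a) algebra \<Rightarrow> bool" where
  "subalgebra \<Sigma> S A \<longleftrightarrow> S \<subseteq> carrier A \<and> is_algebra \<Sigma> (A\<lparr>carrier := S\<rparr>)"

section \<open>Lattices\<close>

definition modular_lattice :: "('a, 'b) gorder_scheme \<Rightarrow> bool" where
  "modular_lattice L \<longleftrightarrow> lattice L \<and>
     (\<forall>x\<in>carrier L. \<forall>y\<in>carrier L. \<forall>z\<in>carrier L.
        x \<sqsubseteq>\<^bsub>L\<^esub> z \<longrightarrow> x \<squnion>\<^bsub>L\<^esub> (y \<sqinter>\<^bsub>L\<^esub> z) = (x \<squnion>\<^bsub>L\<^esub> y) \<sqinter>\<^bsub>L\<^esub> z)"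

definition complemented :: "('a, 'b) gorder_scheme \<Rightarrow> 'a set" where
  "complemented L = {x \<in> carrier L.
     \<exists>y\<in>carrier L. x \<squnion>\<^bsub>L\<^esub> y = \<top>\<^bsub>L\<^esub> \<and> x \<sqinter>\<^bsub>L\<^esub> y = \<bottom>\<^bsub>L\<^esub>}"

definition boolean_algebra :: "('a, 'b) gorder_scheme \<Rightarrow> bool" where
  "boolean_algebra L \<longleftrightarrow> bounded_lattice L \<and>
     (\<forall>x\<in>carrier L. \<forall>y\<in>carrier L. \<forall>z\<in>carrier L.
        x \<sqinter>\<^bsub>L\<^esub> (y \<squnion>\<^bsub>L\<^esub> z) = (x \<sqinter>\<^bsub>L\<^esub> y) \<squnion>\<^bsub>L\<^esub> (x \<sqinter>\<^bsub>L\<^esub> z)) \<and>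
     complemented L = carrier L"

text \<open>
  Preservation of complements is automatic: complements in a Boolean algebra are unique and
  characterised by join, meet and the bounds.
\<close>

definition boolean_morphism ::
  "('a, 'c) gorder_scheme \<Rightarrow> ('b, 'd) gorder_scheme \<Rightarrow> ('a \<Rightarrow> 'b) \<Rightarrow> bool" where
  "boolean_morphism L M h \<longleftrightarrow> boolean_algebra L \<and> boolean_algebra M \<and>
     h \<in> carrier L \<rightarrow> carrier M \<and> join_pres L M h \<and> meet_pres L M h \<and>
     h \<bottom>\<^bsub>L\<^esub> = \<bottom>\<^bsub>M\<^esub> \<and> h \<top>\<^bsub>L\<^esub> = \<top>\<^bsub>M\<^esub>"

definition boolean_isomorphism ::
  "('a, 'c) gorder_scheme \<Rightarrow> ('b, 'd) gorder_scheme \<Rightarrow> ('a \<Rightarrow> 'b) \<Rightarrow> bool" where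
  "boolean_isomorphism L M h \<longleftrightarrow>
     boolean_morphism L M h \<and> bij_betw h (carrier L) (carrier M)"

text \<open>
  The complemented elements with the inherited order. When the complemented elements
  form a sublattice, as in a bounded distributive lattice, its operations are those of
  \<open>L\<close>.
\<close>

definition complemented_poset :: "'a gorder \<Rightarrow> 'a gorder" where
  "complemented_poset L = L\<lparr>carrier := complemented L\<rparr>"

section \<open>Congruences\<close>

definition Con :: "'f signature \<Rightarrow> ('f, 'a) algebra \<Rightarrow> 'a rel set" where
  "Con \<Sigma> A = {\<theta>. equiv (carrier A) \<theta> \<and>
     (\<forall>(f, n)\<in>\<Sigma>. \<forall>xs ys. length xs = n \<and> list_all2 (\<lambda>x y. (x, y) \<in> \<theta>) xs ys
        \<longrightarrow> (interp A f xs, interp A f ys) \<in> \<theta>)}"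

definition Con_lattice :: "'f signature \<Rightarrow> ('f, 'a) algebra \<Rightarrow> 'a rel gorder" where
  "Con_lattice \<Sigma> A = \<lparr>carrier = Con \<Sigma> A, eq = (=), le = (\<subseteq>)\<rparr>"

definition Delta :: "('f, 'a) algebra \<Rightarrow> 'a rel" where
  "Delta A = Id_on (carrier A)"

definition Nabla :: "('f, 'a) algebra \<Rightarrow> 'a rel" where
  "Nabla A = carrier A \<times> carrier A"

definition Cg :: "'f signature \<Rightarrow> ('f, 'a) algebra \<Rightarrow> 'a rel \<Rightarrow> 'a rel" where
  "Cg \<Sigma> A X = \<Inter>{\<theta> \<in> Con \<Sigma> A. X \<subseteq> \<theta>}"

definition fg_Con :: "'f signature \<Rightarrow> ('f, 'a) algebra \<Rightarrow> 'a rel set" where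
  "fg_Con \<Sigma> A = {Cg \<Sigma> A X | X. finite X \<and> X \<subseteq> Nabla A}"

text \<open>
  HOL cannot quantify over the members of a class on all types at once. The two properties of
  varieties below therefore refer to the members carried by one type \<open>'u\<close>.
\<close>

definition congruence_modular :: "'u itself \<Rightarrow> 'f signature \<Rightarrow> 'f identities \<Rightarrow> bool" where
  "congruence_modular _ \<Sigma> E \<longleftrightarrow>
     (\<forall>M :: ('f, 'u) algebra. M \<in> variety \<Sigma> E \<longrightarrow> modular_lattice (Con_lattice \<Sigma> M))"

definition semi_degenerate :: "'u itself \<Rightarrow> 'f signature \<Rightarrow> 'f identities \<Rightarrow> bool" where
  "semi_degenerate _ \<Sigma> E \<longleftrightarrow>
     (\<forall>M :: ('f, 'u) algebra. M \<in> variety \<Sigma> E \<and> (\<exists>x\<in>carrier M. \<exists>y\<in>carrier M. x \<noteq> y)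
        \<longrightarrow> \<not> (\<exists>x. subalgebra \<Sigma> {x} M))"

text \<open>
  For an algebra carried by \<open>'a\<close>, the type below is a sufficient choice of \<open>'u\<close>: it is infinite
  and at least as large as \<open>'a\<close> and \<open>'f\<close>. So it contains isomorphic copies of all members of the
  variety of cardinality at most the maximum of the cardinalities of \<open>'a\<close>, \<open>'f\<close> and the natural
  numbers, in particular of the countably generated free algebras, and of the quotients
  of subalgebras of finite powers of algebras carried by \<open>'a\<close>. By Day's term condition, and by
  passing to the subalgebra generated by a one-element subalgebra and one further element, either
  property holds for the members carried by this type iff it holds for all members of the variety.
\<close>

type_synonym ('f, 'a) universe = "('f, 'a + nat) trm"

section \<open>Commutator, prime congruences and the reticulation\<close>

definition centralizes ::
  "'f signature \<Rightarrow> ('f, 'a) algebra \<Rightarrow> 'a rel \<Rightarrow> 'a rel \<Rightarrow> 'a rel \<Rightarrow> bool" where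
  "centralizes \<Sigma> A \<alpha> \<beta> \<mu> \<longleftrightarrow>
     (\<forall>n k. \<forall>t\<in>terms_of_arity \<Sigma> (n + k). \<forall>as bs cs ds.
        length as = n \<and> list_all2 (\<lambda>a b. (a, b) \<in> \<alpha>) as bs \<and>
        length cs = k \<and> list_all2 (\<lambda>c d. (c, d) \<in> \<beta>) cs ds \<longrightarrow>
        ((term_op A t (as @ cs), term_op A t (as @ ds)) \<in> \<mu> \<longleftrightarrow>
         (term_op A t (bs @ cs), term_op A t (bs @ ds)) \<in> \<mu>))"

definition commutator ::
  "'f signature \<Rightarrow> ('f, 'a) algebra \<Rightarrow> 'a rel \<Rightarrow> 'a rel \<Rightarrow> 'a rel" where
  "commutator \<Sigma> A \<alpha> \<beta> = \<Inter>{\<mu> \<in> Con \<Sigma> A. centralizes \<Sigma> A \<alpha> \<beta> \<mu>}"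

definition commutator_associative :: "'f signature \<Rightarrow> ('f, 'a) algebra \<Rightarrow> bool" where
  "commutator_associative \<Sigma> A \<longleftrightarrow>
     (\<forall>\<alpha>\<in>Con \<Sigma> A. \<forall>\<beta>\<in>Con \<Sigma> A. \<forall>\<gamma>\<in>Con \<Sigma> A.
        commutator \<Sigma> A (commutator \<Sigma> A \<alpha> \<beta>) \<gamma> = commutator \<Sigma> A \<alpha> (commutator \<Sigma> A \<beta> \<gamma>))"

definition Spec :: "'f signature \<Rightarrow> ('f, 'a) algebra \<Rightarrow> 'a rel set" where
  "Spec \<Sigma> A = {\<phi> \<in> Con \<Sigma> A. \<phi> \<noteq> Nabla A \<and>
     (\<forall>\<alpha>\<in>Con \<Sigma> A. \<forall>\<beta>\<in>Con \<Sigma> A. commutator \<Sigma> A \<alpha> \<beta> \<subseteq> \<phi> \<longrightarrow> \<alpha> \<subseteq> \<phi> \<or> \<beta> \<subseteq> \<phi>)}"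

text \<open>Intersecting with \<open>Nabla A\<close> makes the empty intersection equal to \<open>Nabla A\<close>.\<close>

definition radical :: "'f signature \<Rightarrow> ('f, 'a) algebra \<Rightarrow> 'a rel \<Rightarrow> 'a rel" where
  "radical \<Sigma> A \<theta> = Nabla A \<inter> \<Inter>{\<phi> \<in> Spec \<Sigma> A. \<theta> \<subseteq> \<phi>}"

definition semiprime :: "'f signature \<Rightarrow> ('f, 'a) algebra \<Rightarrow> bool" where
  "semiprime \<Sigma> A \<longleftrightarrow> radical \<Sigma> A (Delta A) = Delta A"

definition rad_equiv :: "'f signature \<Rightarrow> ('f, 'a) algebra \<Rightarrow> 'a rel rel" where
  "rad_equiv \<Sigma> A =
     {(\<alpha>, \<beta>). \<alpha> \<in> Con \<Sigma> A \<and> \<beta> \<in> Con \<Sigma> A \<and> radical \<Sigma> A \<alpha> = radical \<Sigma> A \<beta>}"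

definition rad_class :: "'f signature \<Rightarrow> ('f, 'a) algebra \<Rightarrow> 'a rel \<Rightarrow> 'a rel set" where
  "rad_class \<Sigma> A \<alpha> = rad_equiv \<Sigma> A `` {\<alpha>}"

text \<open>
  The quotient of the congruence lattice by \<open>rad_equiv\<close>, with the order of a quotient lattice:
  \<open>X\<close> is below \<open>Y\<close> iff some representatives are. The lemmas below show that its bounded lattice
  operations are those induced on classes by the operations of the congruence lattice.
\<close>

definition quotient_lattice :: "'f signature \<Rightarrow> ('f, 'a) algebra \<Rightarrow> 'a rel set gorder" where
  "quotient_lattice \<Sigma> A =
     \<lparr>carrier = Con \<Sigma> A // rad_equiv \<Sigma> A, eq = (=), le = (\<lambda>X Y. \<exists>\<alpha>\<in>X. \<exists>\<beta>\<in>Y. \<alpha> \<subseteq> \<beta>)\<rparr>"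

definition reticulation :: "'f signature \<Rightarrow> ('f, 'a) algebra \<Rightarrow> 'a rel set gorder" where
  "reticulation \<Sigma> A = (quotient_lattice \<Sigma> A)\<lparr>carrier := rad_class \<Sigma> A ` fg_Con \<Sigma> A\<rparr>"


lemma ConI:
  assumes "equiv (carrier A) \<theta>"
    and "\<And>f xs ys. (f, length xs) \<in> \<Sigma> \<Longrightarrow> list_all2 (\<lambda>x y. (x, y) \<in> \<theta>) xs ys \<Longrightarrow>
      (interp A f xs, interp A f ys) \<in> \<theta>"
  shows "\<theta> \<in> Con \<Sigma> A"
  using assms unfolding Con_def by blast

lemma interp_in_carrier:
  assumes "is_algebra \<Sigma> A" "(f, length xs) \<in> \<Sigma>" "set xs \<subseteq> carrier A"
  shows "interp A f xs \<in> carrier A"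
proof -
  have "xs \<in> lists (carrier A)" using assms(3) by (simp add: lists_eq_set)
  then show ?thesis using assms(1,2) unfolding is_algebra_def by blast
qed

lemma Nabla_in_Con:
  assumes "is_algebra \<Sigma> A" shows "Nabla A \<in> Con \<Sigma> A"
proof (rule ConI)
  show "equiv (carrier A) (Nabla A)"
    by (auto simp: Nabla_def equiv_def refl_on_def sym_def trans_def)
  fix f xs ys
  assume f: "(f, length xs) \<in> \<Sigma>" and xy: "list_all2 (\<lambda>x y. (x, y) \<in> Nabla A) xs ys"
  have "set xs \<subseteq> carrier A" "set ys \<subseteq> carrier A" "length ys = length xs"
    using xy by (auto simp: list_all2_conv_all_nth in_set_conv_nth Nabla_def)
  then show "(interp A f xs, interp A f ys) \<in> Nabla A"
    using interp_in_carrier[OF assms] f by (simp add: Nabla_def)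
qed

lemma Delta_in_Con:
  assumes "is_algebra \<Sigma> A" shows "Delta A \<in> Con \<Sigma> A"
proof (rule ConI)
  show "equiv (carrier A) (Delta A)"
    by (auto simp: Delta_def equiv_def refl_on_def sym_def trans_def)
  fix f xs ys
  assume f: "(f, length xs) \<in> \<Sigma>" and xy: "list_all2 (\<lambda>x y. (x, y) \<in> Delta A) xs ys"
  have "set xs \<subseteq> carrier A" "ys = xs"
    using xy by (auto simp: list_all2_conv_all_nth in_set_conv_nth list_eq_iff_nth_eq
        Delta_def Id_on_iff)
  then show "(interp A f xs, interp A f ys) \<in> Delta A"
    using interp_in_carrier[OF assms] f by (simp add: Delta_def Id_on_iff)
qed

lemma Con_subset_Nabla: "\<theta> \<in> Con \<Sigma> A \<Longrightarrow> \<theta> \<subseteq> Nabla A"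
  by (auto simp: Con_def equiv_def Nabla_def)

lemma Delta_subset_Con: "\<theta> \<in> Con \<Sigma> A \<Longrightarrow> Delta A \<subseteq> \<theta>"
  by (auto simp: Con_def equiv_def Delta_def refl_on_def)

lemma Inter_in_Con:
  assumes "S \<noteq> {}" "S \<subseteq> Con \<Sigma> A" shows "\<Inter>S \<in> Con \<Sigma> A"
proof (rule ConI)
  have e: "equiv (carrier A) \<theta>" if "\<theta> \<in> S" for \<theta>
    using that assms(2) by (auto simp: Con_def)
  show "equiv (carrier A) (\<Inter>S)"
  proof (rule equivI)
    show "\<Inter>S \<subseteq> carrier A \<times> carrier A"
      using e assms(1) unfolding equiv_def by blast
    show "refl_on (carrier A) (\<Inter>S)"
      using e unfolding equiv_def refl_on_def by blast
    show "sym (\<Inter>S)"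
      using e unfolding equiv_def sym_def by blast
    show "trans (\<Inter>S)"
      using e unfolding equiv_def trans_def by (meson Inter_iff)
  qed
  fix f xs ys
  assume f: "(f, length xs) \<in> \<Sigma>" and xy: "list_all2 (\<lambda>x y. (x, y) \<in> \<Inter>S) xs ys"
  have "(interp A f xs, interp A f ys) \<in> \<theta>" if "\<theta> \<in> S" for \<theta>
  proof -
    have "list_all2 (\<lambda>x y. (x, y) \<in> \<theta>) xs ys"
      using xy that by (auto elim: list_all2_mono)
    then show ?thesis
      using f that assms(2) unfolding Con_def by blast
  qed
  then show "(interp A f xs, interp A f ys) \<in> \<Inter>S" by blast
qed

lemma Cg_in_Con:
  assumes "is_algebra \<Sigma> A" "X \<subseteq> Nabla A" shows "Cg \<Sigma> A X \<in> Con \<Sigma> A"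
  unfolding Cg_def by (rule Inter_in_Con) (use Nabla_in_Con assms in auto)

lemma radical_in_Con:
  assumes "is_algebra \<Sigma> A" shows "radical \<Sigma> A \<theta> \<in> Con \<Sigma> A"
proof -
  have "radical \<Sigma> A \<theta> = \<Inter>(insert (Nabla A) {\<phi> \<in> Spec \<Sigma> A. \<theta> \<subseteq> \<phi>})"
    by (auto simp: radical_def)
  also have "\<dots> \<in> Con \<Sigma> A"
    by (rule Inter_in_Con) (use Nabla_in_Con[OF assms] in \<open>auto simp: Spec_def\<close>)
  finally show ?thesis .
qed

lemma radical_increasing: "\<theta> \<in> Con \<Sigma> A \<Longrightarrow> \<theta> \<subseteq> radical \<Sigma> A \<theta>"
  using Con_subset_Nabla by (fastforce simp: radical_def)

lemma radical_mono: "\<alpha> \<subseteq> \<beta> \<Longrightarrow> radical \<Sigma> A \<alpha> \<subseteq> radical \<Sigma> A \<beta>"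
  by (auto simp: radical_def)

lemma subset_prime_iff:
  assumes "\<theta> \<in> Con \<Sigma> A" "\<phi> \<in> Spec \<Sigma> A"
  shows "radical \<Sigma> A \<theta> \<subseteq> \<phi> \<longleftrightarrow> \<theta> \<subseteq> \<phi>"
  using assms radical_increasing[OF assms(1)] by (auto simp: radical_def)

lemma radical_radical:
  assumes "\<theta> \<in> Con \<Sigma> A"
  shows "radical \<Sigma> A (radical \<Sigma> A \<theta>) = radical \<Sigma> A \<theta>"
proof -
  have "{\<phi> \<in> Spec \<Sigma> A. radical \<Sigma> A \<theta> \<subseteq> \<phi>} = {\<phi> \<in> Spec \<Sigma> A. \<theta> \<subseteq> \<phi>}"
    using subset_prime_iff[OF assms] by auto
  then show ?thesis
    by (simp only: radical_def[of \<Sigma> A "radical \<Sigma> A \<theta>"] radical_def[of \<Sigma> A \<theta>, symmetric])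
qed

lemma eval_trm_Con:
  assumes "\<theta> \<in> Con \<Sigma> A" "wf_trm \<Sigma> t" "\<And>v. v \<in> vars_trm t \<Longrightarrow> (\<sigma> v, \<tau> v) \<in> \<theta>"
  shows "(eval_trm A \<sigma> t, eval_trm A \<tau> t) \<in> \<theta>"
  using assms(2,3)
proof (induction t)
  case (App f ts)
  have "(eval_trm A \<sigma> t, eval_trm A \<tau> t) \<in> \<theta>" if "t \<in> set ts" for t
    using App.IH[OF that] App.prems that by auto
  then have "list_all2 (\<lambda>x y. (x, y) \<in> \<theta>) (map (eval_trm A \<sigma>) ts) (map (eval_trm A \<tau>) ts)"
    by (simp add: list_all2_conv_all_nth)
  moreover have "(f, length (map (eval_trm A \<sigma>) ts)) \<in> \<Sigma>"
    using App.prems(1) by simp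
  ultimately have "(interp A f (map (eval_trm A \<sigma>) ts), interp A f (map (eval_trm A \<tau>) ts)) \<in> \<theta>"
    using assms(1) unfolding Con_def by blast
  then show ?case by simp
qed simp

lemma term_op_Con:
  assumes "\<theta> \<in> Con \<Sigma> A" "t \<in> terms_of_arity \<Sigma> n" "length xs = n"
    "list_all2 (\<lambda>x y. (x, y) \<in> \<theta>) xs ys"
  shows "(term_op A t xs, term_op A t ys) \<in> \<theta>"
  unfolding term_op_def
  by (rule eval_trm_Con[OF assms(1)])
     (use assms(2-4) in \<open>auto simp: terms_of_arity_def list_all2_conv_all_nth\<close>)

lemma commutator_subset_Int:
  assumes \<alpha>: "\<alpha> \<in> Con \<Sigma> A" and \<beta>: "\<beta> \<in> Con \<Sigma> A"
  shows "commutator \<Sigma> A \<alpha> \<beta> \<subseteq> \<alpha> \<inter> \<beta>"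
proof -
  have refl: "list_all2 (\<lambda>x y. (x, y) \<in> \<theta>) xs xs \<and> list_all2 (\<lambda>x y. (x, y) \<in> \<theta>) ys ys"
    if "\<theta> \<in> Con \<Sigma> A" "\<theta>' \<in> Con \<Sigma> A" "list_all2 (\<lambda>x y. (x, y) \<in> \<theta>') xs ys"
    for \<theta> \<theta>' xs ys
  proof -
    have "(x, x) \<in> \<theta> \<and> (y, y) \<in> \<theta>" if "(x, y) \<in> \<theta>'" for x y
      using that \<open>\<theta> \<in> Con \<Sigma> A\<close> Con_subset_Nabla[OF \<open>\<theta>' \<in> Con \<Sigma> A\<close>]
      by (auto simp: Con_def equiv_def refl_on_def Nabla_def)
    then show ?thesis
      using that(3) by (auto simp: list_all2_conv_all_nth)
  qed
  have "centralizes \<Sigma> A \<alpha> \<beta> \<alpha>"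
    unfolding centralizes_def
  proof (intro allI ballI impI, elim conjE)
    fix n k t as bs cs ds
    assume t: "t \<in> terms_of_arity \<Sigma> (n + k)" and l: "length as = n" "length cs = k"
      and ab: "list_all2 (\<lambda>a b. (a, b) \<in> \<alpha>) as bs" and cd: "list_all2 (\<lambda>c d. (c, d) \<in> \<beta>) cs ds"
    have "(term_op A t (as @ xs), term_op A t (bs @ xs)) \<in> \<alpha>"
      if "xs = cs \<or> xs = ds" for xs
      by (rule term_op_Con[OF \<alpha> t])
         (use that l ab cd refl[OF \<alpha> \<beta> cd] in \<open>auto intro: list_all2_appendI dest: list_all2_lengthD\<close>)
    then have "(term_op A t (as @ cs), term_op A t (bs @ cs)) \<in> \<alpha>"
      "(term_op A t (as @ ds), term_op A t (bs @ ds)) \<in> \<alpha>" by auto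
    moreover have "sym \<alpha>" "trans \<alpha>" using \<alpha> by (auto simp: Con_def equiv_def)
    ultimately show "(term_op A t (as @ cs), term_op A t (as @ ds)) \<in> \<alpha> \<longleftrightarrow>
      (term_op A t (bs @ cs), term_op A t (bs @ ds)) \<in> \<alpha>"
      by (meson symD transD)
  qed
  moreover have "centralizes \<Sigma> A \<alpha> \<beta> \<beta>"
    unfolding centralizes_def
  proof (intro allI ballI impI, elim conjE)
    fix n k t as bs cs ds
    assume t: "t \<in> terms_of_arity \<Sigma> (n + k)" and l: "length as = n" "length cs = k"
      and ab: "list_all2 (\<lambda>a b. (a, b) \<in> \<alpha>) as bs" and cd: "list_all2 (\<lambda>c d. (c, d) \<in> \<beta>) cs ds"
    have "(term_op A t (xs @ cs), term_op A t (xs @ ds)) \<in> \<beta>"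
      if "xs = as \<or> xs = bs" for xs
      by (rule term_op_Con[OF \<beta> t])
         (use that l ab cd refl[OF \<beta> \<alpha> ab] in \<open>auto intro: list_all2_appendI dest: list_all2_lengthD\<close>)
    then show "(term_op A t (as @ cs), term_op A t (as @ ds)) \<in> \<beta> \<longleftrightarrow>
      (term_op A t (bs @ cs), term_op A t (bs @ ds)) \<in> \<beta>" by blast
  qed
  ultimately show ?thesis
    using \<alpha> \<beta> by (auto simp: commutator_def)
qed

lemma Int_in_Con: "\<alpha> \<in> Con \<Sigma> A \<Longrightarrow> \<beta> \<in> Con \<Sigma> A \<Longrightarrow> \<alpha> \<inter> \<beta> \<in> Con \<Sigma> A"
  using Inter_in_Con[of "{\<alpha>, \<beta>}" \<Sigma> A] by simp

lemma radical_Int: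
  assumes "\<alpha> \<in> Con \<Sigma> A" "\<beta> \<in> Con \<Sigma> A"
  shows "radical \<Sigma> A (\<alpha> \<inter> \<beta>) = radical \<Sigma> A \<alpha> \<inter> radical \<Sigma> A \<beta>"
proof -
  have "\<alpha> \<inter> \<beta> \<subseteq> \<phi> \<longleftrightarrow> \<alpha> \<subseteq> \<phi> \<or> \<beta> \<subseteq> \<phi>" if "\<phi> \<in> Spec \<Sigma> A" for \<phi>
    using that assms commutator_subset_Int[OF assms] unfolding Spec_def by blast
  then show ?thesis
    unfolding radical_def by blast
qed

lemma partial_orderI_eq:
  assumes "eq L = (=)" "\<And>x. x \<in> carrier L \<Longrightarrow> x \<sqsubseteq>\<^bsub>L\<^esub> x"
    "\<And>x y. x \<in> carrier L \<Longrightarrow> y \<in> carrier L \<Longrightarrow> x \<sqsubseteq>\<^bsub>L\<^esub> y \<Longrightarrow> y \<sqsubseteq>\<^bsub>L\<^esub> x \<Longrightarrow> x = y"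
    "\<And>x y z. x \<in> carrier L \<Longrightarrow> y \<in> carrier L \<Longrightarrow> z \<in> carrier L \<Longrightarrow>
       x \<sqsubseteq>\<^bsub>L\<^esub> y \<Longrightarrow> y \<sqsubseteq>\<^bsub>L\<^esub> z \<Longrightarrow> x \<sqsubseteq>\<^bsub>L\<^esub> z"
  shows "partial_order L"
proof
  show "x \<sqsubseteq>\<^bsub>L\<^esub> z" if "x \<sqsubseteq>\<^bsub>L\<^esub> y" "y \<sqsubseteq>\<^bsub>L\<^esub> z" "x \<in> carrier L" "y \<in> carrier L" "z \<in> carrier L"
    for x y z
    using assms(4) that by blast
qed (use assms(1-3) in simp_all)

lemma lattice_op_eqI:
  assumes "partial_order L" "x \<in> carrier L" "y \<in> carrier L"
  shows "s \<in> carrier L \<Longrightarrow> x \<sqsubseteq>\<^bsub>L\<^esub> s \<Longrightarrow> y \<sqsubseteq>\<^bsub>L\<^esub> s \<Longrightarrow>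
      (\<And>u. u \<in> carrier L \<Longrightarrow> x \<sqsubseteq>\<^bsub>L\<^esub> u \<Longrightarrow> y \<sqsubseteq>\<^bsub>L\<^esub> u \<Longrightarrow> s \<sqsubseteq>\<^bsub>L\<^esub> u) \<Longrightarrow> x \<squnion>\<^bsub>L\<^esub> y = s"
    and "s \<in> carrier L \<Longrightarrow> s \<sqsubseteq>\<^bsub>L\<^esub> x \<Longrightarrow> s \<sqsubseteq>\<^bsub>L\<^esub> y \<Longrightarrow>
      (\<And>u. u \<in> carrier L \<Longrightarrow> u \<sqsubseteq>\<^bsub>L\<^esub> x \<Longrightarrow> u \<sqsubseteq>\<^bsub>L\<^esub> y \<Longrightarrow> u \<sqsubseteq>\<^bsub>L\<^esub> s) \<Longrightarrow> x \<sqinter>\<^bsub>L\<^esub> y = s"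
    and "s \<in> carrier L \<Longrightarrow> (\<And>u. u \<in> carrier L \<Longrightarrow> s \<sqsubseteq>\<^bsub>L\<^esub> u) \<Longrightarrow> \<bottom>\<^bsub>L\<^esub> = s"
    and "s \<in> carrier L \<Longrightarrow> (\<And>u. u \<in> carrier L \<Longrightarrow> u \<sqsubseteq>\<^bsub>L\<^esub> s) \<Longrightarrow> \<top>\<^bsub>L\<^esub> = s"
proof -
  interpret partial_order L by fact
  have l: "(SOME z. least L z B) = s" if "least L s B" for s B
    using that least_unique by (metis someI)
  have g: "(SOME z. greatest L z B) = s" if "greatest L s B" for s B
    using that greatest_unique by (metis someI)
  show "x \<squnion>\<^bsub>L\<^esub> y = s" if "s \<in> carrier L" "x \<sqsubseteq>\<^bsub>L\<^esub> s" "y \<sqsubseteq>\<^bsub>L\<^esub> s"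
    "\<And>u. u \<in> carrier L \<Longrightarrow> x \<sqsubseteq>\<^bsub>L\<^esub> u \<Longrightarrow> y \<sqsubseteq>\<^bsub>L\<^esub> u \<Longrightarrow> s \<sqsubseteq>\<^bsub>L\<^esub> u"
    unfolding join_def sup_def using that assms(2,3)
    by (intro l) (auto simp: least_def Upper_def)
  show "x \<sqinter>\<^bsub>L\<^esub> y = s" if "s \<in> carrier L" "s \<sqsubseteq>\<^bsub>L\<^esub> x" "s \<sqsubseteq>\<^bsub>L\<^esub> y"
    "\<And>u. u \<in> carrier L \<Longrightarrow> u \<sqsubseteq>\<^bsub>L\<^esub> x \<Longrightarrow> u \<sqsubseteq>\<^bsub>L\<^esub> y \<Longrightarrow> u \<sqsubseteq>\<^bsub>L\<^esub> s"
    unfolding meet_def inf_def using that assms(2,3)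
    by (intro g) (auto simp: greatest_def Lower_def)
  show "\<bottom>\<^bsub>L\<^esub> = s" if "s \<in> carrier L" "\<And>u. u \<in> carrier L \<Longrightarrow> s \<sqsubseteq>\<^bsub>L\<^esub> u"
    unfolding bottom_def using that by (intro l) (auto simp: least_def)
  show "\<top>\<^bsub>L\<^esub> = s" if "s \<in> carrier L" "\<And>u. u \<in> carrier L \<Longrightarrow> u \<sqsubseteq>\<^bsub>L\<^esub> s"
    unfolding top_def using that by (intro g) (auto simp: greatest_def)
qed

lemma Con_lattice_simps [simp]:
  "carrier (Con_lattice \<Sigma> A) = Con \<Sigma> A" "\<alpha> \<sqsubseteq>\<^bsub>Con_lattice \<Sigma> A\<^esub> \<beta> \<longleftrightarrow> \<alpha> \<subseteq> \<beta>"
  by (simp_all add: Con_lattice_def)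

lemma Con_lattice_ops:
  assumes "is_algebra \<Sigma> A"
  shows "\<alpha> \<in> Con \<Sigma> A \<Longrightarrow> \<beta> \<in> Con \<Sigma> A \<Longrightarrow> \<alpha> \<squnion>\<^bsub>Con_lattice \<Sigma> A\<^esub> \<beta> = Cg \<Sigma> A (\<alpha> \<union> \<beta>)"
    and "\<alpha> \<in> Con \<Sigma> A \<Longrightarrow> \<beta> \<in> Con \<Sigma> A \<Longrightarrow> \<alpha> \<sqinter>\<^bsub>Con_lattice \<Sigma> A\<^esub> \<beta> = \<alpha> \<inter> \<beta>"
    and "\<bottom>\<^bsub>Con_lattice \<Sigma> A\<^esub> = Delta A"
    and "\<top>\<^bsub>Con_lattice \<Sigma> A\<^esub> = Nabla A"
proof -
  have po: "partial_order (Con_lattice \<Sigma> A)"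
    by (rule partial_orderI_eq) (auto simp: Con_lattice_def)
  note op = lattice_op_eqI[OF po]
  have d: "Delta A \<in> Con \<Sigma> A" by (rule Delta_in_Con[OF assms])
  show "\<bottom>\<^bsub>Con_lattice \<Sigma> A\<^esub> = Delta A"
    using d by (intro op(3)[OF _ _ _ ]) (auto dest: Delta_subset_Con)
  show "\<top>\<^bsub>Con_lattice \<Sigma> A\<^esub> = Nabla A"
    using d Nabla_in_Con[OF assms] by (intro op(4)) (auto dest: Con_subset_Nabla)
  assume ab: "\<alpha> \<in> Con \<Sigma> A" "\<beta> \<in> Con \<Sigma> A"
  show "\<alpha> \<squnion>\<^bsub>Con_lattice \<Sigma> A\<^esub> \<beta> = Cg \<Sigma> A (\<alpha> \<union> \<beta>)"
  proof (rule op(1))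
    show "Cg \<Sigma> A (\<alpha> \<union> \<beta>) \<in> carrier (Con_lattice \<Sigma> A)"
      using Cg_in_Con[OF assms, of "\<alpha> \<union> \<beta>"] ab by (auto dest: Con_subset_Nabla)
  qed (use ab in \<open>auto simp: Cg_def\<close>)
  show "\<alpha> \<sqinter>\<^bsub>Con_lattice \<Sigma> A\<^esub> \<beta> = \<alpha> \<inter> \<beta>"
    by (rule op(2)) (use ab Int_in_Con[OF ab] in auto)
qed

lemma equiv_rad_equiv: "equiv (Con \<Sigma> A) (rad_equiv \<Sigma> A)"
  by (auto simp: rad_equiv_def equiv_def refl_on_def sym_def trans_def)

lemma rad_class_eq: "\<alpha> \<in> Con \<Sigma> A \<Longrightarrow>
  rad_class \<Sigma> A \<alpha> = {\<beta> \<in> Con \<Sigma> A. radical \<Sigma> A \<beta> = radical \<Sigma> A \<alpha>}"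
  by (auto simp: rad_class_def rad_equiv_def)

lemma carrier_quotient_lattice: "carrier (quotient_lattice \<Sigma> A) = rad_class \<Sigma> A ` Con \<Sigma> A"
  by (auto simp: quotient_lattice_def quotient_def rad_class_def)

lemma quotient_lattice_le_iff:
  assumes "is_algebra \<Sigma> A" "\<alpha> \<in> Con \<Sigma> A" "\<beta> \<in> Con \<Sigma> A"
  shows "rad_class \<Sigma> A \<alpha> \<sqsubseteq>\<^bsub>quotient_lattice \<Sigma> A\<^esub> rad_class \<Sigma> A \<beta> \<longleftrightarrow>
    radical \<Sigma> A \<alpha> \<subseteq> radical \<Sigma> A \<beta>"
proof
  assume "rad_class \<Sigma> A \<alpha> \<sqsubseteq>\<^bsub>quotient_lattice \<Sigma> A\<^esub> rad_class \<Sigma> A \<beta>"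
  then show "radical \<Sigma> A \<alpha> \<subseteq> radical \<Sigma> A \<beta>"
    using assms(2,3) radical_mono[of _ _ \<Sigma> A]
    by (simp add: quotient_lattice_def rad_class_eq) metis
next
  assume "radical \<Sigma> A \<alpha> \<subseteq> radical \<Sigma> A \<beta>"
  moreover have "radical \<Sigma> A \<theta> \<in> rad_class \<Sigma> A \<theta>" if "\<theta> \<in> Con \<Sigma> A" for \<theta>
    using that assms(1) by (simp add: rad_class_eq radical_in_Con radical_radical)
  ultimately show "rad_class \<Sigma> A \<alpha> \<sqsubseteq>\<^bsub>quotient_lattice \<Sigma> A\<^esub> rad_class \<Sigma> A \<beta>"
    using assms(2,3) by (auto simp: quotient_lattice_def)
qed

lemma quotient_lattice_ops:
  assumes "is_algebra \<Sigma> A"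
  shows "\<alpha> \<in> Con \<Sigma> A \<Longrightarrow> \<beta> \<in> Con \<Sigma> A \<Longrightarrow>
      rad_class \<Sigma> A \<alpha> \<squnion>\<^bsub>quotient_lattice \<Sigma> A\<^esub> rad_class \<Sigma> A \<beta>
        = rad_class \<Sigma> A (\<alpha> \<squnion>\<^bsub>Con_lattice \<Sigma> A\<^esub> \<beta>)"
    and "\<alpha> \<in> Con \<Sigma> A \<Longrightarrow> \<beta> \<in> Con \<Sigma> A \<Longrightarrow>
      rad_class \<Sigma> A \<alpha> \<sqinter>\<^bsub>quotient_lattice \<Sigma> A\<^esub> rad_class \<Sigma> A \<beta>
        = rad_class \<Sigma> A (\<alpha> \<sqinter>\<^bsub>Con_lattice \<Sigma> A\<^esub> \<beta>)"
    and "\<bottom>\<^bsub>quotient_lattice \<Sigma> A\<^esub> = rad_class \<Sigma> A (Delta A)"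
    and "\<top>\<^bsub>quotient_lattice \<Sigma> A\<^esub> = rad_class \<Sigma> A (Nabla A)"
proof -
  note le = quotient_lattice_le_iff[OF assms]
  have po: "partial_order (quotient_lattice \<Sigma> A)"
  proof (rule partial_orderI_eq)
    show "eq (quotient_lattice \<Sigma> A) = (=)" by (simp add: quotient_lattice_def)
    show "X = Y" if X: "X \<in> carrier (quotient_lattice \<Sigma> A)" and Y: "Y \<in> carrier (quotient_lattice \<Sigma> A)"
      and le1: "X \<sqsubseteq>\<^bsub>quotient_lattice \<Sigma> A\<^esub> Y" and le2: "Y \<sqsubseteq>\<^bsub>quotient_lattice \<Sigma> A\<^esub> X" for X Y
    proof -
      obtain \<alpha> \<beta> where *: "\<alpha> \<in> Con \<Sigma> A" "\<beta> \<in> Con \<Sigma> A" "X = rad_class \<Sigma> A \<alpha>" "Y = rad_class \<Sigma> A \<beta>"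
        using X Y by (auto simp: carrier_quotient_lattice)
      then have "radical \<Sigma> A \<alpha> = radical \<Sigma> A \<beta>"
        using le1 le2 le by blast
      then show ?thesis
        using * by (simp add: rad_class_eq)
    qed
  qed (auto simp: carrier_quotient_lattice le)
  note op = lattice_op_eqI[OF po]
  have d: "Delta A \<in> Con \<Sigma> A" by (rule Delta_in_Con[OF assms])
  have n: "Nabla A \<in> Con \<Sigma> A" by (rule Nabla_in_Con[OF assms])
  show "\<bottom>\<^bsub>quotient_lattice \<Sigma> A\<^esub> = rad_class \<Sigma> A (Delta A)"
    by (rule op(3)[of "rad_class \<Sigma> A (Delta A)" "rad_class \<Sigma> A (Delta A)"])
       (use d in \<open>auto simp: carrier_quotient_lattice le radical_mono Delta_subset_Con\<close>)
  show "\<top>\<^bsub>quotient_lattice \<Sigma> A\<^esub> = rad_class \<Sigma> A (Nabla A)"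
    by (rule op(4)[of "rad_class \<Sigma> A (Delta A)" "rad_class \<Sigma> A (Delta A)"])
       (use d n in \<open>auto simp: carrier_quotient_lattice le radical_mono Con_subset_Nabla\<close>)
  assume ab: "\<alpha> \<in> Con \<Sigma> A" "\<beta> \<in> Con \<Sigma> A"
  have j: "Cg \<Sigma> A (\<alpha> \<union> \<beta>) \<in> Con \<Sigma> A"
    using Cg_in_Con[OF assms, of "\<alpha> \<union> \<beta>"] ab by (auto dest: Con_subset_Nabla)
  have ju: "radical \<Sigma> A (Cg \<Sigma> A (\<alpha> \<union> \<beta>)) \<subseteq> radical \<Sigma> A \<gamma>"
    if "\<gamma> \<in> Con \<Sigma> A" "radical \<Sigma> A \<alpha> \<subseteq> radical \<Sigma> A \<gamma>" "radical \<Sigma> A \<beta> \<subseteq> radical \<Sigma> A \<gamma>" for \<gamma>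
  proof -
    have "\<alpha> \<union> \<beta> \<subseteq> radical \<Sigma> A \<gamma>"
      using that ab radical_increasing by blast
    then have "Cg \<Sigma> A (\<alpha> \<union> \<beta>) \<subseteq> radical \<Sigma> A \<gamma>"
      using radical_in_Con[OF assms, of \<gamma>] by (auto simp: Cg_def)
    then show ?thesis
      using radical_mono radical_radical[OF that(1)] by metis
  qed
  have jl: "radical \<Sigma> A \<alpha> \<subseteq> radical \<Sigma> A (Cg \<Sigma> A (\<alpha> \<union> \<beta>))"
    "radical \<Sigma> A \<beta> \<subseteq> radical \<Sigma> A (Cg \<Sigma> A (\<alpha> \<union> \<beta>))"
    by (rule radical_mono, force simp: Cg_def)+
  show "rad_class \<Sigma> A \<alpha> \<squnion>\<^bsub>quotient_lattice \<Sigma> A\<^esub> rad_class \<Sigma> A \<beta>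
        = rad_class \<Sigma> A (\<alpha> \<squnion>\<^bsub>Con_lattice \<Sigma> A\<^esub> \<beta>)"
    unfolding Con_lattice_ops(1)[OF assms ab]
    by (rule op(1)) (use ab j jl ju in \<open>auto simp: carrier_quotient_lattice le\<close>)
  have m: "\<alpha> \<inter> \<beta> \<in> Con \<Sigma> A" by (rule Int_in_Con[OF ab])
  show "rad_class \<Sigma> A \<alpha> \<sqinter>\<^bsub>quotient_lattice \<Sigma> A\<^esub> rad_class \<Sigma> A \<beta>
        = rad_class \<Sigma> A (\<alpha> \<sqinter>\<^bsub>Con_lattice \<Sigma> A\<^esub> \<beta>)"
    unfolding Con_lattice_ops(2)[OF assms ab]
    by (rule op(2)) (use ab m in \<open>auto simp: carrier_quotient_lattice le radical_Int[OF ab]\<close>)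
qed

end

theory Submission
  imports Defs
begin

text \<open>
  The commutator \<open>[\<alpha>, \<beta>]\<close> is described by the compatible relation on \<open>\<beta>\<close>, regarded as a subalgebra
  of \<open>A \<times> A\<close>, that consists of the matrices in the term condition. By Day's argument, modularity of
  the congruence lattice of a quotient of the term algebra turns \<open>C(\<beta>, \<alpha>; \<delta>)\<close> into \<open>C(\<alpha>, \<beta>; \<delta>')\<close>
  for every \<open>\<delta>' \<supseteq> \<delta>\<close>, whence commutativity and distributivity over joins. Semi-degeneracy, applied to
  quotients of the term algebra, gives \<open>[\<theta>, \<nabla>] = \<theta>\<close> and compactness of \<open>\<nabla>\<close>.

  Consequently \<open>\<rho>(\<theta>) = \<nabla>\<close> only for \<open>\<theta> = \<nabla>\<close>, and \<open>\<alpha>\<close> is complemented iff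
  \<open>\<alpha> \<or> \<beta> = \<nabla>\<close> and \<open>[\<alpha>, \<beta>] = \<Delta>\<close> for some \<open>\<beta>\<close>. If the classes of compact \<open>\<alpha>\<close>, \<open>\<beta>\<close> are
  complements in the reticulation, then \<open>\<alpha> \<or> \<beta> = \<nabla>\<close> and \<open>[\<alpha>, \<beta>] \<subseteq> \<rho>(\<Delta>)\<close>. In the semiprime
  case this says that \<open>\<alpha>\<close> is complemented. In the associative case some member of the derived series
  of \<open>[\<alpha>, \<beta>]\<close> is \<open>\<Delta>\<close>; it is the commutator of the corresponding members of the derived series of
  \<open>\<alpha>\<close> and \<open>\<beta>\<close>, which have the same radicals as \<open>\<alpha>\<close> and \<open>\<beta>\<close> and therefore still join to \<open>\<nabla>\<close>.
\<close>

section \<open>Congruences generated by compatible relations\<close>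

lemma Con_equiv: "\<theta> \<in> Con \<Sigma> A \<Longrightarrow> equiv (carrier A) \<theta>"
  by (simp add: Con_def)

lemma Con_refl: "\<theta> \<in> Con \<Sigma> A \<Longrightarrow> x \<in> carrier A \<Longrightarrow> (x, x) \<in> \<theta>"
  using Con_equiv[of \<theta> \<Sigma> A] by (auto simp: equiv_def refl_on_def)

lemma Con_sym: "\<theta> \<in> Con \<Sigma> A \<Longrightarrow> (x, y) \<in> \<theta> \<Longrightarrow> (y, x) \<in> \<theta>"
  using Con_equiv[of \<theta> \<Sigma> A] unfolding equiv_def by (meson symD)

lemma Con_trans: "\<theta> \<in> Con \<Sigma> A \<Longrightarrow> (x, y) \<in> \<theta> \<Longrightarrow> (y, z) \<in> \<theta> \<Longrightarrow> (x, z) \<in> \<theta>"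
  using Con_equiv[of \<theta> \<Sigma> A] unfolding equiv_def by (meson transD)

lemma Con_carrier: "\<theta> \<in> Con \<Sigma> A \<Longrightarrow> (x, y) \<in> \<theta> \<Longrightarrow> x \<in> carrier A \<and> y \<in> carrier A"
  using Con_subset_Nabla[of \<theta> \<Sigma> A] by (auto simp: Nabla_def)

lemma Con_compatible:
  assumes "\<theta> \<in> Con \<Sigma> A" "(f, length xs) \<in> \<Sigma>" "list_all2 (\<lambda>x y. (x, y) \<in> \<theta>) xs ys"
  shows "(interp A f xs, interp A f ys) \<in> \<theta>"
  using assms unfolding Con_def by blast

lemma Cg_superset: "X \<subseteq> Cg \<Sigma> A X"
  by (auto simp: Cg_def)

lemma Cg_least: "\<theta> \<in> Con \<Sigma> A \<Longrightarrow> X \<subseteq> \<theta> \<Longrightarrow> Cg \<Sigma> A X \<subseteq> \<theta>"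
  by (auto simp: Cg_def)

lemma Cg_mono: "X \<subseteq> Y \<Longrightarrow> Cg \<Sigma> A X \<subseteq> Cg \<Sigma> A Y"
  by (auto simp: Cg_def)

text \<open>Separated from \<open>Con\<close> because the relation of matrices on the square, used
  later, is compatible, reflexive and symmetric but in general not transitive.\<close>

definition compatible :: "'f signature \<Rightarrow> ('f, 'a) algebra \<Rightarrow> 'a rel \<Rightarrow> bool" where
  "compatible \<Sigma> A R \<longleftrightarrow> (\<forall>f xs ys. (f, length xs) \<in> \<Sigma> \<longrightarrow> list_all2 (\<lambda>x y. (x, y) \<in> R) xs ys \<longrightarrow>
     (interp A f xs, interp A f ys) \<in> R)"

lemma compatibleI:
  assumes "\<And>f xs ys. (f, length xs) \<in> \<Sigma> \<Longrightarrow> list_all2 (\<lambda>x y. (x, y) \<in> R) xs ys \<Longrightarrow>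
    (interp A f xs, interp A f ys) \<in> R"
  shows "compatible \<Sigma> A R"
  using assms by (simp add: compatible_def)

lemma compatibleD:
  assumes "compatible \<Sigma> A R" "(f, length xs) \<in> \<Sigma>" "list_all2 (\<lambda>x y. (x, y) \<in> R) xs ys"
  shows "(interp A f xs, interp A f ys) \<in> R"
  using assms by (simp add: compatible_def)

lemma Con_imp_compatible: "\<theta> \<in> Con \<Sigma> A \<Longrightarrow> compatible \<Sigma> A \<theta>"
  by (rule compatibleI) (rule Con_compatible)

text \<open>The union of two compatible relations need not be compatible, but it is compatible one
  coordinate at a time, which is enough for its transitive closure.\<close>

lemma trancl_Union_compatible_in_Con:
  assumes "S \<noteq> {}"
    and sub: "\<And>R. R \<in> S \<Longrightarrow> R \<subseteq> Nabla A"
    and refl: "\<And>R x. R \<in> S \<Longrightarrow> x \<in> carrier A \<Longrightarrow> (x, x) \<in> R"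
    and sym: "\<And>R. R \<in> S \<Longrightarrow> sym R"
    and comp: "\<And>R. R \<in> S \<Longrightarrow> compatible \<Sigma> A R"
  shows "(\<Union>S)\<^sup>+ \<in> Con \<Sigma> A"
proof (rule ConI)
  have sub': "(\<Union>S)\<^sup>+ \<subseteq> carrier A \<times> carrier A"
    by (rule trancl_subset_Sigma) (use sub in \<open>auto simp: Nabla_def\<close>)
  have refl': "(x, x) \<in> (\<Union>S)\<^sup>+" if "x \<in> carrier A" for x
    using assms(1) refl[OF _ that] by (intro r_into_trancl) blast
  show "equiv (carrier A) ((\<Union>S)\<^sup>+)"
  proof (rule equivI)
    show "refl_on (carrier A) ((\<Union>S)\<^sup>+)"
      using refl' by (auto simp: refl_on_def)
    show "Relation.sym ((\<Union>S)\<^sup>+)"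
      by (rule sym_trancl) (meson UnionE UnionI sym symD symI)
  qed (use sub' in simp_all)
  fix f xs ys
  assume f: "(f, length xs) \<in> \<Sigma>" and xy: "list_all2 (\<lambda>x y. (x, y) \<in> (\<Union>S)\<^sup>+) xs ys"
  have step: "(interp A f (us @ x # vs), interp A f (us @ y # vs)) \<in> (\<Union>S)\<^sup>+"
    if "(x, y) \<in> (\<Union>S)\<^sup>+" "set us \<subseteq> carrier A" "set vs \<subseteq> carrier A" "length (us @ x # vs) = length xs"
    for us vs x y
  proof -
    have one: "(interp A f (us @ b # vs), interp A f (us @ c # vs)) \<in> (\<Union>S)\<^sup>+"
      if bc: "(b, c) \<in> \<Union>S" for b c
    proof -
      obtain R where R: "R \<in> S" "(b, c) \<in> R" using bc by blast
      have "list_all2 (\<lambda>x y. (x, y) \<in> R) (us @ b # vs) (us @ c # vs)"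
        using R refl[OF R(1)] \<open>set us \<subseteq> carrier A\<close> \<open>set vs \<subseteq> carrier A\<close>
        by (intro list_all2_appendI list_all2_Cons[THEN iffD2] conjI list.rel_refl_strong) auto
      moreover have "(f, length (us @ b # vs)) \<in> \<Sigma>"
        using f \<open>length (us @ x # vs) = length xs\<close> by simp
      ultimately show ?thesis
        using compatibleD[OF comp[OF R(1)]] R(1) by (meson UnionI r_into_trancl)
    qed
    show ?thesis
      using that(1)
    proof (induction rule: trancl_induct)
      case (base z)
      then show ?case by (rule one)
    next
      case (step b c)
      then show ?case using one by (meson trancl_trans)
    qed
  qed
  \<comment> \<open>\<open>us\<close> collects the arguments that have been exchanged already; it
    grows during the induction, so it is kept arbitrary, and the claim is the case where it is
    empty.\<close>
  have "(interp A f (us @ xs'), interp A f (us @ ys')) \<in> (\<Union>S)\<^sup>+"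
    if "list_all2 (\<lambda>x y. (x, y) \<in> (\<Union>S)\<^sup>+) xs' ys'" "set us \<subseteq> carrier A"
      "length (us @ xs') = length xs" for us xs' ys'
    using that
  proof (induction arbitrary: us rule: list_all2_induct)
    case Nil
    obtain R where R: "R \<in> S" using assms(1) by blast
    have "list_all2 (\<lambda>x y. (x, y) \<in> R) us us"
      using refl[OF R] Nil by (intro list.rel_refl_strong) auto
    then have "(interp A f us, interp A f us) \<in> R"
      using compatibleD[OF comp[OF R]] f Nil by simp
    then show ?case using R by (simp, meson UnionI r_into_trancl)
  next
    case (Cons x xs' y ys')
    have c: "y \<in> carrier A" "set xs' \<subseteq> carrier A"
      using Cons.hyps by (auto simp: list_all2_conv_all_nth in_set_conv_nth dest!: subsetD[OF sub'])
    have "(interp A f (us @ x # xs'), interp A f (us @ y # xs')) \<in> (\<Union>S)\<^sup>+"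
      by (rule step) (use Cons.prems Cons.hyps c in auto)
    moreover have "(interp A f ((us @ [y]) @ xs'), interp A f ((us @ [y]) @ ys')) \<in> (\<Union>S)\<^sup>+"
      by (rule Cons.IH) (use Cons.prems c in auto)
    ultimately show ?case by simp
  qed
  from this[OF xy, of "[]"] show "(interp A f xs, interp A f ys) \<in> (\<Union>S)\<^sup>+"
    by simp
qed


lemma trancl_compatible_in_Con:
  assumes "R \<subseteq> Nabla A" "\<And>x. x \<in> carrier A \<Longrightarrow> (x, x) \<in> R" "sym R" "compatible \<Sigma> A R"
  shows "R\<^sup>+ \<in> Con \<Sigma> A"
  using trancl_Union_compatible_in_Con[of "{R}" A \<Sigma>] assms by simp

lemma trancl_Un_in_Con:
  assumes "\<alpha> \<in> Con \<Sigma> A" "\<beta> \<in> Con \<Sigma> A"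
  shows "(\<alpha> \<union> \<beta>)\<^sup>+ \<in> Con \<Sigma> A"
proof -
  have "(\<Union>{\<alpha>, \<beta>})\<^sup>+ \<in> Con \<Sigma> A"
    by (rule trancl_Union_compatible_in_Con)
      (use assms Con_subset_Nabla Con_refl Con_imp_compatible Con_sym in \<open>auto simp: sym_def\<close>)
  then show ?thesis by simp
qed

lemma Cg_Un_eq_trancl:
  assumes "\<alpha> \<in> Con \<Sigma> A" "\<beta> \<in> Con \<Sigma> A"
  shows "Cg \<Sigma> A (\<alpha> \<union> \<beta>) = (\<alpha> \<union> \<beta>)\<^sup>+"
proof
  from trancl_Un_in_Con[OF assms] show "Cg \<Sigma> A (\<alpha> \<union> \<beta>) \<subseteq> (\<alpha> \<union> \<beta>)\<^sup>+"
    by (intro Cg_least) auto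
  have "(x, y) \<in> \<theta>" if \<theta>: "\<theta> \<in> Con \<Sigma> A" "\<alpha> \<union> \<beta> \<subseteq> \<theta>" and "(x, y) \<in> (\<alpha> \<union> \<beta>)\<^sup>+" for x y \<theta>
    using that(3) by (induction) (use Con_trans[OF \<theta>(1)] \<theta>(2) in blast)+
  then show "(\<alpha> \<union> \<beta>)\<^sup>+ \<subseteq> Cg \<Sigma> A (\<alpha> \<union> \<beta>)"
    by (auto simp: Cg_def)
qed

lemma Cg_Un_in_Con:
  assumes "\<alpha> \<in> Con \<Sigma> A" "\<beta> \<in> Con \<Sigma> A"
  shows "Cg \<Sigma> A (\<alpha> \<union> \<beta>) \<in> Con \<Sigma> A"
  unfolding Cg_Un_eq_trancl[OF assms] by (rule trancl_Un_in_Con[OF assms])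

section \<open>Directed unions and finite generation\<close>

lemma finite_subset_directed:
  assumes "finite X" "X \<subseteq> \<Union>D" "D \<noteq> {}"
    and dir: "\<And>\<theta> \<theta>'. \<theta> \<in> D \<Longrightarrow> \<theta>' \<in> D \<Longrightarrow> \<exists>\<phi>\<in>D. \<theta> \<union> \<theta>' \<subseteq> \<phi>"
  shows "\<exists>\<phi>\<in>D. X \<subseteq> \<phi>"
  using assms(1,2)
proof (induction rule: finite_induct)
  case empty
  then show ?case using assms(3) by auto
next
  case (insert x X)
  then obtain \<phi> \<psi> where p: "\<phi> \<in> D" "X \<subseteq> \<phi>" "\<psi> \<in> D" "x \<in> \<psi>" by auto
  obtain \<chi> where "\<chi> \<in> D" "\<phi> \<union> \<psi> \<subseteq> \<chi>" using dir[OF p(1,3)] by blast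
  then show ?case using p by blast
qed

text \<open>Operations are finitary, so each closure condition of a congruence involves finitely
  many pairs, and by directedness these lie in a single member of \<open>D\<close>.\<close>

lemma directed_Union_in_Con:
  assumes "D \<noteq> {}" "D \<subseteq> Con \<Sigma> A"
    and dir: "\<And>\<theta> \<theta>'. \<theta> \<in> D \<Longrightarrow> \<theta>' \<in> D \<Longrightarrow> \<exists>\<phi>\<in>D. \<theta> \<union> \<theta>' \<subseteq> \<phi>"
  shows "\<Union>D \<in> Con \<Sigma> A"
proof (rule ConI)
  have D: "\<theta> \<in> Con \<Sigma> A" if "\<theta> \<in> D" for \<theta> using that assms(2) by blast
  show "equiv (carrier A) (\<Union>D)"
  proof (rule equivI)
    show "\<Union>D \<subseteq> carrier A \<times> carrier A"
      using D Con_carrier by fast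
    show "refl_on (carrier A) (\<Union>D)"
      using assms(1) D Con_refl unfolding refl_on_def by fast
    show "sym (\<Union>D)"
      using D Con_sym unfolding sym_def by fast
    show "trans (\<Union>D)"
    proof (rule transI)
      fix x y z assume "(x, y) \<in> \<Union>D" "(y, z) \<in> \<Union>D"
      then obtain \<theta> \<theta>' where t: "\<theta> \<in> D" "(x, y) \<in> \<theta>" "\<theta>' \<in> D" "(y, z) \<in> \<theta>'" by blast
      obtain \<phi> where p: "\<phi> \<in> D" "\<theta> \<union> \<theta>' \<subseteq> \<phi>" using dir[OF t(1,3)] by blast
      then have "(x, z) \<in> \<phi>" using t Con_trans[OF D[OF p(1)], of x y z] by blast
      then show "(x, z) \<in> \<Union>D" using p by blast
    qed
  qed
  fix f xs ys
  assume f: "(f, length xs) \<in> \<Sigma>" and xy: "list_all2 (\<lambda>x y. (x, y) \<in> \<Union>D) xs ys"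
  have "set (zip xs ys) \<subseteq> \<Union>D"
    using xy unfolding list_all2_iff by fast
  then obtain \<phi> where p: "\<phi> \<in> D" "set (zip xs ys) \<subseteq> \<phi>"
    using finite_subset_directed[OF _ _ assms(1) dir] by (metis List.finite_set)
  then have "list_all2 (\<lambda>x y. (x, y) \<in> \<phi>) xs ys"
    using xy unfolding list_all2_iff by fast
  then show "(interp A f xs, interp A f ys) \<in> \<Union>D"
    using Con_compatible[OF D[OF p(1)] f] p(1) by blast
qed

text \<open>The congruences generated by finite subsets of \<open>X\<close> form a directed family.
  Its union is a congruence containing \<open>X\<close>, hence it contains
  \<open>Cg \<Sigma> A X\<close>.\<close>

lemma Cg_finite_subset:
  assumes A: "is_algebra \<Sigma> A" and X: "X \<subseteq> Nabla A" and "x \<in> Cg \<Sigma> A X"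
  shows "\<exists>Y. finite Y \<and> Y \<subseteq> X \<and> x \<in> Cg \<Sigma> A Y"
proof -
  define D where "D = Cg \<Sigma> A ` {Y. finite Y \<and> Y \<subseteq> X}"
  have "\<Union>D \<in> Con \<Sigma> A"
  proof (rule directed_Union_in_Con)
    show "D \<subseteq> Con \<Sigma> A"
      using Cg_in_Con[OF A] X unfolding D_def by auto
    fix \<theta> \<theta>' assume "\<theta> \<in> D" "\<theta>' \<in> D"
    then obtain Y Y' where "finite Y" "Y \<subseteq> X" "\<theta> = Cg \<Sigma> A Y" "finite Y'" "Y' \<subseteq> X" "\<theta>' = Cg \<Sigma> A Y'"
      unfolding D_def by blast
    then have "Cg \<Sigma> A (Y \<union> Y') \<in> D" "\<theta> \<union> \<theta>' \<subseteq> Cg \<Sigma> A (Y \<union> Y')"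
      unfolding D_def using Cg_mono[of Y "Y \<union> Y'" \<Sigma> A] Cg_mono[of Y' "Y \<union> Y'" \<Sigma> A] by auto
    then show "\<exists>\<phi>\<in>D. \<theta> \<union> \<theta>' \<subseteq> \<phi>" by blast
  qed (auto simp: D_def)
  moreover have "X \<subseteq> \<Union>D"
  proof
    fix y assume "y \<in> X"
    then have "Cg \<Sigma> A {y} \<in> D" unfolding D_def by auto
    then show "y \<in> \<Union>D" using Cg_superset[of "{y}"] by blast
  qed
  ultimately have "Cg \<Sigma> A X \<subseteq> \<Union>D" by (rule Cg_least)
  then show ?thesis using assms(3) unfolding D_def by blast
qed

section \<open>Homomorphisms, quotients and squares\<close>

lemma eval_trm_cong:
  "(\<And>v. v \<in> vars_trm t \<Longrightarrow> \<sigma> v = \<tau> v) \<Longrightarrow> eval_trm A \<sigma> t = eval_trm A \<tau> t"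
proof (induction t)
  case (App f ts)
  then have "map (eval_trm A \<sigma>) ts = map (eval_trm A \<tau>) ts" by fastforce
  then show ?case by (simp only: eval_trm.simps)
qed simp

lemma eval_trm_map:
  "eval_trm A \<sigma> (map_trm id g t) = eval_trm A (\<lambda>v. \<sigma> (g v)) t"
  by (induction t) (auto intro!: arg_cong[where f = "interp A _"])

lemma wf_trm_map: "wf_trm \<Sigma> (map_trm id g t) \<longleftrightarrow> wf_trm \<Sigma> t"
  by (induction t) auto

lemma eval_trm_closed:
  assumes "is_algebra \<Sigma> A" "wf_trm \<Sigma> t" "\<And>v. v \<in> vars_trm t \<Longrightarrow> \<sigma> v \<in> carrier A"
  shows "eval_trm A \<sigma> t \<in> carrier A"
  using assms(2,3)
proof (induction t)
  case (App f ts)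
  then have "set (map (eval_trm A \<sigma>) ts) \<subseteq> carrier A" by auto
  then show ?case using interp_in_carrier[OF assms(1)] App.prems(1) by simp
qed simp

definition homomorphism ::
  "'f signature \<Rightarrow> ('f, 'a) algebra \<Rightarrow> ('f, 'b) algebra \<Rightarrow> ('a \<Rightarrow> 'b) \<Rightarrow> bool" where
  "homomorphism \<Sigma> A B h \<longleftrightarrow> h \<in> carrier A \<rightarrow> carrier B \<and>
     (\<forall>f xs. (f, length xs) \<in> \<Sigma> \<and> set xs \<subseteq> carrier A \<longrightarrow>
        h (interp A f xs) = interp B f (map h xs))"

lemma homomorphism_closed: "homomorphism \<Sigma> A B h \<Longrightarrow> x \<in> carrier A \<Longrightarrow> h x \<in> carrier B"
  by (auto simp: homomorphism_def)

lemma homomorphism_interp: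
  "homomorphism \<Sigma> A B h \<Longrightarrow> (f, length xs) \<in> \<Sigma> \<Longrightarrow> set xs \<subseteq> carrier A \<Longrightarrow>
    h (interp A f xs) = interp B f (map h xs)"
  by (simp add: homomorphism_def)

lemma homomorphism_eval_trm:
  assumes A: "is_algebra \<Sigma> A" and h: "homomorphism \<Sigma> A B h"
    and "wf_trm \<Sigma> t" "\<And>v. v \<in> vars_trm t \<Longrightarrow> \<sigma> v \<in> carrier A"
  shows "h (eval_trm A \<sigma> t) = eval_trm B (\<lambda>v. h (\<sigma> v)) t"
  using assms(3,4)
proof (induction t)
  case (App f ts)
  have "h (interp A f (map (eval_trm A \<sigma>) ts)) = interp B f (map h (map (eval_trm A \<sigma>) ts))"
    by (rule homomorphism_interp[OF h]) (use App.prems in \<open>auto intro!: eval_trm_closed[OF A]\<close>)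
  also have "map h (map (eval_trm A \<sigma>) ts) = map (eval_trm B (\<lambda>v. h (\<sigma> v))) ts"
    using App by auto
  finally show ?case by simp
qed simp

text \<open>Serves to pull congruences of an arbitrary algebra back to the term algebra carried by
  \<open>universe\<close>, the type at which the hypotheses on the variety are available.\<close>

lemma vimage_in_Con:
  assumes A: "is_algebra \<Sigma> A" and h: "homomorphism \<Sigma> A B h" and \<theta>: "\<theta> \<in> Con \<Sigma> B"
  shows "{(x, y) \<in> Nabla A. (h x, h y) \<in> \<theta>} \<in> Con \<Sigma> A" (is "?K \<in> _")
proof (rule ConI)
  show "equiv (carrier A) ?K"
  proof (rule equivI)
    show "refl_on (carrier A) ?K"
      using Con_refl[OF \<theta>] homomorphism_closed[OF h] by (auto simp: refl_on_def Nabla_def)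
    show "sym ?K" using Con_sym[OF \<theta>] by (auto simp: sym_def Nabla_def)
    show "trans ?K" using Con_trans[OF \<theta>] unfolding trans_def Nabla_def by blast
  qed (auto simp: Nabla_def)
  fix f xs ys
  assume f: "(f, length xs) \<in> \<Sigma>" and xy: "list_all2 (\<lambda>x y. (x, y) \<in> ?K) xs ys"
  have l: "set xs \<subseteq> carrier A" "set ys \<subseteq> carrier A" "length ys = length xs"
    "list_all2 (\<lambda>x y. (x, y) \<in> \<theta>) (map h xs) (map h ys)"
    using xy by (auto simp: list_all2_conv_all_nth in_set_conv_nth Nabla_def)
  then have "(interp B f (map h xs), interp B f (map h ys)) \<in> \<theta>"
    using f by (intro Con_compatible[OF \<theta>]) auto
  then show "(interp A f xs, interp A f ys) \<in> ?K"
    using l f homomorphism_interp[OF h] interp_in_carrier[OF A] by (simp add: Nabla_def)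
qed

text \<open>Quotients are formed on representatives, so that they are carried by the same type.\<close>

definition rep :: "'a rel \<Rightarrow> 'a \<Rightarrow> 'a" where
  "rep \<theta> x = (SOME y. (x, y) \<in> \<theta>)"

definition quotient_algebra :: "('f, 'a) algebra \<Rightarrow> 'a rel \<Rightarrow> ('f, 'a) algebra" where
  "quotient_algebra A \<theta> = \<lparr>carrier = rep \<theta> ` carrier A, interp = (\<lambda>f xs. rep \<theta> (interp A f xs))\<rparr>"

lemma rep_related:
  assumes "\<theta> \<in> Con \<Sigma> A" "x \<in> carrier A" shows "(x, rep \<theta> x) \<in> \<theta>"
  unfolding rep_def using Con_refl[OF assms] by (rule someI)

lemma rep_eq_iff:
  assumes "\<theta> \<in> Con \<Sigma> A" "x \<in> carrier A" "y \<in> carrier A"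
  shows "rep \<theta> x = rep \<theta> y \<longleftrightarrow> (x, y) \<in> \<theta>"
proof
  assume "rep \<theta> x = rep \<theta> y"
  then show "(x, y) \<in> \<theta>"
    using rep_related[OF assms(1,2)] rep_related[OF assms(1,3)] Con_sym[OF assms(1)]
      Con_trans[OF assms(1)] by metis
next
  assume "(x, y) \<in> \<theta>"
  then have "(x, z) \<in> \<theta> \<longleftrightarrow> (y, z) \<in> \<theta>" for z
    using Con_sym[OF assms(1)] Con_trans[OF assms(1)] by blast
  then show "rep \<theta> x = rep \<theta> y" by (simp add: rep_def)
qed

lemma rep_closed: "\<theta> \<in> Con \<Sigma> A \<Longrightarrow> x \<in> carrier A \<Longrightarrow> rep \<theta> x \<in> carrier A"
  using rep_related Con_carrier by metis

lemma carrier_quotient_subset: "\<theta> \<in> Con \<Sigma> A \<Longrightarrow> carrier (quotient_algebra A \<theta>) \<subseteq> carrier A"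
  by (auto simp: quotient_algebra_def intro: rep_closed)

lemma quotient_is_algebra:
  assumes A: "is_algebra \<Sigma> A" and \<theta>: "\<theta> \<in> Con \<Sigma> A"
  shows "is_algebra \<Sigma> (quotient_algebra A \<theta>)"
  unfolding is_algebra_def
proof (intro conjI ballI impI, goal_cases)
  case 1
  then show ?case using A by (auto simp: quotient_algebra_def is_algebra_def)
next
  case (2 p)
  show ?case
  proof (cases p)
    case (Pair f n)
    have "interp (quotient_algebra A \<theta>) f xs \<in> carrier (quotient_algebra A \<theta>)"
      if "set xs \<subseteq> carrier (quotient_algebra A \<theta>)" "length xs = n" for xs
      using interp_in_carrier[OF A, of f xs] that 2 Pair carrier_quotient_subset[OF \<theta>]
      by (auto simp: quotient_algebra_def)
    then show ?thesis using Pair by (simp add: lists_eq_set)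
  qed
qed

lemma rep_homomorphism:
  assumes A: "is_algebra \<Sigma> A" and \<theta>: "\<theta> \<in> Con \<Sigma> A"
  shows "homomorphism \<Sigma> A (quotient_algebra A \<theta>) (rep \<theta>)"
proof -
  have "rep \<theta> (interp A f xs) = rep \<theta> (interp A f (map (rep \<theta>) xs))"
    if f: "(f, length xs) \<in> \<Sigma>" and xs: "set xs \<subseteq> carrier A" for f xs
  proof -
    have "list_all2 (\<lambda>x y. (x, y) \<in> \<theta>) xs (map (rep \<theta>) xs)"
      using xs by (auto simp: list_all2_conv_all_nth intro!: rep_related[OF \<theta>])
    then have *: "(interp A f xs, interp A f (map (rep \<theta>) xs)) \<in> \<theta>"
      by (rule Con_compatible[OF \<theta> f])
    then show ?thesis using rep_eq_iff[OF \<theta>] Con_carrier[OF \<theta> *] by blast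
  qed
  then show ?thesis by (auto simp: homomorphism_def quotient_algebra_def)
qed

text \<open>As the quotient is carried by representatives, the congruence corresponding to \<phi> is
  its restriction. It is compatible because the operations of the quotient differ from those of
  \<open>A\<close> by a step in \<theta>, which lies in \<phi>.\<close>

lemma rep_restrict_in_Con:
  assumes A: "is_algebra \<Sigma> A" and \<theta>: "\<theta> \<in> Con \<Sigma> A" and \<phi>: "\<phi> \<in> Con \<Sigma> A" and "\<theta> \<subseteq> \<phi>"
  shows "\<phi> \<inter> Nabla (quotient_algebra A \<theta>) \<in> Con \<Sigma> (quotient_algebra A \<theta>)" (is "?R \<in> _")
proof (rule ConI)
  note sub = carrier_quotient_subset[OF \<theta>]
  show "equiv (carrier (quotient_algebra A \<theta>)) ?R"
  proof (rule equivI)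
    show "refl_on (carrier (quotient_algebra A \<theta>)) ?R"
      using Con_refl[OF \<phi>] sub by (auto simp: refl_on_def Nabla_def)
    show "sym ?R" using Con_sym[OF \<phi>] by (auto simp: sym_def Nabla_def)
    show "trans ?R" using Con_trans[OF \<phi>] unfolding trans_def Nabla_def by blast
  qed (auto simp: Nabla_def)
  fix f xs ys
  assume f: "(f, length xs) \<in> \<Sigma>" and xy: "list_all2 (\<lambda>x y. (x, y) \<in> ?R) xs ys"
  have "list_all2 (\<lambda>x y. (x, y) \<in> \<phi>) xs ys"
    using xy by (rule list_all2_mono) auto
  then have i: "(interp A f xs, interp A f ys) \<in> \<phi>" (is "(?u, ?v) \<in> _")
    by (rule Con_compatible[OF \<phi> f])
  note uv = Con_carrier[OF \<phi> i]
  have "(?u, rep \<theta> ?u) \<in> \<phi>" "(?v, rep \<theta> ?v) \<in> \<phi>"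
    using rep_related[OF \<theta>] uv \<open>\<theta> \<subseteq> \<phi>\<close> by auto
  then have "(rep \<theta> ?u, rep \<theta> ?v) \<in> \<phi>"
    using i Con_sym[OF \<phi>] Con_trans[OF \<phi>] by blast
  then show "(interp (quotient_algebra A \<theta>) f xs, interp (quotient_algebra A \<theta>) f ys) \<in> ?R"
    using uv by (auto simp: quotient_algebra_def Nabla_def)
qed

definition square_algebra :: "('f, 'a) algebra \<Rightarrow> 'a rel \<Rightarrow> ('f, 'a \<times> 'a) algebra" where
  "square_algebra A \<beta> =
     \<lparr>carrier = \<beta>, interp = (\<lambda>f xs. (interp A f (map fst xs), interp A f (map snd xs)))\<rparr>"

lemma carrier_square [simp]: "carrier (square_algebra A \<beta>) = \<beta>"
  by (simp add: square_algebra_def)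

lemma interp_square:
  "interp (square_algebra A \<beta>) f xs = (interp A f (map fst xs), interp A f (map snd xs))"
  by (simp add: square_algebra_def)

lemma eval_trm_square:
  "eval_trm (square_algebra A \<beta>) \<sigma> t =
    (eval_trm A (\<lambda>v. fst (\<sigma> v)) t, eval_trm A (\<lambda>v. snd (\<sigma> v)) t)"
proof (induction t)
  case (App f ts)
  then have "map fst (map (eval_trm (square_algebra A \<beta>) \<sigma>) ts) = map (eval_trm A (\<lambda>v. fst (\<sigma> v))) ts"
    "map snd (map (eval_trm (square_algebra A \<beta>) \<sigma>) ts) = map (eval_trm A (\<lambda>v. snd (\<sigma> v))) ts"
    by auto
  then show ?case by (simp only: eval_trm.simps interp_square)
qed simp

lemma square_is_algebra:
  assumes "is_algebra \<Sigma> A" "\<beta> \<in> Con \<Sigma> A"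
  shows "is_algebra \<Sigma> (square_algebra A \<beta>)"
proof -
  have "interp (square_algebra A \<beta>) f xs \<in> \<beta>" if "(f, length xs) \<in> \<Sigma>" "set xs \<subseteq> \<beta>" for f xs
    unfolding interp_square
    by (rule Con_compatible[OF assms(2)]) (use that in \<open>auto simp: list_all2_conv_all_nth\<close>)
  moreover have "\<beta> \<noteq> {}"
    using assms Con_refl[OF assms(2)] by (auto simp: is_algebra_def)
  ultimately show ?thesis
    by (auto simp: is_algebra_def lists_eq_set)
qed

lemma square_in_variety:
  assumes "A \<in> variety \<Sigma> E" "\<beta> \<in> Con \<Sigma> A"
  shows "square_algebra A \<beta> \<in> variety \<Sigma> E"
proof -
  have "eval_trm (square_algebra A \<beta>) \<sigma> s = eval_trm (square_algebra A \<beta>) \<sigma> t"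
    if "(s, t) \<in> E" "range \<sigma> \<subseteq> \<beta>" for s t \<sigma>
  proof -
    have "range (\<lambda>v. fst (\<sigma> v)) \<subseteq> carrier A" "range (\<lambda>v. snd (\<sigma> v)) \<subseteq> carrier A"
      using that(2) Con_subset_Nabla[OF assms(2)] by (fastforce simp: Nabla_def)+
    then show ?thesis
      using assms(1) that(1) unfolding eval_trm_square variety_def by blast
  qed
  then show ?thesis
    using assms square_is_algebra by (auto simp: variety_def)
qed

section \<open>The relation of commutator matrices\<close>

text \<open>\<open>((p, q), (r, s))\<close> stands for the matrix with rows \<open>(p, q)\<close> and \<open>(r, s)\<close>: the rows are
  pairs of \<open>\<beta>\<close>, the columns are pairs of \<open>\<alpha>\<close>.\<close>

inductive_set matrices ::
  "'f signature \<Rightarrow> ('f, 'a) algebra \<Rightarrow> 'a rel \<Rightarrow> 'a rel \<Rightarrow> ('a \<times> 'a) rel"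
  for \<Sigma> A \<alpha> \<beta> where
  column: "(a, b) \<in> \<alpha> \<Longrightarrow> ((a, a), (b, b)) \<in> matrices \<Sigma> A \<alpha> \<beta>"
| row: "(c, d) \<in> \<beta> \<Longrightarrow> ((c, d), (c, d)) \<in> matrices \<Sigma> A \<alpha> \<beta>"
| interp: "(f, length xs) \<in> \<Sigma> \<Longrightarrow> list_all2 (\<lambda>x y. (x, y) \<in> matrices \<Sigma> A \<alpha> \<beta>) xs ys \<Longrightarrow>
    (interp (square_algebra A \<beta>) f xs, interp (square_algebra A \<beta>) f ys) \<in> matrices \<Sigma> A \<alpha> \<beta>"

lemma matrices_compatible: "compatible \<Sigma> (square_algebra A \<beta>) (matrices \<Sigma> A \<alpha> \<beta>)"
  by (rule compatibleI) (rule matrices.interp)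

lemma matrices_eval_trm:
  assumes "wf_trm \<Sigma> t" "\<And>v. v \<in> vars_trm t \<Longrightarrow> (\<sigma> v, \<tau> v) \<in> matrices \<Sigma> A \<alpha> \<beta>"
  shows "(eval_trm (square_algebra A \<beta>) \<sigma> t, eval_trm (square_algebra A \<beta>) \<tau> t) \<in> matrices \<Sigma> A \<alpha> \<beta>"
  using assms
proof (induction t)
  case (App f ts)
  have "list_all2 (\<lambda>x y. (x, y) \<in> matrices \<Sigma> A \<alpha> \<beta>)
      (map (eval_trm (square_algebra A \<beta>) \<sigma>) ts) (map (eval_trm (square_algebra A \<beta>) \<tau>) ts)"
    unfolding list_all2_map1 list_all2_map2
    by (rule list.rel_refl_strong) (use App in auto)
  from matrices.interp[OF _ this, of f] show ?case using App.prems(1) by simp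
qed simp

text \<open>The pairs from \<open>row\<close> are reflexive, so a congruence of the square only has
  to contain the columns.\<close>

lemma matrices_subset_Con:
  assumes \<theta>: "\<theta> \<in> Con \<Sigma> (square_algebra A \<beta>)" "\<And>a b. (a, b) \<in> \<alpha> \<Longrightarrow> ((a, a), (b, b)) \<in> \<theta>"
  shows "matrices \<Sigma> A \<alpha> \<beta> \<subseteq> \<theta>"
proof -
  have "(x, y) \<in> \<theta>" if "(x, y) \<in> matrices \<Sigma> A \<alpha> \<beta>" for x y
    using that
  proof (induction rule: matrices.induct)
    case (column a b)
    then show ?case by (rule \<theta>(2))
  next
    case (row c d)
    then show ?case using Con_refl[OF \<theta>(1)] by simp
  next
    case (interp f xs ys)
    have "list_all2 (\<lambda>x y. (x, y) \<in> \<theta>) xs ys"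
      using interp.IH by (rule list_all2_mono) auto
    then show ?case by (rule Con_compatible[OF \<theta>(1) interp.hyps])
  qed
  then show ?thesis by auto
qed

lemma matrices_subset:
  assumes A: "is_algebra \<Sigma> A" and \<alpha>: "\<alpha> \<in> Con \<Sigma> A" and \<beta>: "\<beta> \<in> Con \<Sigma> A"
  shows "matrices \<Sigma> A \<alpha> \<beta> \<subseteq> Nabla (square_algebra A \<beta>)"
  by (rule matrices_subset_Con[OF Nabla_in_Con[OF square_is_algebra[OF A \<beta>]]])
    (use Con_carrier[OF \<alpha>] Con_refl[OF \<beta>] in \<open>auto simp: Nabla_def\<close>)

lemma matrices_sym:
  assumes \<alpha>: "\<alpha> \<in> Con \<Sigma> A"
  shows "(x, y) \<in> matrices \<Sigma> A \<alpha> \<beta> \<Longrightarrow> (y, x) \<in> matrices \<Sigma> A \<alpha> \<beta>"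
proof (induction rule: matrices.induct)
  case (interp f xs ys)
  have "list_all2 (\<lambda>x y. (x, y) \<in> matrices \<Sigma> A \<alpha> \<beta>) ys xs"
    using interp.IH by (auto simp: list_all2_conv_all_nth)
  moreover have "length ys = length xs" using interp.IH by (auto simp: list_all2_lengthD)
  ultimately show ?case using interp.hyps by (intro matrices.interp) auto
qed (auto intro: matrices.column matrices.row Con_sym[OF \<alpha>])

text \<open>Transposition exchanges the two kinds of generators and commutes with the operations,
  which act entrywise. It lets the same matrices serve the term condition with its arguments in
  either order.\<close>

lemma matrices_transpose:
  assumes "((p, q), (r, s)) \<in> matrices \<Sigma> A \<alpha> \<beta>"
  shows "((p, r), (q, s)) \<in> matrices \<Sigma> A \<beta> \<alpha>"
proof -
  have "((fst x, fst y), (snd x, snd y)) \<in> matrices \<Sigma> A \<beta> \<alpha>" if "(x, y) \<in> matrices \<Sigma> A \<alpha> \<beta>" for x y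
    using that
  proof (induction rule: matrices.induct)
    case (interp f xs ys)
    let ?us = "map2 (\<lambda>x y. (fst x, fst y)) xs ys" and ?vs = "map2 (\<lambda>x y. (snd x, snd y)) xs ys"
    have l: "length ys = length xs" using interp.IH by (simp add: list_all2_lengthD)
    have "list_all2 (\<lambda>x y. (x, y) \<in> matrices \<Sigma> A \<beta> \<alpha>) ?us ?vs"
      using interp.IH by (auto simp: list_all2_conv_all_nth)
    then have "(Defs.interp (square_algebra A \<alpha>) f ?us, Defs.interp (square_algebra A \<alpha>) f ?vs)
        \<in> matrices \<Sigma> A \<beta> \<alpha>"
      using interp.hyps l by (intro matrices.interp) auto
    moreover have "map fst ?us = map fst xs" "map snd ?us = map fst ys"
      "map fst ?vs = map snd xs" "map snd ?vs = map snd ys"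
      using l by (auto simp: list_eq_iff_nth_eq)
    ultimately show ?case by (simp add: interp_square)
  qed (auto intro: matrices.column matrices.row)
  from this[OF assms] show ?thesis by simp
qed

text \<open>Reflexivity on \<beta> comes from \<open>row\<close> and symmetry from that of \<alpha>;
  only transitivity has to be added.\<close>

lemma matrices_trancl_in_Con:
  assumes A: "is_algebra \<Sigma> A" and \<alpha>: "\<alpha> \<in> Con \<Sigma> A" and \<beta>: "\<beta> \<in> Con \<Sigma> A"
  shows "(matrices \<Sigma> A \<alpha> \<beta>)\<^sup>+ \<in> Con \<Sigma> (square_algebra A \<beta>)"
  by (rule trancl_compatible_in_Con[OF matrices_subset[OF assms] _ _ matrices_compatible])
    (auto simp: sym_def intro: matrices.row matrices_sym[OF \<alpha>])

text \<open>Variables of the following term are the generators of the relation of matrices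
  themselves, so that no renaming is needed when terms are combined.\<close>

lemma matrices_termE:
  assumes "(x, y) \<in> matrices \<Sigma> A \<alpha> \<beta>"
  obtains t :: "('f, 'a \<times> 'a + 'a \<times> 'a) trm" where
    "wf_trm \<Sigma> t" "vars_trm t \<subseteq> Inl ` \<alpha> \<union> Inr ` \<beta>"
    "x = (eval_trm A (case_sum fst fst) t, eval_trm A (case_sum fst snd) t)"
    "y = (eval_trm A (case_sum snd fst) t, eval_trm A (case_sum snd snd) t)"
proof -
  define P where "P x y t \<longleftrightarrow> wf_trm \<Sigma> t \<and> vars_trm t \<subseteq> Inl ` \<alpha> \<union> Inr ` \<beta> \<and>
    x = (eval_trm A (case_sum fst fst) t, eval_trm A (case_sum fst snd) t) \<and>
    y = (eval_trm A (case_sum snd fst) t, eval_trm A (case_sum snd snd) t)" for x y t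
  have "\<exists>t. P x y t"
    using assms
  proof (induction rule: matrices.induct)
    case (column a b)
    then have "P (a, a) (b, b) (Var (Inl (a, b)))" by (simp add: P_def)
    then show ?case by blast
  next
    case (row c d)
    then have "P (c, d) (c, d) (Var (Inr (c, d)))" by (simp add: P_def)
    then show ?case by blast
  next
    case (interp f xs ys)
    have l: "length ys = length xs" using interp.IH by (simp add: list_all2_lengthD)
    have "\<forall>i<length xs. \<exists>t. P (xs ! i) (ys ! i) t"
      using interp.IH by (auto simp: list_all2_conv_all_nth)
    then obtain T where T: "\<And>i. i < length xs \<Longrightarrow> P (xs ! i) (ys ! i) (T i)" by metis
    define ts where "ts = map T [0..<length xs]"
    have ts: "length ts = length xs" "\<And>i. i < length xs \<Longrightarrow> P (xs ! i) (ys ! i) (ts ! i)"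
      using T by (auto simp: ts_def)
    have "wf_trm \<Sigma> t \<and> vars_trm t \<subseteq> Inl ` \<alpha> \<union> Inr ` \<beta>" if "t \<in> set ts" for t
      using that ts unfolding P_def in_set_conv_nth by metis
    then have "wf_trm \<Sigma> (App f ts)" "vars_trm (App f ts) \<subseteq> Inl ` \<alpha> \<union> Inr ` \<beta>"
      using ts(1) interp.hyps by auto
    moreover have
      "xs = map (\<lambda>t. (eval_trm A (case_sum fst fst) t, eval_trm A (case_sum fst snd) t)) ts"
    proof (rule nth_equalityI)
      fix i assume "i < length xs"
      then have "P (xs ! i) (ys ! i) (ts ! i)" "i < length ts" using ts by auto
      then show "xs ! i =
          map (\<lambda>t. (eval_trm A (case_sum fst fst) t, eval_trm A (case_sum fst snd) t)) ts ! i"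
        unfolding P_def by (simp only: nth_map)
    qed (simp add: ts(1))
    moreover have
      "ys = map (\<lambda>t. (eval_trm A (case_sum snd fst) t, eval_trm A (case_sum snd snd) t)) ts"
    proof (rule nth_equalityI)
      fix i assume "i < length ys"
      then have "P (xs ! i) (ys ! i) (ts ! i)" "i < length ts" using ts l by auto
      then show "ys ! i =
          map (\<lambda>t. (eval_trm A (case_sum snd fst) t, eval_trm A (case_sum snd snd) t)) ts ! i"
        unfolding P_def by (simp only: nth_map)
    qed (simp add: ts(1) l)
    ultimately have "P (Defs.interp (square_algebra A \<beta>) f xs) (Defs.interp (square_algebra A \<beta>) f ys) (App f ts)"
      by (simp add: P_def interp_square comp_def)
    then show ?case by blast
  qed
  then show ?thesis using that unfolding P_def by blast
qed

lemma finite_vars_trm: "finite (vars_trm t)"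
  by (induction t) auto

section \<open>The term condition expressed by matrices\<close>

text \<open>The term that produces the matrix has the generators as variables; numbering those of
  the columns before those of the rows makes it an instance of the term condition.\<close>

lemma centralizes_imp_matrices:
  assumes "centralizes \<Sigma> A \<alpha> \<beta> \<mu>" "((p, q), (r, s)) \<in> matrices \<Sigma> A \<alpha> \<beta>"
  shows "(p, q) \<in> \<mu> \<longleftrightarrow> (r, s) \<in> \<mu>"
proof -
  obtain t :: "('a, 'b \<times> 'b + 'b \<times> 'b) trm" where
    t: "wf_trm \<Sigma> t" "vars_trm t \<subseteq> Inl ` \<alpha> \<union> Inr ` \<beta>"
    "p = eval_trm A (case_sum fst fst) t" "q = eval_trm A (case_sum fst snd) t"
    "r = eval_trm A (case_sum snd fst) t" "s = eval_trm A (case_sum snd snd) t"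
    by (rule matrices_termE[OF assms(2)]) auto
  have fin: "finite (Inl -` vars_trm t)" "finite (Inr -` vars_trm t)"
    using finite_vars_trm[of t] by (auto intro: finite_vimageI)
  obtain ls where ls: "set ls = Inl -` vars_trm t" using finite_list[OF fin(1)] by blast
  obtain rs where rs: "set rs = Inr -` vars_trm t" using finite_list[OF fin(2)] by blast
  \<comment> \<open>The number of a variable is its position in \<open>ls\<close> followed by
    \<open>rs\<close>. With \<open>h\<close> and \<open>k\<close> quantified inside, one renaming
    works for all four entries; the implication leaves it arbitrary outside
    \<open>vars_trm t\<close>.\<close>
  have "\<exists>i. v \<in> vars_trm t \<longrightarrow> i < length ls + length rs \<and>
      (\<forall>(h :: 'b \<times> 'b \<Rightarrow> 'b) k. case_sum h k v = (map h ls @ map k rs) ! i)" for v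
  proof (cases v)
    case (Inl x)
    show ?thesis
    proof (cases "v \<in> vars_trm t")
      case True
      then obtain i where "i < length ls" "ls ! i = x"
        using ls Inl in_set_conv_nth[of x ls] by auto
      then show ?thesis using Inl by (intro exI[of _ i]) (auto simp: nth_append)
    qed blast
  next
    case (Inr x)
    show ?thesis
    proof (cases "v \<in> vars_trm t")
      case True
      then obtain i where "i < length rs" "rs ! i = x"
        using rs Inr in_set_conv_nth[of x rs] by auto
      then show ?thesis using Inr by (intro exI[of _ "length ls + i"]) (auto simp: nth_append)
    qed blast
  qed
  then obtain g where g: "\<And>v. v \<in> vars_trm t \<Longrightarrow> g v < length ls + length rs"
    "\<And>v (h :: 'b \<times> 'b \<Rightarrow> 'b) k. v \<in> vars_trm t \<Longrightarrow> case_sum h k v = (map h ls @ map k rs) ! g v"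
    by metis
  define u where "u = map_trm id g t"
  have u: "u \<in> terms_of_arity \<Sigma> (length ls + length rs)"
    using t(1) g(1) by (auto simp: u_def terms_of_arity_def wf_trm_map trm.set_map)
  have e: "term_op A u (map h ls @ map k rs) = eval_trm A (case_sum h k) t" for h k
    unfolding term_op_def u_def eval_trm_map by (rule eval_trm_cong) (simp add: g(2))
  have "list_all2 (\<lambda>a b. (a, b) \<in> \<alpha>) (map fst ls) (map snd ls)"
    "list_all2 (\<lambda>a b. (a, b) \<in> \<beta>) (map fst rs) (map snd rs)"
    using ls rs t(2) by (auto simp: list_all2_conv_all_nth dest!: nth_mem)
  then have "(term_op A u (map fst ls @ map fst rs), term_op A u (map fst ls @ map snd rs)) \<in> \<mu> \<longleftrightarrow>
      (term_op A u (map snd ls @ map fst rs), term_op A u (map snd ls @ map snd rs)) \<in> \<mu>"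
    using assms(1) u unfolding centralizes_def by (metis length_map)
  then show ?thesis unfolding e t(3-6) .
qed

lemma matrices_imp_centralizes:
  assumes "\<And>p q r s. ((p, q), (r, s)) \<in> matrices \<Sigma> A \<alpha> \<beta> \<Longrightarrow> (p, q) \<in> \<mu> \<longleftrightarrow> (r, s) \<in> \<mu>"
  shows "centralizes \<Sigma> A \<alpha> \<beta> \<mu>"
  unfolding centralizes_def
proof (intro allI ballI impI, elim conjE)
  fix n k t as bs cs ds
  assume t: "t \<in> terms_of_arity \<Sigma> (n + k)" and l: "length as = n" "length cs = k"
    and ab: "list_all2 (\<lambda>a b. (a, b) \<in> \<alpha>) as bs" and cd: "list_all2 (\<lambda>c d. (c, d) \<in> \<beta>) cs ds"
  have l': "length bs = n" "length ds = k" using l ab cd by (auto dest: list_all2_lengthD)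
  let ?x = "\<lambda>v. ((as @ cs) ! v, (as @ ds) ! v)" and ?y = "\<lambda>v. ((bs @ cs) ! v, (bs @ ds) ! v)"
  have "(?x v, ?y v) \<in> matrices \<Sigma> A \<alpha> \<beta>" if "v \<in> vars_trm t" for v
  proof (cases "v < n")
    case True
    then show ?thesis using ab l l'
      by (auto simp: nth_append list_all2_conv_all_nth intro: matrices.column)
  next
    case False
    have "v < n + k" using t that by (auto simp: terms_of_arity_def)
    then have "(cs ! (v - n), ds ! (v - n)) \<in> \<beta>"
      using False cd l by (auto simp: list_all2_conv_all_nth)
    then show ?thesis using False l l' by (auto simp: nth_append intro: matrices.row)
  qed
  moreover have "wf_trm \<Sigma> t" using t by (simp add: terms_of_arity_def)
  ultimately have "(eval_trm (square_algebra A \<beta>) ?x t, eval_trm (square_algebra A \<beta>) ?y t) \<in> matrices \<Sigma> A \<alpha> \<beta>"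
    by (intro matrices_eval_trm)
  then show "((term_op A t (as @ cs), term_op A t (as @ ds)) \<in> \<mu>) =
      ((term_op A t (bs @ cs), term_op A t (bs @ ds)) \<in> \<mu>)"
    using assms by (simp add: eval_trm_square term_op_def)
qed

text \<open>This removes terms and arities from the term condition, so that the arguments below
  concern relations on the square.\<close>

lemma centralizes_iff_matrices:
  "centralizes \<Sigma> A \<alpha> \<beta> \<mu> \<longleftrightarrow>
    (\<forall>x y. (x, y) \<in> matrices \<Sigma> A \<alpha> \<beta> \<longrightarrow> x \<in> \<mu> \<longleftrightarrow> y \<in> \<mu>)"
  using centralizes_imp_matrices[of \<Sigma> A \<alpha> \<beta> \<mu>] matrices_imp_centralizes[of \<Sigma> A \<alpha> \<beta> \<mu>]
  by (metis surj_pair)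

lemma centralizesD:
  "centralizes \<Sigma> A \<alpha> \<beta> \<mu> \<Longrightarrow> (x, y) \<in> matrices \<Sigma> A \<alpha> \<beta> \<Longrightarrow> x \<in> \<mu> \<longleftrightarrow> y \<in> \<mu>"
  unfolding centralizes_iff_matrices by blast

lemma centralizes_trancl:
  assumes "centralizes \<Sigma> A \<alpha> \<beta> \<mu>" "(x, y) \<in> (matrices \<Sigma> A \<alpha> \<beta>)\<^sup>+"
  shows "x \<in> \<mu> \<longleftrightarrow> y \<in> \<mu>"
  using assms(2)
  by (induction rule: trancl_induct) (use centralizesD[OF assms(1)] in blast)+

lemma centralizes_mono:
  assumes "centralizes \<Sigma> A \<alpha> \<beta> \<mu>" "\<alpha>' \<subseteq> \<alpha>" "\<beta>' \<subseteq> \<beta>"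
  shows "centralizes \<Sigma> A \<alpha>' \<beta>' \<mu>"
proof -
  have "list_all2 (\<lambda>a b. (a, b) \<in> \<alpha>) as bs" if "list_all2 (\<lambda>a b. (a, b) \<in> \<alpha>') as bs" for as bs
    using that assms(2) by (auto elim: list_all2_mono)
  moreover have "list_all2 (\<lambda>a b. (a, b) \<in> \<beta>) as bs" if "list_all2 (\<lambda>a b. (a, b) \<in> \<beta>') as bs" for as bs
    using that assms(3) by (auto elim: list_all2_mono)
  ultimately show ?thesis using assms(1) unfolding centralizes_def by meson
qed

section \<open>The commutator as the least centralizing congruence\<close>

lemma commutator_mono:
  "\<alpha>' \<subseteq> \<alpha> \<Longrightarrow> \<beta>' \<subseteq> \<beta> \<Longrightarrow> commutator \<Sigma> A \<alpha>' \<beta>' \<subseteq> commutator \<Sigma> A \<alpha> \<beta>"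
  unfolding commutator_def using centralizes_mono by blast

lemma centralizes_Nabla:
  assumes A: "is_algebra \<Sigma> A" and \<alpha>: "\<alpha> \<in> Con \<Sigma> A" and \<beta>: "\<beta> \<in> Con \<Sigma> A"
  shows "centralizes \<Sigma> A \<alpha> \<beta> (Nabla A)"
  unfolding centralizes_iff_matrices
  using matrices_subset[OF assms] Con_subset_Nabla[OF \<beta>] by (auto simp: Nabla_def)

lemma commutator_in_Con:
  assumes "is_algebra \<Sigma> A" "\<alpha> \<in> Con \<Sigma> A" "\<beta> \<in> Con \<Sigma> A"
  shows "commutator \<Sigma> A \<alpha> \<beta> \<in> Con \<Sigma> A"
  unfolding commutator_def
  by (rule Inter_in_Con) (use centralizes_Nabla[OF assms] Nabla_in_Con[OF assms(1)] in auto)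

text \<open>If for each \<mu> of a family both rows of a matrix belong to \<mu> or neither does, the
  same holds for the intersection of the family.\<close>

lemma centralizes_commutator: "centralizes \<Sigma> A \<alpha> \<beta> (commutator \<Sigma> A \<alpha> \<beta>)"
  unfolding centralizes_iff_matrices commutator_def by blast

lemma commutator_least: "\<mu> \<in> Con \<Sigma> A \<Longrightarrow> centralizes \<Sigma> A \<alpha> \<beta> \<mu> \<Longrightarrow> commutator \<Sigma> A \<alpha> \<beta> \<subseteq> \<mu>"
  by (auto simp: commutator_def)

text \<open>A pair of the join is linked by steps from \<alpha> and \<alpha>', so its column lies in
  the transitive closure of the union of the two relations of matrices. This closure is a congruence
  of the square and so contains all matrices of the join; membership in \<mu> is constant along each
  link.\<close>

lemma centralizes_Un:
  assumes A: "is_algebra \<Sigma> A" and \<alpha>: "\<alpha> \<in> Con \<Sigma> A" "\<alpha>' \<in> Con \<Sigma> A" and \<beta>: "\<beta> \<in> Con \<Sigma> A"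
    and c: "centralizes \<Sigma> A \<alpha> \<beta> \<mu>" "centralizes \<Sigma> A \<alpha>' \<beta> \<mu>"
  shows "centralizes \<Sigma> A (Cg \<Sigma> A (\<alpha> \<union> \<alpha>')) \<beta> \<mu>"
proof -
  let ?M = "matrices \<Sigma> A \<alpha> \<beta>" and ?M' = "matrices \<Sigma> A \<alpha>' \<beta>"
  have "((a, a), (b, b)) \<in> (?M \<union> ?M')\<^sup>+" if "(a, b) \<in> (\<alpha> \<union> \<alpha>')\<^sup>+" for a b
    using that
  proof (induction rule: trancl_induct)
    case (base y)
    then show ?case by (auto intro: matrices.column)
  next
    case (step y z)
    then have "((y, y), (z, z)) \<in> ?M \<union> ?M'" by (auto intro: matrices.column)
    then show ?case using step.IH by (rule trancl_into_trancl[rotated])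
  qed
  moreover have "(\<Union>{?M, ?M'})\<^sup>+ \<in> Con \<Sigma> (square_algebra A \<beta>)"
    by (rule trancl_Union_compatible_in_Con)
      (use matrices_subset[OF A _ \<beta>] \<alpha> matrices_compatible in
        \<open>auto simp: sym_def intro: matrices.row matrices_sym\<close>)
  ultimately have "matrices \<Sigma> A (Cg \<Sigma> A (\<alpha> \<union> \<alpha>')) \<beta> \<subseteq> (?M \<union> ?M')\<^sup>+"
    unfolding Cg_Un_eq_trancl[OF \<alpha>] by (intro matrices_subset_Con) auto
  moreover have "x \<in> \<mu> \<longleftrightarrow> y \<in> \<mu>" if "(x, y) \<in> (?M \<union> ?M')\<^sup>+" for x y
    using that by (induction rule: trancl_induct) (use c[THEN centralizesD] in blast)+
  ultimately show ?thesis unfolding centralizes_iff_matrices by blast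
qed

section \<open>Quotients of the term algebra\<close>

text \<open>Evaluation in the quotient is evaluation in \<open>B\<close> followed by
  \<open>rep \<theta>\<close>, so identities valid modulo \<theta> become equations. Meant for the
  term algebra, in which the identities need not hold themselves.\<close>

lemma quotient_in_variety:
  assumes B: "is_algebra \<Sigma> B" and \<theta>: "\<theta> \<in> Con \<Sigma> B" and E: "wf_identities \<Sigma> E"
    and id: "\<And>s t \<rho>. (s, t) \<in> E \<Longrightarrow> range \<rho> \<subseteq> carrier B \<Longrightarrow> (eval_trm B \<rho> s, eval_trm B \<rho> t) \<in> \<theta>"
  shows "quotient_algebra B \<theta> \<in> variety \<Sigma> E"
proof -
  let ?Q = "quotient_algebra B \<theta>"
  have "eval_trm ?Q \<sigma> s = eval_trm ?Q \<sigma> t" if st: "(s, t) \<in> E" and \<sigma>: "range \<sigma> \<subseteq> carrier ?Q" for s t \<sigma>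
  proof -
    have "\<exists>x\<in>carrier B. \<sigma> v = rep \<theta> x" for v
      using \<sigma> by (auto simp: quotient_algebra_def)
    then obtain \<rho> where \<rho>: "\<And>v. \<rho> v \<in> carrier B" "\<And>v. \<sigma> v = rep \<theta> (\<rho> v)" by metis
    have wf: "wf_trm \<Sigma> s" "wf_trm \<Sigma> t" using E st by (auto simp: wf_identities_def)
    have \<sigma>_eq: "\<sigma> = (\<lambda>v. rep \<theta> (\<rho> v))" using \<rho>(2) by blast
    have "eval_trm ?Q \<sigma> u = rep \<theta> (eval_trm B \<rho> u)" if "wf_trm \<Sigma> u" for u
      unfolding \<sigma>_eq using homomorphism_eval_trm[OF B rep_homomorphism[OF B \<theta>] that, of \<rho>] \<rho>(1) by simp
    moreover have "rep \<theta> (eval_trm B \<rho> s) = rep \<theta> (eval_trm B \<rho> t)"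
      using id[OF st, of \<rho>] \<rho>(1) rep_eq_iff[OF \<theta>] Con_carrier[OF \<theta>] by blast
    ultimately show ?thesis using wf by simp
  qed
  then show ?thesis using quotient_is_algebra[OF B \<theta>] by (auto simp: variety_def)
qed

definition term_algebra :: "'f signature \<Rightarrow> ('f, ('f, 'v) trm) algebra" where
  "term_algebra \<Sigma> = \<lparr>carrier = {t. wf_trm \<Sigma> t}, interp = App\<rparr>"

lemma term_algebra_simps [simp]:
  "carrier (term_algebra \<Sigma>) = {t. wf_trm \<Sigma> t}" "interp (term_algebra \<Sigma>) = App"
  by (simp_all add: term_algebra_def)

lemma term_is_algebra: "is_algebra \<Sigma> (term_algebra \<Sigma> :: ('f, ('f, 'v) trm) algebra)"
proof -
  have "wf_trm \<Sigma> (Var v :: ('f, 'v) trm)" for v by simp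
  then show ?thesis by (auto simp: is_algebra_def lists_eq_set simp del: wf_trm.simps(1))
qed

lemma eval_trm_homomorphism:
  assumes "is_algebra \<Sigma> B" "range \<sigma> \<subseteq> carrier B"
  shows "homomorphism \<Sigma> (term_algebra \<Sigma>) B (eval_trm B \<sigma>)"
  using eval_trm_closed[OF assms(1), of _ \<sigma>] assms(2) by (auto simp: homomorphism_def)

text \<open>For all assignments this is the kernel of the map onto the free algebra of the variety
  generated by \<open>A\<close>. Restricting \<open>P\<close> by equations between variables gives
  the kernel of the map that also identifies these variables.\<close>

definition term_kernel :: "'f signature \<Rightarrow> ('f, 'a) algebra \<Rightarrow> ('v \<Rightarrow> 'a) set \<Rightarrow> ('f, 'v) trm rel" where
  "term_kernel \<Sigma> A P = {(s, t). wf_trm \<Sigma> s \<and> wf_trm \<Sigma> t \<and> (\<forall>\<sigma>\<in>P. eval_trm A \<sigma> s = eval_trm A \<sigma> t)}"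

lemma term_kernel_in_Con: "term_kernel \<Sigma> A P \<in> Con \<Sigma> (term_algebra \<Sigma>)"
proof (rule ConI)
  show "equiv (carrier (term_algebra \<Sigma>)) (term_kernel \<Sigma> A P)"
    by (rule equivI) (auto simp: term_kernel_def refl_on_def sym_def trans_def)
  fix f xs ys
  assume f: "(f, length xs) \<in> \<Sigma>" and xy: "list_all2 (\<lambda>x y. (x, y) \<in> term_kernel \<Sigma> A P) xs ys"
  have l: "length ys = length xs" using xy by (simp add: list_all2_lengthD)
  have "map (eval_trm A \<sigma>) xs = map (eval_trm A \<sigma>) ys" if "\<sigma> \<in> P" for \<sigma>
    using xy that by (auto simp: list_all2_conv_all_nth term_kernel_def intro: nth_equalityI)
  moreover have "\<forall>t\<in>set xs \<union> set ys. wf_trm \<Sigma> t"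
    using xy by (auto simp: list_all2_conv_all_nth term_kernel_def in_set_conv_nth)
  ultimately show "(interp (term_algebra \<Sigma>) f xs, interp (term_algebra \<Sigma>) f ys) \<in> term_kernel \<Sigma> A P"
    using f l by (auto simp: term_kernel_def)
qed

lemma term_kernel_mono: "P \<subseteq> Q \<Longrightarrow> term_kernel \<Sigma> A Q \<subseteq> term_kernel \<Sigma> A P"
  by (auto simp: term_kernel_def)

abbreviation assignments :: "('f, 'a) algebra \<Rightarrow> ('v \<Rightarrow> 'a) set" where
  "assignments A \<equiv> {\<sigma>. range \<sigma> \<subseteq> carrier A}"

text \<open>Substituting terms into an identity of \<open>A\<close> yields another identity of
  \<open>A\<close>, whose sides are related by the kernel and hence by \<theta>. With variables from
  \<open>'a + nat\<close> these quotients are carried by \<open>universe\<close>.\<close>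

lemma term_quotient_in_variety:
  fixes \<theta> :: "('f, 'v) trm rel"
  assumes A: "A \<in> variety \<Sigma> E" and E: "wf_identities \<Sigma> E"
    and \<theta>: "\<theta> \<in> Con \<Sigma> (term_algebra \<Sigma>)" "term_kernel \<Sigma> A (assignments A) \<subseteq> \<theta>"
  shows "quotient_algebra (term_algebra \<Sigma>) \<theta> \<in> variety \<Sigma> E"
proof (rule quotient_in_variety[OF term_is_algebra \<theta>(1) E])
  fix s t and \<rho> :: "nat \<Rightarrow> ('f, 'v) trm"
  assume st: "(s, t) \<in> E" and \<rho>: "range \<rho> \<subseteq> carrier (term_algebra \<Sigma>)"
  have alg: "is_algebra \<Sigma> A" using A by (simp add: variety_def)
  have wf: "wf_trm \<Sigma> s" "wf_trm \<Sigma> t" using E st by (auto simp: wf_identities_def)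
  have e: "eval_trm A \<sigma> (eval_trm (term_algebra \<Sigma>) \<rho> u) = eval_trm A (\<lambda>v. eval_trm A \<sigma> (\<rho> v)) u"
    if "wf_trm \<Sigma> u" "\<sigma> \<in> assignments A" for u \<sigma>
    by (rule homomorphism_eval_trm[OF term_is_algebra eval_trm_homomorphism[OF alg] that(1)])
      (use that \<rho> in auto)
  have "eval_trm A (\<lambda>v. eval_trm A \<sigma> (\<rho> v)) s = eval_trm A (\<lambda>v. eval_trm A \<sigma> (\<rho> v)) t"
    if "\<sigma> \<in> assignments A" for \<sigma>
  proof -
    have "eval_trm A \<sigma> (\<rho> v) \<in> carrier A" for v
      by (rule eval_trm_closed[OF alg]) (use \<rho> that in auto)
    then have "range (\<lambda>v. eval_trm A \<sigma> (\<rho> v)) \<subseteq> carrier A" by blast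
    then show ?thesis using A st unfolding variety_def by blast
  qed
  moreover have "wf_trm \<Sigma> (eval_trm (term_algebra \<Sigma>) \<rho> u)" if "wf_trm \<Sigma> u" for u
    using eval_trm_closed[OF term_is_algebra that, of \<rho>] \<rho> by auto
  ultimately have "(eval_trm (term_algebra \<Sigma>) \<rho> s, eval_trm (term_algebra \<Sigma>) \<rho> t)
      \<in> term_kernel \<Sigma> A (assignments A)"
    unfolding term_kernel_def using e wf by auto
  then show "(eval_trm (term_algebra \<Sigma>) \<rho> s, eval_trm (term_algebra \<Sigma>) \<rho> t) \<in> \<theta>"
    using \<theta>(2) by blast
qed

section \<open>Day's condition and commutativity of the commutator\<close>

text \<open>Modularity is known for members of the variety only, so the law is applied in the
  quotient and brought back along representatives. The chain puts \<open>(x, u)\<close> into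
  (\<gamma> \<or> \<alpha>) \<inter> \<beta>, which is \<gamma> \<or> (\<alpha> \<inter> \<beta>) by
  \<gamma> \<subseteq> \<beta>.\<close>

lemma modular_quotient_law:
  fixes B :: "('f, 'u) algebra"
  assumes mod: "congruence_modular TYPE('u) \<Sigma> E"
    and B: "is_algebra \<Sigma> B" and \<theta>: "\<theta> \<in> Con \<Sigma> B" and Q: "quotient_algebra B \<theta> \<in> variety \<Sigma> E"
    and \<alpha>: "\<alpha> \<in> Con \<Sigma> B" "\<theta> \<subseteq> \<alpha>" and \<beta>: "\<beta> \<in> Con \<Sigma> B" "\<gamma> \<subseteq> \<beta>" and \<gamma>: "\<gamma> \<in> Con \<Sigma> B" "\<theta> \<subseteq> \<gamma>"
    and chain: "(x, y) \<in> \<alpha>" "(y, z) \<in> \<gamma>" "(z, u) \<in> \<alpha>" "(x, u) \<in> \<beta>"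
  shows "(x, u) \<in> Cg \<Sigma> B (\<alpha> \<inter> \<beta> \<union> \<gamma>)"
proof -
  let ?Q = "quotient_algebra B \<theta>"
  let ?r = "\<lambda>\<phi>. \<phi> \<inter> Nabla ?Q"
  note Qalg = quotient_is_algebra[OF B \<theta>]
  define \<phi> where "\<phi> = Cg \<Sigma> B (\<alpha> \<inter> \<beta> \<union> \<gamma>)"
  have \<phi>: "\<phi> \<in> Con \<Sigma> B" "\<alpha> \<inter> \<beta> \<union> \<gamma> \<subseteq> \<phi>"
    unfolding \<phi>_def by (rule Cg_Un_in_Con[OF Int_in_Con[OF \<alpha>(1) \<beta>(1)] \<gamma>(1)], rule Cg_superset)
  have R: "?r \<psi> \<in> Con \<Sigma> ?Q" if "\<psi> \<in> Con \<Sigma> B" "\<theta> \<subseteq> \<psi>" for \<psi>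
    by (rule rep_restrict_in_Con[OF B \<theta> that])
  have rel: "(rep \<theta> a, rep \<theta> b) \<in> ?r \<psi>" if \<psi>: "\<psi> \<in> Con \<Sigma> B" "\<theta> \<subseteq> \<psi>" and ab: "(a, b) \<in> \<psi>" for a b \<psi>
  proof -
    have c: "a \<in> carrier B" "b \<in> carrier B" using Con_carrier[OF \<psi>(1) ab] by auto
    then have "(a, rep \<theta> a) \<in> \<psi>" "(b, rep \<theta> b) \<in> \<psi>"
      using rep_related[OF \<theta>] \<psi>(2) by blast+
    then have "(rep \<theta> a, rep \<theta> b) \<in> \<psi>"
      using ab Con_sym[OF \<psi>(1)] Con_trans[OF \<psi>(1)] by blast
    then show ?thesis using c by (simp add: Nabla_def quotient_algebra_def)
  qed
  have \<theta>': "\<theta> \<subseteq> \<beta>" using \<beta> \<gamma> by blast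
  have m: "modular_lattice (Con_lattice \<Sigma> ?Q)"
    using mod Q by (simp add: congruence_modular_def)
  have law: "Cg \<Sigma> ?Q (?r \<gamma> \<union> (?r \<alpha> \<inter> ?r \<beta>)) = Cg \<Sigma> ?Q (?r \<gamma> \<union> ?r \<alpha>) \<inter> ?r \<beta>"
  proof -
    have c: "?r \<alpha> \<in> Con \<Sigma> ?Q" "?r \<beta> \<in> Con \<Sigma> ?Q" "?r \<gamma> \<in> Con \<Sigma> ?Q"
      using R \<alpha> \<beta>(1) \<theta>' \<gamma> by auto
    have "?r \<gamma> \<subseteq> ?r \<beta>" using \<beta>(2) by blast
    then have "?r \<gamma> \<squnion>\<^bsub>Con_lattice \<Sigma> ?Q\<^esub> (?r \<alpha> \<sqinter>\<^bsub>Con_lattice \<Sigma> ?Q\<^esub> ?r \<beta>) =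
        (?r \<gamma> \<squnion>\<^bsub>Con_lattice \<Sigma> ?Q\<^esub> ?r \<alpha>) \<sqinter>\<^bsub>Con_lattice \<Sigma> ?Q\<^esub> ?r \<beta>"
      using m c \<open>?r \<gamma> \<subseteq> ?r \<beta>\<close> unfolding modular_lattice_def Con_lattice_simps by blast
    then show ?thesis
      using c by (simp only: Con_lattice_ops[OF Qalg] Int_in_Con Cg_Un_in_Con)
  qed
  have "(rep \<theta> x, rep \<theta> u) \<in> Cg \<Sigma> ?Q (?r \<gamma> \<union> ?r \<alpha>)"
  proof -
    let ?C = "Cg \<Sigma> ?Q (?r \<gamma> \<union> ?r \<alpha>)"
    have C: "?C \<in> Con \<Sigma> ?Q" by (rule Cg_Un_in_Con[OF R[OF \<gamma>] R[OF \<alpha>]])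
    have "(rep \<theta> x, rep \<theta> y) \<in> ?C" "(rep \<theta> y, rep \<theta> z) \<in> ?C" "(rep \<theta> z, rep \<theta> u) \<in> ?C"
      using rel[OF \<alpha> chain(1)] rel[OF \<gamma> chain(2)] rel[OF \<alpha> chain(3)] Cg_superset[of "?r \<gamma> \<union> ?r \<alpha>" \<Sigma> ?Q]
      by blast+
    then show ?thesis using Con_trans[OF C] by blast
  qed
  moreover have "(rep \<theta> x, rep \<theta> u) \<in> ?r \<beta>" by (rule rel[OF \<beta>(1) \<theta>' chain(4)])
  ultimately have "(rep \<theta> x, rep \<theta> u) \<in> Cg \<Sigma> ?Q (?r \<gamma> \<union> (?r \<alpha> \<inter> ?r \<beta>))"
    unfolding law by blast
  moreover have "Cg \<Sigma> ?Q (?r \<gamma> \<union> (?r \<alpha> \<inter> ?r \<beta>)) \<subseteq> ?r \<phi>"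
    by (rule Cg_least) (use R[OF \<phi>(1)] \<phi>(2) \<gamma>(2) in auto)
  ultimately have "(rep \<theta> x, rep \<theta> u) \<in> \<phi>" by blast
  moreover have "(x, rep \<theta> x) \<in> \<phi>" "(u, rep \<theta> u) \<in> \<phi>"
    using rep_related[OF \<theta>] Con_carrier[OF \<beta>(1) chain(4)] \<gamma>(2) \<phi>(2) by blast+
  ultimately show ?thesis
    unfolding \<phi>_def[symmetric] using Con_sym[OF \<phi>(1)] Con_trans[OF \<phi>(1)] by blast
qed

section \<open>Day terms\<close>

text \<open>The variables \<open>Inr 0\<close> to \<open>Inr 3\<close> play the roles of x, y, z, u.
  Every other variable also receives \<open>a\<close>, so that the assignment stays in the carrier
  when the four values do.\<close>

definition quad :: "'a \<Rightarrow> 'a \<Rightarrow> 'a \<Rightarrow> 'a \<Rightarrow> 'b + nat \<Rightarrow> 'a" where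
  "quad a b c d v = (if v = Inr 1 then b else if v = Inr 2 then c else if v = Inr 3 then d else a)"

text \<open>Day's identity m(x, y, y, x) = x in \<open>A\<close>. Further variables may occur in the
  terms; the identity holds for all their values.\<close>

definition day_terms :: "'f signature \<Rightarrow> ('f, 'a) algebra \<Rightarrow> ('f, 'a) universe set" where
  "day_terms \<Sigma> A = {t. wf_trm \<Sigma> t \<and> (\<forall>\<sigma>\<in>assignments A.
     \<sigma> (Inr 0) = \<sigma> (Inr 3) \<and> \<sigma> (Inr 1) = \<sigma> (Inr 2) \<longrightarrow> eval_trm A \<sigma> t = \<sigma> (Inr 0))}"

text \<open>The usual Day terms arise from the chain in the free algebra on \<open>x\<close>, \<open>y\<close>, \<open>z\<close>, \<open>u\<close>
  that connects \<open>x\<close> with \<open>u\<close> by the modular law applied to the congruences generated by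
  \<open>{(x, y), (z, u)}\<close>, \<open>{(x, u), (y, z)}\<close> and \<open>{(y, z)}\<close>. Here the chain is not extracted: the
  condition is required for all terms, and carried along the chain.\<close>

lemma day_condition:
  fixes A :: "('f, 'a) algebra"
  assumes mod: "congruence_modular TYPE(('f, 'a) universe) \<Sigma> E" and E: "wf_identities \<Sigma> E"
    and A: "A \<in> variety \<Sigma> E" and \<delta>: "\<delta> \<in> Con \<Sigma> A"
    and pq: "(p, q) \<in> \<delta>" and rs: "r \<in> carrier A" "s \<in> carrier A"
    and day: "\<And>t. t \<in> day_terms \<Sigma> A \<Longrightarrow>
      (eval_trm A (quad r r s s) t, eval_trm A (quad r p q s) t) \<in> \<delta>"
  shows "(r, s) \<in> \<delta>"
proof -
  let ?T = "term_algebra \<Sigma> :: ('f, ('f, 'a) universe) algebra"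
  define K where "K = (\<lambda>P. term_kernel \<Sigma> A {\<sigma> :: 'a + nat \<Rightarrow> 'a. range \<sigma> \<subseteq> carrier A \<and> P \<sigma>})"
  have K: "K P \<in> Con \<Sigma> ?T" for P unfolding K_def by (rule term_kernel_in_Con)
  define \<theta> where "\<theta> = K (\<lambda>\<sigma>. True)"
  define \<alpha> where "\<alpha> = K (\<lambda>\<sigma>. \<sigma> (Inr 0) = \<sigma> (Inr 1) \<and> \<sigma> (Inr 2) = \<sigma> (Inr 3))"
  define \<beta> where "\<beta> = K (\<lambda>\<sigma>. \<sigma> (Inr 0) = \<sigma> (Inr 3) \<and> \<sigma> (Inr 1) = \<sigma> (Inr 2))"
  define \<gamma> where "\<gamma> = K (\<lambda>\<sigma>. \<sigma> (Inr 1) = \<sigma> (Inr 2))"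
  have Q: "quotient_algebra ?T \<theta> \<in> variety \<Sigma> E"
    by (rule term_quotient_in_variety[OF A E]) (auto simp: \<theta>_def K_def term_kernel_in_Con)
  have "(Var (Inr 0), Var (Inr 3)) \<in> Cg \<Sigma> ?T (\<alpha> \<inter> \<beta> \<union> \<gamma>)"
  proof (rule modular_quotient_law[OF mod term_is_algebra _ Q])
    show "(Var (Inr 0), Var (Inr 1)) \<in> \<alpha>" "(Var (Inr 1), Var (Inr 2)) \<in> \<gamma>"
      "(Var (Inr 2), Var (Inr 3)) \<in> \<alpha>" "(Var (Inr 0), Var (Inr 3)) \<in> \<beta>"
      by (auto simp: \<alpha>_def \<beta>_def \<gamma>_def K_def term_kernel_def)
    show "\<theta> \<subseteq> \<alpha>" "\<gamma> \<subseteq> \<beta>" "\<theta> \<subseteq> \<gamma>"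
      unfolding \<alpha>_def \<beta>_def \<gamma>_def \<theta>_def K_def by (rule term_kernel_mono, blast)+
  qed (simp_all add: \<theta>_def \<alpha>_def \<beta>_def \<gamma>_def K)
  then have "(Var (Inr 0), Var (Inr 3)) \<in> (\<alpha> \<inter> \<beta> \<union> \<gamma>)\<^sup>+"
    using Cg_Un_eq_trancl[OF Int_in_Con[of \<alpha>] , of \<Sigma> ?T \<beta> \<gamma>] K by (simp add: \<alpha>_def \<beta>_def \<gamma>_def)
  \<comment> \<open>Invariant along the chain, which leads from \<open>Var (Inr 0)\<close>, with
    value \<open>r\<close>, to \<open>Var (Inr 3)\<close>, with value \<open>s\<close>.\<close>
  moreover have "t \<in> day_terms \<Sigma> A \<and> (r, eval_trm A (quad r p q s) t) \<in> \<delta>"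
    if "(Var (Inr 0), t) \<in> (\<alpha> \<inter> \<beta> \<union> \<gamma>)\<^sup>+" for t
  proof -
    note sub = Con_carrier[OF \<delta>]
    have as: "range (quad a b c d :: 'a + nat \<Rightarrow> 'a) \<subseteq> carrier A"
      if "a \<in> carrier A" "b \<in> carrier A" "c \<in> carrier A" "d \<in> carrier A" for a b c d
      using that by (auto simp: quad_def)
    have link: "t' \<in> day_terms \<Sigma> A \<and> (r, eval_trm A (quad r p q s) t') \<in> \<delta>"
      if t: "t \<in> day_terms \<Sigma> A" "(r, eval_trm A (quad r p q s) t) \<in> \<delta>"
        and tt': "(t, t') \<in> \<alpha> \<inter> \<beta> \<union> \<gamma>" for t t'
    proof
      have "\<gamma> \<subseteq> \<beta>"
        unfolding \<beta>_def \<gamma>_def K_def by (rule term_kernel_mono, blast)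
      then have "(t, t') \<in> \<beta>" using tt' by blast
      then show d: "t' \<in> day_terms \<Sigma> A"
        using t(1) by (auto simp: \<beta>_def K_def term_kernel_def day_terms_def)
      have wf: "wf_trm \<Sigma> t" "wf_trm \<Sigma> t'" using t(1) d by (auto simp: day_terms_def)
      show "(r, eval_trm A (quad r p q s) t') \<in> \<delta>"
      \<comment> \<open>A link in \<gamma> has equal values at (r, p, p, s), which differ from those
        at (r, p, q, s) by a step in \<delta>. A link in \<alpha> has equal values at (r, r, s, s),
        which \<open>day\<close> compares with those at (r, p, q, s).\<close>
      proof (cases "(t, t') \<in> \<gamma>")
        case True
        have e: "eval_trm A (quad r p p s) t = eval_trm A (quad r p p s) t'"
          using True as[of r p p s] rs sub[OF pq]
          by (auto simp: \<gamma>_def K_def term_kernel_def quad_def)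
        have "(eval_trm A (quad r p p s) u, eval_trm A (quad r p q s) u) \<in> \<delta>" if "wf_trm \<Sigma> u" for u
          by (rule eval_trm_Con[OF \<delta> that]) (use pq rs sub[OF pq] Con_refl[OF \<delta>] in \<open>auto simp: quad_def\<close>)
        from this[OF wf(1)] this[OF wf(2)] show ?thesis
          using t(2) e Con_sym[OF \<delta>] Con_trans[OF \<delta>] by metis
      next
        case False
        then have "(t, t') \<in> \<alpha>" using tt' by blast
        then have "eval_trm A (quad r r s s) t = eval_trm A (quad r r s s) t'"
          using as[of r r s s] rs by (auto simp: \<alpha>_def K_def term_kernel_def quad_def)
        then show ?thesis
          using t(2) day[OF t(1)] day[OF d] Con_sym[OF \<delta>] Con_trans[OF \<delta>] by metis
      qed
    qed
    have 0: "Var (Inr 0) \<in> day_terms \<Sigma> A" "(r, eval_trm A (quad r p q s) (Var (Inr 0))) \<in> \<delta>"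
      using Con_refl[OF \<delta> rs(1)] by (auto simp: day_terms_def quad_def)
    show ?thesis
      using that
    proof (induction rule: trancl_induct)
      case (base t)
      show ?case by (rule link[OF 0 base])
    next
      case (step t t')
      show ?case by (rule link[OF conjunct1[OF step.IH] conjunct2[OF step.IH] step.hyps(2)])
    qed
  qed
  ultimately show ?thesis by (fastforce simp: quad_def)
qed

text \<open>Apply \<open>C(\<beta>, \<alpha>; \<delta>)\<close> to the polynomial \<open>m(r, t(x, c), t(x, y), t(b, y))\<close>, where \<open>m\<close> is a Day
  term: it takes the value \<open>r\<close> whenever \<open>y = c\<close>.\<close>

lemma centralizes_imp_day:
  fixes A :: "('f, 'a) algebra"
  assumes A: "is_algebra \<Sigma> A" and \<alpha>: "\<alpha> \<in> Con \<Sigma> A" and \<beta>: "\<beta> \<in> Con \<Sigma> A" and \<delta>: "\<delta> \<in> Con \<Sigma> A"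
    and c: "centralizes \<Sigma> A \<beta> \<alpha> \<delta>"
    and m: "((p, q), (r, s)) \<in> matrices \<Sigma> A \<alpha> \<beta>" and t: "t \<in> day_terms \<Sigma> A"
  shows "(eval_trm A (quad r r s s) t, eval_trm A (quad r p q s) t) \<in> \<delta>"
proof -
  let ?M = "matrices \<Sigma> A \<beta> \<alpha>"
  have rs: "(r, s) \<in> \<beta>" using matrices_subset[OF A \<alpha> \<beta>] m by (auto simp: Nabla_def)
  have m': "((p, r), (q, s)) \<in> ?M" by (rule matrices_transpose[OF m])
  then have pr: "(p, r) \<in> \<alpha>" using matrices_subset[OF A \<beta> \<alpha>] by (auto simp: Nabla_def)
  have car: "p \<in> carrier A" "r \<in> carrier A" "s \<in> carrier A"
    using Con_carrier[OF \<alpha> pr] Con_carrier[OF \<beta> rs] by auto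
  have wf: "wf_trm \<Sigma> t" using t by (simp add: day_terms_def)
  \<comment> \<open>For \<open>Inr 0\<close> to \<open>Inr 3\<close> the rows
    \<open>\<sigma> v\<close>, \<open>\<tau> v\<close> form a constant matrix, a row generator, the
    transposed matrix \<open>m'\<close> and the column of (r, s) \<in> \<beta>. By Day's identity,
    \<open>t\<close> maps the upper rows to (r, r), which lies in \<delta>.\<close>
  define \<sigma> :: "'a + nat \<Rightarrow> 'a \<times> 'a" where "\<sigma> = quad (r, r) (p, r) (p, r) (r, r)"
  define \<tau> :: "'a + nat \<Rightarrow> 'a \<times> 'a" where "\<tau> = quad (r, r) (p, r) (q, s) (s, s)"
  have "(\<sigma> v, \<tau> v) \<in> ?M" for v
    using m' rs pr Con_refl[OF \<beta> car(2)] unfolding \<sigma>_def \<tau>_def quad_def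
    by (auto intro: matrices.row matrices.column)
  then have "(eval_trm (square_algebra A \<alpha>) \<sigma> t, eval_trm (square_algebra A \<alpha>) \<tau> t) \<in> ?M"
    by (intro matrices_eval_trm wf)
  then have "eval_trm (square_algebra A \<alpha>) \<sigma> t \<in> \<delta> \<longleftrightarrow> eval_trm (square_algebra A \<alpha>) \<tau> t \<in> \<delta>"
    by (rule centralizesD[OF c])
  moreover have "(\<lambda>v. fst (\<sigma> v)) = quad r p p r" "(\<lambda>v. snd (\<sigma> v)) = quad r r r r"
    "(\<lambda>v. fst (\<tau> v)) = quad r p q s" "(\<lambda>v. snd (\<tau> v)) = quad r r s s"
    by (auto simp: \<sigma>_def \<tau>_def quad_def)
  moreover have "eval_trm A (quad r p p r) t = r" "eval_trm A (quad r r r r) t = r"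
    using t car unfolding day_terms_def by (auto simp: quad_def image_subset_iff)
  ultimately have "(eval_trm A (quad r p q s) t, eval_trm A (quad r r s s) t) \<in> \<delta>"
    using Con_refl[OF \<delta> car(2)] by (simp add: eval_trm_square)
  then show ?thesis by (rule Con_sym[OF \<delta>])
qed

text \<open>\<open>day_condition\<close> leads from the upper row to the lower one; exchanging the
  rows of the matrix gives the converse.\<close>

lemma day_imp_centralizes:
  fixes A :: "('f, 'a) algebra"
  assumes mod: "congruence_modular TYPE(('f, 'a) universe) \<Sigma> E" and E: "wf_identities \<Sigma> E"
    and A: "A \<in> variety \<Sigma> E"
    and \<alpha>: "\<alpha> \<in> Con \<Sigma> A" and \<beta>: "\<beta> \<in> Con \<Sigma> A" and \<delta>: "\<delta> \<in> Con \<Sigma> A"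
    and day: "\<And>p q r s t. ((p, q), (r, s)) \<in> matrices \<Sigma> A \<alpha> \<beta> \<Longrightarrow> t \<in> day_terms \<Sigma> A \<Longrightarrow>
      (eval_trm A (quad r r s s) t, eval_trm A (quad r p q s) t) \<in> \<delta>"
  shows "centralizes \<Sigma> A \<alpha> \<beta> \<delta>"
proof (rule matrices_imp_centralizes)
  have alg: "is_algebra \<Sigma> A" using A by (simp add: variety_def)
  have *: "(r, s) \<in> \<delta>" if "((p, q), (r, s)) \<in> matrices \<Sigma> A \<alpha> \<beta>" "(p, q) \<in> \<delta>" for p q r s
  proof -
    have "(r, s) \<in> \<beta>" using matrices_subset[OF alg \<alpha> \<beta>] that(1) by (auto simp: Nabla_def)
    then have "r \<in> carrier A" "s \<in> carrier A" using Con_carrier[OF \<beta>] by auto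
    then show ?thesis by (rule day_condition[OF mod E A \<delta> that(2) _ _ day[OF that(1)]])
  qed
  show "(p, q) \<in> \<delta> \<longleftrightarrow> (r, s) \<in> \<delta>" if "((p, q), (r, s)) \<in> matrices \<Sigma> A \<alpha> \<beta>" for p q r s
    using *[OF that] *[OF matrices_sym[OF \<alpha> that]] by (rule iffI)
qed

section \<open>Symmetry and additivity of the commutator\<close>

text \<open>Day's condition on the matrices passes from \<delta> to every larger congruence, so the
  route through it exchanges the arguments and enlarges \<delta> at once.\<close>

lemma centralizes_swap:
  fixes A :: "('f, 'a) algebra"
  assumes mod: "congruence_modular TYPE(('f, 'a) universe) \<Sigma> E" and E: "wf_identities \<Sigma> E"
    and A: "A \<in> variety \<Sigma> E"
    and \<alpha>: "\<alpha> \<in> Con \<Sigma> A" and \<beta>: "\<beta> \<in> Con \<Sigma> A" and \<delta>: "\<delta> \<in> Con \<Sigma> A" "\<delta>' \<in> Con \<Sigma> A" "\<delta> \<subseteq> \<delta>'"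
    and c: "centralizes \<Sigma> A \<beta> \<alpha> \<delta>"
  shows "centralizes \<Sigma> A \<alpha> \<beta> \<delta>'"
proof (rule day_imp_centralizes[OF mod E A \<alpha> \<beta> \<delta>(2)])
  have alg: "is_algebra \<Sigma> A" using A by (simp add: variety_def)
  show "(eval_trm A (quad r r s s) t, eval_trm A (quad r p q s) t) \<in> \<delta>'"
    if "((p, q), (r, s)) \<in> matrices \<Sigma> A \<alpha> \<beta>" "t \<in> day_terms \<Sigma> A" for p q r s t
    using centralizes_imp_day[OF alg \<alpha> \<beta> \<delta>(1) c that] \<delta>(3) by blast
qed

text \<open>Two exchanges restore the order of \<alpha> and \<beta>: the first keeps the commutator
  as third argument, the second enlarges it to \<delta>.\<close>

lemma centralizes_iff_commutator:
  fixes A :: "('f, 'a) algebra"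
  assumes mod: "congruence_modular TYPE(('f, 'a) universe) \<Sigma> E" and E: "wf_identities \<Sigma> E"
    and A: "A \<in> variety \<Sigma> E"
    and \<alpha>: "\<alpha> \<in> Con \<Sigma> A" and \<beta>: "\<beta> \<in> Con \<Sigma> A" and \<delta>: "\<delta> \<in> Con \<Sigma> A"
  shows "centralizes \<Sigma> A \<alpha> \<beta> \<delta> \<longleftrightarrow> commutator \<Sigma> A \<alpha> \<beta> \<subseteq> \<delta>"
proof
  have alg: "is_algebra \<Sigma> A" using A by (simp add: variety_def)
  note c = commutator_in_Con[OF alg \<alpha> \<beta>]
  assume "commutator \<Sigma> A \<alpha> \<beta> \<subseteq> \<delta>"
  moreover have "centralizes \<Sigma> A \<beta> \<alpha> (commutator \<Sigma> A \<alpha> \<beta>)"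
    by (rule centralizes_swap[OF mod E A \<beta> \<alpha> c c subset_refl centralizes_commutator])
  ultimately show "centralizes \<Sigma> A \<alpha> \<beta> \<delta>"
    by (rule centralizes_swap[OF mod E A \<alpha> \<beta> c \<delta>])
qed (rule commutator_least[OF \<delta>])

lemma commutator_commute:
  fixes A :: "('f, 'a) algebra"
  assumes mod: "congruence_modular TYPE(('f, 'a) universe) \<Sigma> E" and E: "wf_identities \<Sigma> E"
    and A: "A \<in> variety \<Sigma> E" and \<alpha>: "\<alpha> \<in> Con \<Sigma> A" and \<beta>: "\<beta> \<in> Con \<Sigma> A"
  shows "commutator \<Sigma> A \<alpha> \<beta> = commutator \<Sigma> A \<beta> \<alpha>"
proof -
  have alg: "is_algebra \<Sigma> A" using A by (simp add: variety_def)
  have "commutator \<Sigma> A \<alpha> \<beta> \<subseteq> commutator \<Sigma> A \<beta> \<alpha>" if "\<alpha> \<in> Con \<Sigma> A" "\<beta> \<in> Con \<Sigma> A" for \<alpha> \<beta>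
    by (rule commutator_least[OF commutator_in_Con[OF alg that(2,1)]],
        rule centralizes_swap[OF mod E A that _ _ subset_refl centralizes_commutator])
      (rule commutator_in_Con[OF alg that(2,1)])+
  then show ?thesis using \<alpha> \<beta> by blast
qed

text \<open>Both commutators lie below the right-hand side, so \<alpha> and \<alpha>' centralize
  \<beta> modulo it, and then so does their join.\<close>

lemma commutator_join:
  fixes A :: "('f, 'a) algebra"
  assumes mod: "congruence_modular TYPE(('f, 'a) universe) \<Sigma> E" and E: "wf_identities \<Sigma> E"
    and A: "A \<in> variety \<Sigma> E"
    and \<alpha>: "\<alpha> \<in> Con \<Sigma> A" "\<alpha>' \<in> Con \<Sigma> A" and \<beta>: "\<beta> \<in> Con \<Sigma> A"
  shows "commutator \<Sigma> A (Cg \<Sigma> A (\<alpha> \<union> \<alpha>')) \<beta> \<subseteq>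
    Cg \<Sigma> A (commutator \<Sigma> A \<alpha> \<beta> \<union> commutator \<Sigma> A \<alpha>' \<beta>)" (is "_ \<subseteq> ?\<delta>")
proof -
  have alg: "is_algebra \<Sigma> A" using A by (simp add: variety_def)
  have \<delta>: "?\<delta> \<in> Con \<Sigma> A"
    by (intro Cg_Un_in_Con commutator_in_Con alg \<alpha> \<beta>)
  have "commutator \<Sigma> A \<alpha> \<beta> \<subseteq> ?\<delta>" "commutator \<Sigma> A \<alpha>' \<beta> \<subseteq> ?\<delta>"
    using Cg_superset[of "commutator \<Sigma> A \<alpha> \<beta> \<union> commutator \<Sigma> A \<alpha>' \<beta>" \<Sigma> A] by blast+
  then have "centralizes \<Sigma> A (Cg \<Sigma> A (\<alpha> \<union> \<alpha>')) \<beta> ?\<delta>"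
    using centralizes_iff_commutator[OF mod E A _ \<beta> \<delta>] \<alpha>
    by (intro centralizes_Un[OF alg \<alpha> \<beta>]) auto
  then show ?thesis by (rule commutator_least[OF \<delta>])
qed

section \<open>Semi-degenerate varieties\<close>

text \<open>Modulo \<theta> every operation is idempotent at \<open>x\<close>, so the class of
  \<open>x\<close> is a one-element subalgebra of the quotient, which must be trivial.\<close>

lemma semi_degenerate_quotient:
  fixes B :: "('f, 'u) algebra"
  assumes sd: "semi_degenerate TYPE('u) \<Sigma> E" and B: "is_algebra \<Sigma> B" and \<theta>: "\<theta> \<in> Con \<Sigma> B"
    and Q: "quotient_algebra B \<theta> \<in> variety \<Sigma> E"
    and x: "x \<in> carrier B" and y: "y \<in> carrier B"
    and idem: "\<And>f n. (f, n) \<in> \<Sigma> \<Longrightarrow> (interp B f (replicate n x), x) \<in> \<theta>"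
  shows "(x, y) \<in> \<theta>"
proof (rule ccontr)
  assume "(x, y) \<notin> \<theta>"
  let ?Q = "quotient_algebra B \<theta>"
  have "rep \<theta> x \<noteq> rep \<theta> y" using \<open>(x, y) \<notin> \<theta>\<close> rep_eq_iff[OF \<theta> x y] by simp
  moreover have car: "rep \<theta> x \<in> carrier ?Q" "rep \<theta> y \<in> carrier ?Q"
    using x y by (auto simp: quotient_algebra_def)
  moreover have "subalgebra \<Sigma> {rep \<theta> x} ?Q"
  proof -
    have "interp ?Q f xs = rep \<theta> x" if "(f, length xs) \<in> \<Sigma>" "set xs \<subseteq> {rep \<theta> x}" for f xs
    proof -
      have "xs = map (rep \<theta>) (replicate (length xs) x)"
        using that(2) by (auto intro: replicate_eqI simp: map_replicate)
      then have "interp ?Q f xs = interp ?Q f (map (rep \<theta>) (replicate (length xs) x))" by simp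
      also have "\<dots> = rep \<theta> (interp B f (replicate (length xs) x))"
        using homomorphism_interp[OF rep_homomorphism[OF B \<theta>], of f "replicate (length xs) x"] that x
        by (auto simp: set_replicate_conv_if split: if_splits)
      also have "\<dots> = rep \<theta> x"
        using idem[OF that(1)] rep_eq_iff[OF \<theta>] Con_carrier[OF \<theta>] by blast
      finally show ?thesis .
    qed
    then show ?thesis
      using car by (auto simp: subalgebra_def is_algebra_def lists_eq_set)
  qed
  ultimately show False using sd Q unfolding semi_degenerate_def by blast
qed

text \<open>Extends the preceding argument to algebras on other types, such as squares:
  \<open>x\<close> and \<open>y\<close> are values of two variables, and \<theta> is pulled back to
  the term algebra carried by \<open>universe\<close>.\<close>

lemma semi_degenerate_collapse:
  fixes B :: "('f, 'b) algebra"
  assumes sd: "semi_degenerate TYPE(('f, 'a) universe) \<Sigma> E" and E: "wf_identities \<Sigma> E"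
    and B: "B \<in> variety \<Sigma> E" and \<theta>: "\<theta> \<in> Con \<Sigma> B" and x: "x \<in> carrier B"
    and idem: "\<And>f n. (f, n) \<in> \<Sigma> \<Longrightarrow> (interp B f (replicate n x), x) \<in> \<theta>"
  shows "\<theta> = Nabla B"
proof -
  have alg: "is_algebra \<Sigma> B" using B by (simp add: variety_def)
  let ?T = "term_algebra \<Sigma> :: ('f, ('f, 'a) universe) algebra"
  have xy: "(x, y) \<in> \<theta>" if y: "y \<in> carrier B" for y
  proof -
    define \<sigma> where "\<sigma> = (\<lambda>v :: 'a + nat. if v = Inr 0 then x else y)"
    have \<sigma>: "range \<sigma> \<subseteq> carrier B" using x y by (auto simp: \<sigma>_def)
    note hom = eval_trm_homomorphism[OF alg \<sigma>]
    define \<phi> where "\<phi> = {(s, t) \<in> Nabla ?T. (eval_trm B \<sigma> s, eval_trm B \<sigma> t) \<in> \<theta>}"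
    have \<phi>: "\<phi> \<in> Con \<Sigma> ?T" unfolding \<phi>_def by (rule vimage_in_Con[OF term_is_algebra hom \<theta>])
    have "term_kernel \<Sigma> B (assignments B) \<subseteq> \<phi>"
      using \<sigma> Con_refl[OF \<theta> homomorphism_closed[OF hom]] by (auto simp: \<phi>_def term_kernel_def Nabla_def)
    from term_quotient_in_variety[OF B E \<phi> this] have "(Var (Inr 0), Var (Inr 1)) \<in> \<phi>"
      by (rule semi_degenerate_quotient[OF sd term_is_algebra \<phi>])
        (use idem in \<open>auto simp: \<phi>_def Nabla_def \<sigma>_def map_replicate\<close>)
    then show ?thesis by (simp add: \<phi>_def \<sigma>_def)
  qed
  show ?thesis
  proof
    show "\<theta> \<subseteq> Nabla B" by (rule Con_subset_Nabla[OF \<theta>])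
    show "Nabla B \<subseteq> \<theta>"
      using xy Con_sym[OF \<theta> xy] Con_trans[OF \<theta>, of _ x] by (auto simp: Nabla_def)
  qed
qed

text \<open>In \<open>\<theta>\<close>, viewed as a subalgebra of the square of \<open>A\<close>, the diagonal is contained in a single
  class of the congruence generated by the matrices, hence that congruence is full.\<close>

lemma commutator_Nabla:
  fixes A :: "('f, 'a) algebra"
  assumes sd: "semi_degenerate TYPE(('f, 'b) universe) \<Sigma> E" and E: "wf_identities \<Sigma> E"
    and A: "A \<in> variety \<Sigma> E" and \<theta>: "\<theta> \<in> Con \<Sigma> A"
  shows "commutator \<Sigma> A (Nabla A) \<theta> = \<theta>"
proof
  have alg: "is_algebra \<Sigma> A" using A by (simp add: variety_def)
  note N = Nabla_in_Con[OF alg]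
  let ?c = "commutator \<Sigma> A (Nabla A) \<theta>" and ?M = "matrices \<Sigma> A (Nabla A) \<theta>"
  show "?c \<subseteq> \<theta>" using commutator_subset_Int[OF N \<theta>] by blast
  obtain a where a: "a \<in> carrier A" using alg by (auto simp: is_algebra_def)
  have full: "?M\<^sup>+ = Nabla (square_algebra A \<theta>)"
  proof (rule semi_degenerate_collapse[OF sd E square_in_variety[OF A \<theta>] matrices_trancl_in_Con[OF alg N \<theta>]])
    show "(a, a) \<in> carrier (square_algebra A \<theta>)" using Con_refl[OF \<theta> a] by simp
    fix f n assume f: "(f, n) \<in> \<Sigma>"
    have "interp A f (replicate n a) \<in> carrier A"
      by (rule interp_in_carrier[OF alg]) (use f a in auto)
    then have "((interp A f (replicate n a), interp A f (replicate n a)), (a, a)) \<in> ?M"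
      using a by (intro matrices.column) (simp add: Nabla_def)
    then show "(interp (square_algebra A \<theta>) f (replicate n (a, a)), (a, a)) \<in> ?M\<^sup>+"
      by (simp add: interp_square r_into_trancl)
  qed
  show "\<theta> \<subseteq> ?c"
  proof
    fix z assume z: "z \<in> \<theta>"
    have aa: "(a, a) \<in> ?c" by (rule Con_refl[OF commutator_in_Con[OF alg N \<theta>] a])
    have "((a, a), z) \<in> ?M\<^sup>+" unfolding full using z Con_refl[OF \<theta> a] by (simp add: Nabla_def)
    then show "z \<in> ?c" using centralizes_trancl[OF centralizes_commutator] aa by blast
  qed
qed

text \<open>By semi-degeneracy, the identities of \<open>A\<close> together with idempotence of all
  operations at \<open>?x\<close> entail that \<open>?x\<close> equals \<open>?y\<close>. Finitely
  many idempotence pairs suffice, and their values at a single element \<open>a\<close> generate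
  \<nabla>.\<close>

lemma Nabla_finitely_generated:
  fixes A :: "('f, 'a) algebra"
  assumes sd: "semi_degenerate TYPE(('f, 'b) universe) \<Sigma> E" and E: "wf_identities \<Sigma> E"
    and A: "A \<in> variety \<Sigma> E"
  shows "Nabla A \<in> fg_Con \<Sigma> A"
proof -
  have alg: "is_algebra \<Sigma> A" using A by (simp add: variety_def)
  let ?T = "term_algebra \<Sigma> :: ('f, ('f, 'b) universe) algebra"
  let ?x = "Var (Inr 0) :: ('f, 'b) universe" and ?y = "Var (Inr 1) :: ('f, 'b) universe"
  define I where "I = (\<lambda>(f, n). (App f (replicate n ?x), ?x)) ` \<Sigma>"
  let ?K = "term_kernel \<Sigma> A (assignments A) :: ('f, 'b) universe rel"
  have sub: "?K \<union> I \<subseteq> Nabla ?T"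
    by (auto simp: I_def Nabla_def term_kernel_def)
  have C: "Cg \<Sigma> ?T (?K \<union> I) \<in> Con \<Sigma> ?T" by (rule Cg_in_Con[OF term_is_algebra sub])
  have s: "?K \<union> I \<subseteq> Cg \<Sigma> ?T (?K \<union> I)" by (rule Cg_superset)
  then have "?K \<subseteq> Cg \<Sigma> ?T (?K \<union> I)" by blast
  from term_quotient_in_variety[OF A E C this] have "(?x, ?y) \<in> Cg \<Sigma> ?T (?K \<union> I)"
    by (rule semi_degenerate_quotient[OF sd term_is_algebra C]) (use s in \<open>auto simp: I_def\<close>)
  then obtain Y where Y: "finite Y" "Y \<subseteq> ?K \<union> I" "(?x, ?y) \<in> Cg \<Sigma> ?T Y"
    using Cg_finite_subset[OF term_is_algebra sub] by blast
  obtain a where a: "a \<in> carrier A" using alg by (auto simp: is_algebra_def)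
  \<comment> \<open>The pairs of \<open>I\<close> contain no variable but \<open>Inr 0\<close>, so
    their values depend on \<open>a\<close> only, and one finite \<open>Z\<close> serves every
    \<open>b\<close> below.\<close>
  define Z where "Z = (\<lambda>(s, t). (eval_trm A (\<lambda>_. a) s, eval_trm A (\<lambda>_. a) t)) ` (Y \<inter> I)"
  have Z: "finite Z" "Z \<subseteq> Nabla A"
  proof -
    show "finite Z" using Y(1) by (simp add: Z_def)
    have "(eval_trm A (\<lambda>_. a) s, eval_trm A (\<lambda>_. a) t) \<in> Nabla A" if "(s, t) \<in> I" for s t
      using that a sub eval_trm_closed[OF alg, of _ "\<lambda>_. a"] by (auto simp: I_def Nabla_def)
    then show "Z \<subseteq> Nabla A" by (auto simp: Z_def)
  qed
  define \<zeta> where "\<zeta> = Cg \<Sigma> A Z"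
  have \<zeta>: "\<zeta> \<in> Con \<Sigma> A" "Z \<subseteq> \<zeta>"
    unfolding \<zeta>_def by (rule Cg_in_Con[OF alg Z(2)], rule Cg_superset)
  have ab: "(a, b) \<in> \<zeta>" if b: "b \<in> carrier A" for b
  proof -
    define \<sigma> where "\<sigma> = (\<lambda>v :: 'b + nat. if v = Inr 0 then a else b)"
    have \<sigma>: "range \<sigma> \<subseteq> carrier A" using a b by (auto simp: \<sigma>_def)
    note hom = eval_trm_homomorphism[OF alg \<sigma>]
    define \<phi> where "\<phi> = {(s, t) \<in> Nabla ?T. (eval_trm A \<sigma> s, eval_trm A \<sigma> t) \<in> \<zeta>}"
    have \<phi>: "\<phi> \<in> Con \<Sigma> ?T" unfolding \<phi>_def by (rule vimage_in_Con[OF term_is_algebra hom \<zeta>(1)])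
    have "?K \<subseteq> \<phi>"
      using \<sigma> Con_refl[OF \<zeta>(1) homomorphism_closed[OF hom]] by (auto simp: \<phi>_def term_kernel_def Nabla_def)
    moreover have "Y \<inter> I \<subseteq> \<phi>"
    proof
      fix z assume z: "z \<in> Y \<inter> I"
      obtain u w where uw: "z = (u, w)" by fastforce
      have "vars_trm u \<subseteq> {Inr 0}" "vars_trm w \<subseteq> {Inr 0}" "(u, w) \<in> Nabla ?T"
        using z uw sub by (auto simp: I_def split: if_splits)
      then have "eval_trm A \<sigma> u = eval_trm A (\<lambda>_. a) u" "eval_trm A \<sigma> w = eval_trm A (\<lambda>_. a) w"
        by (auto intro!: eval_trm_cong simp: \<sigma>_def)
      moreover have "(eval_trm A (\<lambda>_. a) u, eval_trm A (\<lambda>_. a) w) \<in> \<zeta>"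
        using z uw \<zeta>(2) unfolding Z_def by force
      ultimately show "z \<in> \<phi>" using uw \<open>(u, w) \<in> Nabla ?T\<close> by (simp add: \<phi>_def)
    qed
    ultimately have "Cg \<Sigma> ?T Y \<subseteq> \<phi>" using Y(2) by (intro Cg_least[OF \<phi>]) blast
    then have "(?x, ?y) \<in> \<phi>" using Y(3) by blast
    then show ?thesis by (simp add: \<phi>_def \<sigma>_def)
  qed
  have "Nabla A \<subseteq> \<zeta>"
    using ab Con_sym[OF \<zeta>(1) ab] Con_trans[OF \<zeta>(1), of _ a] by (auto simp: Nabla_def)
  then have "Nabla A = \<zeta>" using Con_subset_Nabla[OF \<zeta>(1)] by blast
  then show ?thesis using Z unfolding fg_Con_def \<zeta>_def by blast
qed

section \<open>Complemented elements of multiplicative join semilattices\<close>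

text \<open>\<open>le\<close> is only a preorder, so that \<open>I\<close> may consist of representatives of the elements of the
  lattice under consideration. The multiplication need neither be a meet nor be associative, but it
  agrees with the meet on complemented elements.\<close>

locale multiplicative_preorder =
  fixes I :: "'i set" and le :: "'i \<Rightarrow> 'i \<Rightarrow> bool" (infix \<open>\<preceq>\<close> 50)
    and J :: "'i \<Rightarrow> 'i \<Rightarrow> 'i" and M :: "'i \<Rightarrow> 'i \<Rightarrow> 'i" and Bot :: 'i and Top :: 'i
  assumes le_refl: "a \<in> I \<Longrightarrow> a \<preceq> a"
    and le_trans: "a \<preceq> b \<Longrightarrow> b \<preceq> c \<Longrightarrow> a \<preceq> c"
    and J_closed [simp]: "a \<in> I \<Longrightarrow> b \<in> I \<Longrightarrow> J a b \<in> I"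
    and M_closed [simp]: "a \<in> I \<Longrightarrow> b \<in> I \<Longrightarrow> M a b \<in> I"
    and Bot_closed [simp]: "Bot \<in> I" and Top_closed [simp]: "Top \<in> I"
    and Bot_le: "a \<in> I \<Longrightarrow> Bot \<preceq> a" and le_Top: "a \<in> I \<Longrightarrow> a \<preceq> Top"
    and J_upper: "a \<in> I \<Longrightarrow> b \<in> I \<Longrightarrow> a \<preceq> J a b" "a \<in> I \<Longrightarrow> b \<in> I \<Longrightarrow> b \<preceq> J a b"
    and J_least: "a \<in> I \<Longrightarrow> b \<in> I \<Longrightarrow> c \<in> I \<Longrightarrow> a \<preceq> c \<Longrightarrow> b \<preceq> c \<Longrightarrow> J a b \<preceq> c"
    and M_commute: "a \<in> I \<Longrightarrow> b \<in> I \<Longrightarrow> M a b \<preceq> M b a"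
    and M_mono1: "a \<in> I \<Longrightarrow> a' \<in> I \<Longrightarrow> b \<in> I \<Longrightarrow> a \<preceq> a' \<Longrightarrow> M a b \<preceq> M a' b"
    and M_le1: "a \<in> I \<Longrightarrow> b \<in> I \<Longrightarrow> M a b \<preceq> a"
    and M_Top: "a \<in> I \<Longrightarrow> a \<preceq> M a Top"
    and M_J: "a \<in> I \<Longrightarrow> b \<in> I \<Longrightarrow> c \<in> I \<Longrightarrow> M a (J b c) \<preceq> J (M a b) (M a c)"
begin

declare le_trans [trans]

lemma M_le2: "a \<in> I \<Longrightarrow> b \<in> I \<Longrightarrow> M a b \<preceq> b"
  using M_commute M_le1 le_trans by blast

lemma M_mono: "a \<in> I \<Longrightarrow> a' \<in> I \<Longrightarrow> b \<in> I \<Longrightarrow> b' \<in> I \<Longrightarrow> a \<preceq> a' \<Longrightarrow> b \<preceq> b' \<Longrightarrow> M a b \<preceq> M a' b'"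
  by (meson M_commute M_mono1 M_closed le_trans)

lemma J_mono: "a \<in> I \<Longrightarrow> a' \<in> I \<Longrightarrow> b \<in> I \<Longrightarrow> b' \<in> I \<Longrightarrow> a \<preceq> a' \<Longrightarrow> b \<preceq> b' \<Longrightarrow> J a b \<preceq> J a' b'"
  by (meson J_upper J_least J_closed le_trans)

lemma J_commute: "a \<in> I \<Longrightarrow> b \<in> I \<Longrightarrow> J a b \<preceq> J b a"
  by (simp add: J_least J_upper)

text \<open>The product takes the place of the meet; \<open>complemented_L\<close> shows that the
  usual complemented elements result.\<close>

definition complements :: "'i \<Rightarrow> 'i \<Rightarrow> bool" where
  "complements a b \<longleftrightarrow> a \<in> I \<and> b \<in> I \<and> Top \<preceq> J a b \<and> M a b \<preceq> Bot"

definition compl_elements :: "'i set" where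
  "compl_elements = {a. \<exists>b. complements a b}"

lemma compl_elements_subset: "a \<in> compl_elements \<Longrightarrow> a \<in> I"
  by (auto simp: compl_elements_def complements_def)

lemma complements_sym: "complements a b \<Longrightarrow> complements b a"
  unfolding complements_def using M_commute J_commute le_trans by blast

lemma complements_in: "complements a b \<Longrightarrow> a \<in> compl_elements \<and> b \<in> compl_elements"
  using complements_sym by (auto simp: compl_elements_def)

text \<open>Expand w Top \<preceq> w (a \<or> b) for a complement \<open>b\<close> of
  \<open>a\<close>: the part w a is below a c, and w b is below a b, hence below \<open>Bot\<close>.
  So multiplication by a complemented element is a meet.\<close>

lemma M_greatest:
  assumes "a \<in> compl_elements" and w: "w \<in> I" and c: "c \<in> I" and "w \<preceq> a" "w \<preceq> c"
  shows "w \<preceq> M a c"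
proof -
  obtain b where ab: "a \<in> I" "b \<in> I" "Top \<preceq> J a b" "M a b \<preceq> Bot"
    using assms(1) by (auto simp: compl_elements_def complements_def)
  have "w \<preceq> M w Top" using w by (rule M_Top)
  also have "M w Top \<preceq> M w (J a b)" using w ab by (intro M_mono) (auto intro: le_refl)
  also have "M w (J a b) \<preceq> J (M w a) (M w b)" using w ab by (intro M_J)
  also have "J (M w a) (M w b) \<preceq> M a c"
  proof (rule J_least)
    show "M w a \<preceq> M a c"
      by (rule le_trans[OF M_commute[OF w ab(1)] M_mono]) (use assms ab in \<open>auto intro: le_refl\<close>)
    have "M w b \<preceq> M a b" using assms ab by (intro M_mono1)
    then show "M w b \<preceq> M a c" using ab(4) Bot_le le_trans M_closed[OF ab(1) c] by blast
  qed (use w ab c in auto)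
  finally show ?thesis .
qed

text \<open>When (u \<or> x)(u \<or> y) is expanded, every product except x y has a factor
  \<open>u\<close> and is absorbed by it.\<close>

lemma Top_le_J_M:
  assumes u: "u \<in> I" and x: "x \<in> I" and y: "y \<in> I" and "Top \<preceq> J u x" "Top \<preceq> J u y"
  shows "Top \<preceq> J u (M x y)"
proof -
  have "Top \<preceq> M Top Top" by (rule M_Top) simp
  also have "M Top Top \<preceq> M (J u x) (J u y)" using assms by (intro M_mono) auto
  also have "M (J u x) (J u y) \<preceq> J (M (J u x) u) (M (J u x) y)" using u x y by (intro M_J) auto
  also have "J (M (J u x) u) (M (J u x) y) \<preceq> J u (M x y)"
  proof (rule J_least)
    show "M (J u x) u \<preceq> J u (M x y)"
      by (rule le_trans[OF M_le2 J_upper(1)]) (use u x y in auto)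
    have "M (J u x) y \<preceq> M y (J u x)" using u x y by (intro M_commute) auto
    also have "M y (J u x) \<preceq> J (M y u) (M y x)" using u x y by (intro M_J)
    also have "J (M y u) (M y x) \<preceq> J u (M x y)"
      using u x y by (intro J_mono M_le2 M_commute) auto
    finally show "M (J u x) y \<preceq> J u (M x y)" .
  qed (use u x y in auto)
  finally show ?thesis .
qed

text \<open>De Morgan's law. As complementation is symmetric, it gives closure of the complemented
  elements under joins and products alike.\<close>

lemma complements_J_M:
  assumes "complements a a'" "complements c c'"
  shows "complements (J a c) (M a' c')"
proof -
  have I: "a \<in> I" "a' \<in> I" "c \<in> I" "c' \<in> I" using assms by (auto simp: complements_def)
  have "J a a' \<preceq> J (J a c) a'" "J c c' \<preceq> J (J a c) c'"
    using I by (auto intro!: J_mono J_upper le_refl)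
  then have "Top \<preceq> J (J a c) (M a' c')"
    using assms I le_trans unfolding complements_def by (intro Top_le_J_M) auto
  moreover have "M (J a c) (M a' c') \<preceq> Bot"
  proof -
    let ?w = "M a' c'"
    have w: "?w \<in> I" using I by simp
    have "M ?w a \<preceq> M a' a" "M ?w c \<preceq> M c' c"
      using I by (auto intro: M_mono1 M_le1 M_le2)
    then have "M ?w a \<preceq> Bot" "M ?w c \<preceq> Bot"
      using assms complements_sym le_trans unfolding complements_def by meson+
    then have "J (M ?w a) (M ?w c) \<preceq> Bot" using I w by (intro J_least) auto
    moreover have "M (J a c) ?w \<preceq> M ?w (J a c)" "M ?w (J a c) \<preceq> J (M ?w a) (M ?w c)"
      using I w by (auto intro: M_commute M_J)
    ultimately show ?thesis using le_trans by blast
  qed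
  ultimately show ?thesis using I by (simp add: complements_def)
qed

lemma complements_Bot_Top: "complements Bot Top"
  by (simp add: complements_def J_upper M_le1)

lemma compl_elements_closed:
  "a \<in> compl_elements \<Longrightarrow> c \<in> compl_elements \<Longrightarrow> J a c \<in> compl_elements"
  "a \<in> compl_elements \<Longrightarrow> c \<in> compl_elements \<Longrightarrow> M a c \<in> compl_elements"
  "Bot \<in> compl_elements" "Top \<in> compl_elements"
proof -
  assume "a \<in> compl_elements" "c \<in> compl_elements"
  then obtain a' c' where c: "complements a a'" "complements c c'"
    by (auto simp: compl_elements_def)
  show "J a c \<in> compl_elements"
    using complements_in[OF complements_J_M[OF c]] by simp
  show "M a c \<in> compl_elements"
    using complements_in[OF complements_J_M[OF c[THEN complements_sym]]] by simp
qed (use complements_in[OF complements_Bot_Top] in auto)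

end

section \<open>Lattices given by representatives\<close>

text \<open>\<open>N\<close> represents the meet of \<open>L\<close>. It is kept apart from
  \<open>M\<close> because intersection and commutator of congruences may differ; in the quotient
  and in the reticulation the commutator plays both parts.\<close>

locale represented_lattice = multiplicative_preorder I le J M Bot Top
  for I :: "'i set" and le (infix \<open>\<preceq>\<close> 50) and J M Bot Top +
  fixes L :: "'l gorder" and h :: "'i \<Rightarrow> 'l" and N :: "'i \<Rightarrow> 'i \<Rightarrow> 'i"
  assumes eq_L: "eq L = (=)" and carrier_L: "carrier L = h ` I"
    and le_L: "a \<in> I \<Longrightarrow> b \<in> I \<Longrightarrow> h a \<sqsubseteq>\<^bsub>L\<^esub> h b \<longleftrightarrow> a \<preceq> b"
    and h_eqI: "a \<in> I \<Longrightarrow> b \<in> I \<Longrightarrow> a \<preceq> b \<Longrightarrow> b \<preceq> a \<Longrightarrow> h a = h b"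
    and N_closed [simp]: "a \<in> I \<Longrightarrow> b \<in> I \<Longrightarrow> N a b \<in> I"
    and N_lower: "a \<in> I \<Longrightarrow> b \<in> I \<Longrightarrow> N a b \<preceq> a" "a \<in> I \<Longrightarrow> b \<in> I \<Longrightarrow> N a b \<preceq> b"
    and N_greatest: "a \<in> I \<Longrightarrow> b \<in> I \<Longrightarrow> c \<in> I \<Longrightarrow> c \<preceq> a \<Longrightarrow> c \<preceq> b \<Longrightarrow> c \<preceq> N a b"
begin

lemma h_eq_iff: "a \<in> I \<Longrightarrow> b \<in> I \<Longrightarrow> h a = h b \<longleftrightarrow> a \<preceq> b \<and> b \<preceq> a"
  using h_eqI le_L[of a b] le_L[of b a] le_L[of a a] le_refl by metis

lemma sub_partial_order:
  assumes "carrier L' = h ` I'" "I' \<subseteq> I" "gorder.le L' = gorder.le L" "eq L' = (=)"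
  shows "partial_order (L' :: 'l gorder)"
proof (rule partial_orderI_eq)
  note sub = subsetD[OF assms(2)]
  show "x \<sqsubseteq>\<^bsub>L'\<^esub> x" if "x \<in> carrier L'" for x
    using that assms by (auto simp: le_L sub le_refl)
  show "x = y" if "x \<in> carrier L'" "y \<in> carrier L'" "x \<sqsubseteq>\<^bsub>L'\<^esub> y" "y \<sqsubseteq>\<^bsub>L'\<^esub> x" for x y
    using that assms by (auto simp: le_L sub intro: h_eqI)
  show "x \<sqsubseteq>\<^bsub>L'\<^esub> z"
    if "x \<in> carrier L'" "y \<in> carrier L'" "z \<in> carrier L'" "x \<sqsubseteq>\<^bsub>L'\<^esub> y" "y \<sqsubseteq>\<^bsub>L'\<^esub> z" for x y z
    using that assms by (auto simp: le_L sub intro: le_trans)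
qed (rule assms(4))

lemma L_ops:
  shows "a \<in> I \<Longrightarrow> b \<in> I \<Longrightarrow> h a \<squnion>\<^bsub>L\<^esub> h b = h (J a b)"
    and "a \<in> I \<Longrightarrow> b \<in> I \<Longrightarrow> h a \<sqinter>\<^bsub>L\<^esub> h b = h (N a b)"
    and "\<bottom>\<^bsub>L\<^esub> = h Bot" and "\<top>\<^bsub>L\<^esub> = h Top"
proof -
  have po: "partial_order L"
    by (rule sub_partial_order[OF carrier_L]) (auto simp: eq_L)
  note op = lattice_op_eqI[OF po]
  show "a \<in> I \<Longrightarrow> b \<in> I \<Longrightarrow> h a \<squnion>\<^bsub>L\<^esub> h b = h (J a b)"
    by (rule op(1)) (auto simp: carrier_L le_L J_upper intro: J_least)
  show "a \<in> I \<Longrightarrow> b \<in> I \<Longrightarrow> h a \<sqinter>\<^bsub>L\<^esub> h b = h (N a b)"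
    by (rule op(2)) (auto simp: carrier_L le_L N_lower intro: N_greatest)
  show "\<bottom>\<^bsub>L\<^esub> = h Bot"
    by (rule op(3)[of "h Bot" "h Bot"]) (auto simp: carrier_L le_L Bot_le)
  show "\<top>\<^bsub>L\<^esub> = h Top"
    by (rule op(4)[of "h Bot" "h Bot"]) (auto simp: carrier_L le_L le_Top)
qed

text \<open>The product is a lower bound, so it vanishes with the meet. Conversely, if
  \<open>a\<close> and \<open>b\<close> are complements for the product, \<open>M_greatest\<close>
  puts their meet below the product.\<close>

lemma complemented_L: "complemented L = h ` compl_elements"
proof -
  have *: "h a \<squnion>\<^bsub>L\<^esub> h b = \<top>\<^bsub>L\<^esub> \<and> h a \<sqinter>\<^bsub>L\<^esub> h b = \<bottom>\<^bsub>L\<^esub> \<longleftrightarrow> complements a b"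
    if ab: "a \<in> I" "b \<in> I" for a b
  proof -
    have "N a b \<preceq> Bot" if "complements a b"
    proof -
      have "N a b \<preceq> M a b"
        by (rule M_greatest) (use that ab N_lower in \<open>auto simp: compl_elements_def\<close>)
      then show ?thesis using that le_trans unfolding complements_def by blast
    qed
    moreover have "M a b \<preceq> Bot" if "N a b \<preceq> Bot"
      by (rule le_trans[OF N_greatest that]) (use ab M_le1 M_le2 in auto)
    ultimately show ?thesis
      using ab by (auto simp: L_ops h_eq_iff Bot_le le_Top complements_def)
  qed
  show ?thesis
  proof
    show "complemented L \<subseteq> h ` compl_elements"
      unfolding complemented_def carrier_L using * by (auto simp: compl_elements_def)
    show "h ` compl_elements \<subseteq> complemented L"
    proof
      fix x assume "x \<in> h ` compl_elements"
      then obtain a b where ab: "x = h a" "complements a b" by (auto simp: compl_elements_def)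
      then have "a \<in> I" "b \<in> I" by (auto simp: complements_def)
      then show "x \<in> complemented L"
        unfolding complemented_def carrier_L using *[of a b] ab by blast
    qed
  qed
qed

section \<open>The Boolean algebra of complemented elements\<close>

abbreviation "C \<equiv> complemented_poset L"

lemma carrier_C: "carrier C = h ` compl_elements"
  by (simp add: complemented_poset_def complemented_L)

lemma le_C: "gorder.le C = gorder.le L"
  by (simp add: complemented_poset_def)

lemma po_C: "partial_order C"
  by (rule sub_partial_order[OF carrier_C])
    (auto simp: complemented_poset_def eq_L compl_elements_subset)

lemma C_bounds:
  assumes "a \<in> compl_elements" "b \<in> compl_elements"
  shows "least C (h (J a b)) (Upper C {h a, h b})"
    and "greatest C (h (M a b)) (Lower C {h a, h b})"
  using assms assms[THEN compl_elements_subset]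
  by (auto simp: least_def greatest_def Upper_def Lower_def carrier_C le_C le_L compl_elements_subset
      compl_elements_closed J_upper M_le1 M_le2 intro!: J_least M_greatest)

lemma C_extremal: "least C (h Bot) (carrier C)" "greatest C (h Top) (carrier C)"
  by (auto simp: least_def greatest_def carrier_C le_C le_L compl_elements_subset
      compl_elements_closed Bot_le le_Top)

lemma C_ops:
  shows "a \<in> compl_elements \<Longrightarrow> b \<in> compl_elements \<Longrightarrow> h a \<squnion>\<^bsub>C\<^esub> h b = h (J a b)"
    and "a \<in> compl_elements \<Longrightarrow> b \<in> compl_elements \<Longrightarrow> h a \<sqinter>\<^bsub>C\<^esub> h b = h (M a b)"
    and "\<bottom>\<^bsub>C\<^esub> = h Bot" and "\<top>\<^bsub>C\<^esub> = h Top"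
proof -
  note op = lattice_op_eqI[OF po_C] and simps = carrier_C le_C le_L compl_elements_subset
      compl_elements_closed J_upper M_le1 M_le2 Bot_le le_Top
  show "a \<in> compl_elements \<Longrightarrow> b \<in> compl_elements \<Longrightarrow> h a \<squnion>\<^bsub>C\<^esub> h b = h (J a b)"
    by (rule op(1)) (auto simp: simps intro!: J_least)
  show "a \<in> compl_elements \<Longrightarrow> b \<in> compl_elements \<Longrightarrow> h a \<sqinter>\<^bsub>C\<^esub> h b = h (M a b)"
    by (rule op(2)) (auto simp: simps intro!: M_greatest)
  show "\<bottom>\<^bsub>C\<^esub> = h Bot" by (rule op(3)[of "h Bot" "h Bot"]) (auto simp: simps)
  show "\<top>\<^bsub>C\<^esub> = h Top" by (rule op(4)[of "h Bot" "h Bot"]) (auto simp: simps)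
qed

text \<open>On complemented elements the product is the meet, so \<open>M_J\<close> is one half of
  distributivity; monotonicity gives the other.\<close>

lemma boolean_algebra_C: "boolean_algebra C"
proof -
  interpret C: partial_order C by (rule po_C)
  have "bounded_lattice C"
    by unfold_locales (auto simp: carrier_C intro: C_bounds C_extremal[unfolded carrier_C])
  moreover have "h a \<sqinter>\<^bsub>C\<^esub> (h b \<squnion>\<^bsub>C\<^esub> h c) = (h a \<sqinter>\<^bsub>C\<^esub> h b) \<squnion>\<^bsub>C\<^esub> (h a \<sqinter>\<^bsub>C\<^esub> h c)"
    if abc: "a \<in> compl_elements" "b \<in> compl_elements" "c \<in> compl_elements" for a b c
  proof -
    note I = abc[THEN compl_elements_subset]
    have "J (M a b) (M a c) \<preceq> M a (J b c)"
      using I by (intro J_least M_mono) (auto intro: J_upper le_refl)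
    then show ?thesis
      using I M_J[OF I] by (simp add: C_ops compl_elements_closed abc h_eqI)
  qed
  moreover have "complemented C = carrier C"
  proof
    show "carrier C \<subseteq> complemented C"
    proof
      fix x assume x: "x \<in> carrier C"
      then obtain a b where ab: "x = h a" "complements a b"
        by (auto simp: carrier_C compl_elements_def)
      note c = complements_in[OF ab(2)]
      have "x \<squnion>\<^bsub>C\<^esub> h b = \<top>\<^bsub>C\<^esub>" "x \<sqinter>\<^bsub>C\<^esub> h b = \<bottom>\<^bsub>C\<^esub>"
        using ab c compl_elements_subset by (auto simp: C_ops complements_def h_eq_iff Bot_le le_Top)
      then show "x \<in> complemented C"
        using x c unfolding complemented_def carrier_C by blast
    qed
  qed (auto simp: complemented_def)
  ultimately show ?thesis
    by (auto simp: boolean_algebra_def carrier_C)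
qed

end

section \<open>The reticulation\<close>

lemma finite_subset_Cg:
  assumes "is_algebra \<Sigma> A" "X \<subseteq> Nabla A" "finite Z" "Z \<subseteq> Cg \<Sigma> A X"
  shows "\<exists>Y. finite Y \<and> Y \<subseteq> X \<and> Z \<subseteq> Cg \<Sigma> A Y"
  using assms(3,4)
proof (induction rule: finite_induct)
  case empty
  then show ?case by auto
next
  case (insert z Z)
  then obtain Y where Y: "finite Y" "Y \<subseteq> X" "Z \<subseteq> Cg \<Sigma> A Y" by auto
  obtain Y' where Y': "finite Y'" "Y' \<subseteq> X" "z \<in> Cg \<Sigma> A Y'"
    using Cg_finite_subset[OF assms(1,2), of z] insert.prems by auto
  have "insert z Z \<subseteq> Cg \<Sigma> A (Y \<union> Y')"
    using Y(3) Y'(3) Cg_mono[of Y "Y \<union> Y'" \<Sigma> A] Cg_mono[of Y' "Y \<union> Y'" \<Sigma> A] by auto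
  then show ?case using Y Y' by (intro exI[of _ "Y \<union> Y'"]) auto
qed

text \<open>Gathers what the variety contributes, together with the closure of the compact
  congruences under the commutator; the variety itself does not occur below.\<close>

locale commutator_algebra =
  fixes \<Sigma> :: "'f signature" and A :: "('f, 'a) algebra"
  assumes alg: "is_algebra \<Sigma> A"
    and comm: "\<alpha> \<in> Con \<Sigma> A \<Longrightarrow> \<beta> \<in> Con \<Sigma> A \<Longrightarrow> commutator \<Sigma> A \<alpha> \<beta> = commutator \<Sigma> A \<beta> \<alpha>"
    and comm_join1: "\<alpha> \<in> Con \<Sigma> A \<Longrightarrow> \<alpha>' \<in> Con \<Sigma> A \<Longrightarrow> \<beta> \<in> Con \<Sigma> A \<Longrightarrow>
      commutator \<Sigma> A (Cg \<Sigma> A (\<alpha> \<union> \<alpha>')) \<beta> \<subseteq>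
        Cg \<Sigma> A (commutator \<Sigma> A \<alpha> \<beta> \<union> commutator \<Sigma> A \<alpha>' \<beta>)"
    and comm_Nabla1: "\<alpha> \<in> Con \<Sigma> A \<Longrightarrow> commutator \<Sigma> A (Nabla A) \<alpha> = \<alpha>"
    and Nabla_fg: "Nabla A \<in> fg_Con \<Sigma> A"
    and comm_fg: "\<alpha> \<in> fg_Con \<Sigma> A \<Longrightarrow> \<beta> \<in> fg_Con \<Sigma> A \<Longrightarrow> commutator \<Sigma> A \<alpha> \<beta> \<in> fg_Con \<Sigma> A"
begin

abbreviation "jn \<alpha> \<beta> \<equiv> Cg \<Sigma> A (\<alpha> \<union> \<beta>)"
abbreviation "cm \<equiv> commutator \<Sigma> A"
abbreviation "rad \<equiv> radical \<Sigma> A"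

lemmas jn_in_Con = Cg_Un_in_Con[where \<Sigma> = \<Sigma> and A = A]
lemmas cm_in_Con = commutator_in_Con[OF alg]
lemmas cm_subset = commutator_subset_Int[where \<Sigma> = \<Sigma> and A = A]
lemmas Delta_Con = Delta_in_Con[OF alg] and Nabla_Con = Nabla_in_Con[OF alg]

lemma jn_upper: "\<alpha> \<subseteq> jn \<alpha> \<beta>" "\<beta> \<subseteq> jn \<alpha> \<beta>"
  using Cg_superset[of "\<alpha> \<union> \<beta>" \<Sigma> A] by auto

lemma jn_least: "\<gamma> \<in> Con \<Sigma> A \<Longrightarrow> \<alpha> \<subseteq> \<gamma> \<Longrightarrow> \<beta> \<subseteq> \<gamma> \<Longrightarrow> jn \<alpha> \<beta> \<subseteq> \<gamma>"
  by (rule Cg_least) auto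

lemma comm_join2:
  assumes "\<alpha> \<in> Con \<Sigma> A" "\<beta> \<in> Con \<Sigma> A" "\<beta>' \<in> Con \<Sigma> A"
  shows "cm \<alpha> (jn \<beta> \<beta>') \<subseteq> jn (cm \<alpha> \<beta>) (cm \<alpha> \<beta>')"
  using comm_join1[OF assms(2,3,1)] assms by (simp add: comm jn_in_Con)

lemma comm_Nabla2: "\<alpha> \<in> Con \<Sigma> A \<Longrightarrow> cm \<alpha> (Nabla A) = \<alpha>"
  using comm_Nabla1 comm[OF _ Nabla_Con] by simp

lemma fg_Con_subset: "\<alpha> \<in> fg_Con \<Sigma> A \<Longrightarrow> \<alpha> \<in> Con \<Sigma> A"
  using Cg_in_Con[OF alg] by (auto simp: fg_Con_def)

lemma Delta_fg: "Delta A \<in> fg_Con \<Sigma> A"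
proof -
  have "Cg \<Sigma> A {} = Delta A"
    using Cg_least[OF Delta_Con, of "{}"] Delta_subset_Con[OF Cg_in_Con[OF alg, of "{}"]] by auto
  then show ?thesis unfolding fg_Con_def by (metis (mono_tags, lifting) empty_subsetI finite.emptyI mem_Collect_eq)
qed

lemma jn_fg:
  assumes "\<alpha> \<in> fg_Con \<Sigma> A" "\<beta> \<in> fg_Con \<Sigma> A" shows "jn \<alpha> \<beta> \<in> fg_Con \<Sigma> A"
proof -
  obtain X Y where XY: "finite X" "X \<subseteq> Nabla A" "\<alpha> = Cg \<Sigma> A X" "finite Y" "Y \<subseteq> Nabla A" "\<beta> = Cg \<Sigma> A Y"
    using assms by (auto simp: fg_Con_def)
  have "jn \<alpha> \<beta> = Cg \<Sigma> A (X \<union> Y)"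
  proof
    show "jn \<alpha> \<beta> \<subseteq> Cg \<Sigma> A (X \<union> Y)"
      unfolding XY using Cg_in_Con[OF alg, of "X \<union> Y"] XY by (intro jn_least Cg_mono) auto
    show "Cg \<Sigma> A (X \<union> Y) \<subseteq> jn \<alpha> \<beta>"
      using jn_upper(1)[of \<alpha> \<beta>] jn_upper(2)[of \<beta> \<alpha>] Cg_superset[of X \<Sigma> A] Cg_superset[of Y \<Sigma> A] XY(3,6)
      by (intro Cg_least jn_in_Con fg_Con_subset assms) auto
  qed
  moreover have "finite (X \<union> Y)" "X \<union> Y \<subseteq> Nabla A" using XY by auto
  ultimately show ?thesis unfolding fg_Con_def by blast
qed

text \<open>Compactness of finitely generated congruences: the finitely many generators already lie
  in one member of \<open>D\<close>.\<close>

lemma fg_Con_directed: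
  assumes "\<gamma> \<in> fg_Con \<Sigma> A" "\<gamma> \<subseteq> \<Union>D" "D \<noteq> {}" "D \<subseteq> Con \<Sigma> A"
    "\<And>\<theta> \<theta>'. \<theta> \<in> D \<Longrightarrow> \<theta>' \<in> D \<Longrightarrow> \<exists>\<phi>\<in>D. \<theta> \<union> \<theta>' \<subseteq> \<phi>"
  shows "\<exists>\<phi>\<in>D. \<gamma> \<subseteq> \<phi>"
proof -
  obtain X where X: "finite X" "\<gamma> = Cg \<Sigma> A X" using assms(1) by (auto simp: fg_Con_def)
  then have "X \<subseteq> \<Union>D" using Cg_superset[of X] assms(2) by blast
  then obtain \<phi> where "\<phi> \<in> D" "X \<subseteq> \<phi>"
    using finite_subset_directed[OF X(1) _ assms(3,5)] by blast
  then show ?thesis using Cg_least[of \<phi> \<Sigma> A X] assms(4) X(2) by blast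
qed

text \<open>A congruence that is maximal among those containing no member of a multiplicative system
  of compact congruences is prime.\<close>

lemma prime_avoiding:
  assumes K: "K \<subseteq> fg_Con \<Sigma> A" "K \<noteq> {}"
    and mult: "\<And>\<gamma> \<gamma>'. \<gamma> \<in> K \<Longrightarrow> \<gamma>' \<in> K \<Longrightarrow> \<exists>\<kappa>\<in>K. \<kappa> \<subseteq> cm \<gamma> \<gamma>'"
    and \<theta>: "\<theta> \<in> Con \<Sigma> A" "\<And>\<kappa>. \<kappa> \<in> K \<Longrightarrow> \<not> \<kappa> \<subseteq> \<theta>"
  shows "\<exists>\<phi>\<in>Spec \<Sigma> A. \<theta> \<subseteq> \<phi> \<and> (\<forall>\<kappa>\<in>K. \<not> \<kappa> \<subseteq> \<phi>)"
proof -
  define F where "F = {\<phi> \<in> Con \<Sigma> A. \<theta> \<subseteq> \<phi> \<and> (\<forall>\<kappa>\<in>K. \<not> \<kappa> \<subseteq> \<phi>)}"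
  have "\<exists>\<phi>\<in>F. \<forall>\<psi>\<in>F. \<phi> \<subseteq> \<psi> \<longrightarrow> \<psi> = \<phi>"
  proof (rule subset_Zorn_nonempty)
    show "F \<noteq> {}" using \<theta> by (auto simp: F_def)
    fix D assume D: "D \<noteq> {}" "subset.chain F D"
    then have sub: "D \<subseteq> F" by (simp add: subset_chain_def)
    have dir: "\<exists>\<phi>\<in>D. \<psi> \<union> \<psi>' \<subseteq> \<phi>" if "\<psi> \<in> D" "\<psi>' \<in> D" for \<psi> \<psi>'
    proof -
      have "\<psi> \<subseteq> \<psi>' \<or> \<psi>' \<subseteq> \<psi>" using D(2) that by (auto simp: subset_chain_def)
      then show ?thesis using that by blast
    qed
    have con: "D \<subseteq> Con \<Sigma> A" using sub by (auto simp: F_def)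
    have "\<Union>D \<in> Con \<Sigma> A" by (rule directed_Union_in_Con[OF D(1) con dir])
    moreover have "\<theta> \<subseteq> \<Union>D" using D(1) sub by (auto simp: F_def)
    moreover have "\<not> \<kappa> \<subseteq> \<Union>D" if \<kappa>: "\<kappa> \<in> K" for \<kappa>
    proof
      assume "\<kappa> \<subseteq> \<Union>D"
      then have "\<exists>\<phi>\<in>D. \<kappa> \<subseteq> \<phi>"
        using fg_Con_directed[OF _ _ D(1) con dir] \<kappa> K(1) by blast
      then show False using sub \<kappa> by (auto simp: F_def)
    qed
    ultimately show "\<Union>D \<in> F" by (simp add: F_def)
  qed
  then obtain \<phi> where \<phi>: "\<phi> \<in> F" and max: "\<And>\<psi>. \<psi> \<in> F \<Longrightarrow> \<phi> \<subseteq> \<psi> \<Longrightarrow> \<psi> = \<phi>" by blast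
  have con: "\<phi> \<in> Con \<Sigma> A" and "\<theta> \<subseteq> \<phi>" and avoid: "\<And>\<kappa>. \<kappa> \<in> K \<Longrightarrow> \<not> \<kappa> \<subseteq> \<phi>"
    using \<phi> by (auto simp: F_def)
  have above: "\<exists>\<kappa>\<in>K. \<kappa> \<subseteq> jn \<phi> \<alpha>" if "\<alpha> \<in> Con \<Sigma> A" "\<not> \<alpha> \<subseteq> \<phi>" for \<alpha>
  proof (rule ccontr)
    assume "\<not> (\<exists>\<kappa>\<in>K. \<kappa> \<subseteq> jn \<phi> \<alpha>)"
    then have "jn \<phi> \<alpha> \<in> F"
      using jn_in_Con[OF con that(1)] jn_upper(1)[of \<phi> \<alpha>] \<open>\<theta> \<subseteq> \<phi>\<close> by (auto simp: F_def)
    then have "jn \<phi> \<alpha> = \<phi>" using max jn_upper(1)[of \<phi> \<alpha>] by blast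
    then show False using jn_upper(2)[of \<alpha> \<phi>] that(2) by simp
  qed
  have "\<phi> \<in> Spec \<Sigma> A"
    unfolding Spec_def
  proof (intro CollectI conjI ballI impI)
    show "\<phi> \<in> Con \<Sigma> A" by (rule con)
    obtain \<kappa> where "\<kappa> \<in> K" using K(2) by blast
    then have "\<kappa> \<subseteq> Nabla A" using K(1) fg_Con_subset Con_subset_Nabla by blast
    then show "\<phi> \<noteq> Nabla A" using avoid[OF \<open>\<kappa> \<in> K\<close>] by blast
    fix \<alpha> \<beta> assume ab: "\<alpha> \<in> Con \<Sigma> A" "\<beta> \<in> Con \<Sigma> A" and cm: "cm \<alpha> \<beta> \<subseteq> \<phi>"
    show "\<alpha> \<subseteq> \<phi> \<or> \<beta> \<subseteq> \<phi>"
    proof (rule ccontr)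
      assume "\<not> (\<alpha> \<subseteq> \<phi> \<or> \<beta> \<subseteq> \<phi>)"
      then obtain \<kappa> \<kappa>' where k: "\<kappa> \<in> K" "\<kappa>' \<in> K" "\<kappa> \<subseteq> jn \<phi> \<alpha>" "\<kappa>' \<subseteq> jn \<phi> \<beta>"
        using above ab by meson
      note j = jn_in_Con[OF con ab(1)] jn_in_Con[OF con ab(2)]
      \<comment> \<open>After expansion of the joins, every commutator has \<phi> as an argument
        except [\<alpha>, \<beta>], which lies in \<phi> by assumption.\<close>
      have "cm (jn \<phi> \<alpha>) (jn \<phi> \<beta>) \<subseteq> jn (cm \<phi> (jn \<phi> \<beta>)) (cm \<alpha> (jn \<phi> \<beta>))"
        by (rule comm_join1[OF con ab(1) j(2)])
      also have "\<dots> \<subseteq> \<phi>"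
      proof (rule jn_least[OF con])
        show "cm \<phi> (jn \<phi> \<beta>) \<subseteq> \<phi>" using cm_subset[OF con j(2)] by blast
        have "cm \<alpha> (jn \<phi> \<beta>) \<subseteq> jn (cm \<alpha> \<phi>) (cm \<alpha> \<beta>)" by (rule comm_join2[OF ab(1) con ab(2)])
        also have "\<dots> \<subseteq> \<phi>" by (rule jn_least[OF con]) (use cm_subset[OF ab(1) con] cm in auto)
        finally show "cm \<alpha> (jn \<phi> \<beta>) \<subseteq> \<phi>" .
      qed
      finally have "cm \<kappa> \<kappa>' \<subseteq> \<phi>" using commutator_mono[OF k(3,4)] by blast
      then show False using mult[OF k(1,2)] avoid by blast
    qed
  qed
  then show ?thesis using \<open>\<theta> \<subseteq> \<phi>\<close> avoid by blast
qed

section \<open>Radicals\<close>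

text \<open>As \<nabla> is compact and [\<nabla>, \<nabla>] = \<nabla>, it forms a multiplicative
  system by itself, so every proper congruence lies in a prime.\<close>

lemma radical_eq_Nabla:
  assumes "\<theta> \<in> Con \<Sigma> A" "Nabla A \<subseteq> rad \<theta>"
  shows "\<theta> = Nabla A"
proof (rule ccontr)
  assume "\<theta> \<noteq> Nabla A"
  then have "\<not> Nabla A \<subseteq> \<theta>" using Con_subset_Nabla[OF assms(1)] by blast
  then obtain \<phi> where "\<phi> \<in> Spec \<Sigma> A" "\<theta> \<subseteq> \<phi>" "\<not> Nabla A \<subseteq> \<phi>"
    using prime_avoiding[of "{Nabla A}" \<theta>] assms(1) Nabla_fg comm_Nabla1[OF Nabla_Con] by auto
  then show False using assms(2) by (auto simp: radical_def)
qed

text \<open>The primes above [\<alpha>, \<beta>] are those above \<alpha> or above \<beta>. Hence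
  the commutator is a meet for the preorder by radicals.\<close>

lemma radical_commutator:
  assumes "\<alpha> \<in> Con \<Sigma> A" "\<beta> \<in> Con \<Sigma> A"
  shows "rad (cm \<alpha> \<beta>) = rad \<alpha> \<inter> rad \<beta>"
proof -
  have "cm \<alpha> \<beta> \<subseteq> \<phi> \<longleftrightarrow> \<alpha> \<subseteq> \<phi> \<or> \<beta> \<subseteq> \<phi>" if "\<phi> \<in> Spec \<Sigma> A" for \<phi>
    using that assms cm_subset[OF assms] unfolding Spec_def by blast
  then show ?thesis unfolding radical_def by blast
qed

lemma radical_jn_least:
  assumes "\<alpha> \<in> Con \<Sigma> A" "\<beta> \<in> Con \<Sigma> A" "\<gamma> \<in> Con \<Sigma> A" "rad \<alpha> \<subseteq> rad \<gamma>" "rad \<beta> \<subseteq> rad \<gamma>"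
  shows "rad (jn \<alpha> \<beta>) \<subseteq> rad \<gamma>"
proof -
  have "jn \<alpha> \<beta> \<subseteq> rad \<gamma>"
    using assms radical_increasing[of \<alpha> \<Sigma> A] radical_increasing[of \<beta> \<Sigma> A]
    by (intro jn_least radical_in_Con[OF alg]) auto
  then show ?thesis using radical_mono radical_radical[OF assms(3)] by metis
qed

lemma rad_class_eqI:
  "\<alpha> \<in> Con \<Sigma> A \<Longrightarrow> \<beta> \<in> Con \<Sigma> A \<Longrightarrow> rad \<alpha> \<subseteq> rad \<beta> \<Longrightarrow> rad \<beta> \<subseteq> rad \<alpha> \<Longrightarrow>
    rad_class \<Sigma> A \<alpha> = rad_class \<Sigma> A \<beta>"
  by (simp add: rad_class_eq)

section \<open>Congruences, their quotient and the reticulation as represented lattices\<close>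

sublocale Con: represented_lattice "Con \<Sigma> A" "(\<subseteq>)" jn cm "Delta A" "Nabla A"
  "Con_lattice \<Sigma> A" "\<lambda>\<alpha>. \<alpha>" "(\<inter>)"
proof unfold_locales
  fix \<alpha> \<beta> \<gamma> assume "\<alpha> \<in> Con \<Sigma> A" "\<beta> \<in> Con \<Sigma> A" "\<gamma> \<in> Con \<Sigma> A" "\<alpha> \<subseteq> \<gamma>" "\<beta> \<subseteq> \<gamma>"
  then show "jn \<alpha> \<beta> \<subseteq> \<gamma>" by (intro jn_least)
next
  fix \<alpha> \<beta> assume "\<alpha> \<in> Con \<Sigma> A" "\<beta> \<in> Con \<Sigma> A"
  then show "cm \<alpha> \<beta> \<subseteq> cm \<beta> \<alpha>" by (simp add: comm)
next
  show "eq (Con_lattice \<Sigma> A) = (=)" by (simp add: Con_lattice_def)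
next
  fix \<alpha> \<beta> \<gamma> :: "'a rel" assume "\<alpha> \<subseteq> \<beta>" "\<beta> \<subseteq> \<gamma>"
  then show "\<alpha> \<subseteq> \<gamma>" by (rule subset_trans)
qed (simp_all add: jn_in_Con cm_in_Con Delta_Con Nabla_Con Delta_subset_Con Con_subset_Nabla jn_upper
    comm_Nabla2 comm_join2 Int_in_Con cm_subset[THEN subset_trans] commutator_mono)

text \<open>Stated for a set \<open>I\<close> in order to cover both the congruences and the compact
  congruences.\<close>

lemma radical_multiplicative:
  assumes I: "I \<subseteq> Con \<Sigma> A" "Delta A \<in> I" "Nabla A \<in> I"
    "\<And>\<alpha> \<beta>. \<alpha> \<in> I \<Longrightarrow> \<beta> \<in> I \<Longrightarrow> jn \<alpha> \<beta> \<in> I" "\<And>\<alpha> \<beta>. \<alpha> \<in> I \<Longrightarrow> \<beta> \<in> I \<Longrightarrow> cm \<alpha> \<beta> \<in> I"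
  shows "multiplicative_preorder I (\<lambda>\<alpha> \<beta>. rad \<alpha> \<subseteq> rad \<beta>) jn cm (Delta A) (Nabla A)"
proof
  note con = subsetD[OF I(1)]
  fix \<alpha> \<beta> \<gamma>
  show "rad (Delta A) \<subseteq> rad \<alpha>" "rad \<alpha> \<subseteq> rad (Nabla A)" if "\<alpha> \<in> I"
    using con[OF that] by (auto intro!: radical_mono dest: Delta_subset_Con Con_subset_Nabla)
  show "rad \<alpha> \<subseteq> rad (jn \<alpha> \<beta>)" "rad \<beta> \<subseteq> rad (jn \<alpha> \<beta>)"
    by (rule radical_mono, rule jn_upper)+
  show "rad (cm \<alpha> (jn \<beta> \<gamma>)) \<subseteq> rad (jn (cm \<alpha> \<beta>) (cm \<alpha> \<gamma>))" if "\<alpha> \<in> I" "\<beta> \<in> I" "\<gamma> \<in> I"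
    by (rule radical_mono, rule comm_join2) (use that con in auto)
  show "rad \<alpha> \<subseteq> rad (cm \<alpha> (Nabla A))" if "\<alpha> \<in> I"
    using con[OF that] by (simp add: comm_Nabla2)
  show "rad (jn \<alpha> \<beta>) \<subseteq> rad \<gamma>" if "\<alpha> \<in> I" "\<beta> \<in> I" "\<gamma> \<in> I" "rad \<alpha> \<subseteq> rad \<gamma>" "rad \<beta> \<subseteq> rad \<gamma>"
    by (rule radical_jn_least) (use that con in auto)
  show "rad (cm \<alpha> \<beta>) \<subseteq> rad (cm \<beta> \<alpha>)" "rad (cm \<alpha> \<beta>) \<subseteq> rad \<alpha>" if "\<alpha> \<in> I" "\<beta> \<in> I"
    using that[THEN con] by (auto simp: radical_commutator)
  show "rad (cm \<alpha> \<gamma>) \<subseteq> rad (cm \<beta> \<gamma>)" if "\<alpha> \<in> I" "\<beta> \<in> I" "\<gamma> \<in> I" "rad \<alpha> \<subseteq> rad \<beta>"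
    using that(1-3)[THEN con] that(4) by (auto simp: radical_commutator)
  show "rad \<alpha> \<subseteq> rad \<gamma>" if "rad \<alpha> \<subseteq> rad \<beta>" "rad \<beta> \<subseteq> rad \<gamma>"
    using that by (rule subset_trans)
qed (simp_all add: I(2-5))

sublocale Quot: represented_lattice "Con \<Sigma> A" "\<lambda>\<alpha> \<beta>. rad \<alpha> \<subseteq> rad \<beta>" jn cm "Delta A" "Nabla A"
  "quotient_lattice \<Sigma> A" "rad_class \<Sigma> A" cm
proof -
  interpret multiplicative_preorder "Con \<Sigma> A" "\<lambda>\<alpha> \<beta>. rad \<alpha> \<subseteq> rad \<beta>" jn cm "Delta A" "Nabla A"
    by (rule radical_multiplicative) (use Delta_Con Nabla_Con jn_in_Con cm_in_Con in auto)
  show "represented_lattice (Con \<Sigma> A) (\<lambda>\<alpha> \<beta>. rad \<alpha> \<subseteq> rad \<beta>) jn cm (Delta A) (Nabla A)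
      (quotient_lattice \<Sigma> A) (rad_class \<Sigma> A) cm"
  proof unfold_locales
    show "eq (quotient_lattice \<Sigma> A) = (=)" by (simp add: quotient_lattice_def)
    show "rad_class \<Sigma> A \<alpha> = rad_class \<Sigma> A \<beta>"
      if "\<alpha> \<in> Con \<Sigma> A" "\<beta> \<in> Con \<Sigma> A" "rad \<alpha> \<subseteq> rad \<beta>" "rad \<beta> \<subseteq> rad \<alpha>" for \<alpha> \<beta>
      by (rule rad_class_eqI[OF that])
  qed (simp_all add: carrier_quotient_lattice quotient_lattice_le_iff[OF alg] radical_commutator)
qed

sublocale Ret: represented_lattice "fg_Con \<Sigma> A" "\<lambda>\<alpha> \<beta>. rad \<alpha> \<subseteq> rad \<beta>" jn cm "Delta A" "Nabla A"
  "reticulation \<Sigma> A" "rad_class \<Sigma> A" cm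
proof -
  interpret multiplicative_preorder "fg_Con \<Sigma> A" "\<lambda>\<alpha> \<beta>. rad \<alpha> \<subseteq> rad \<beta>" jn cm "Delta A" "Nabla A"
    by (rule radical_multiplicative) (use fg_Con_subset Delta_fg Nabla_fg jn_fg comm_fg in auto)
  have le: "gorder.le (reticulation \<Sigma> A) = gorder.le (quotient_lattice \<Sigma> A)"
    by (simp add: reticulation_def)
  show "represented_lattice (fg_Con \<Sigma> A) (\<lambda>\<alpha> \<beta>. rad \<alpha> \<subseteq> rad \<beta>) jn cm (Delta A) (Nabla A)
      (reticulation \<Sigma> A) (rad_class \<Sigma> A) cm"
  proof unfold_locales
    show "eq (reticulation \<Sigma> A) = (=)" by (simp add: reticulation_def quotient_lattice_def)
    show "carrier (reticulation \<Sigma> A) = rad_class \<Sigma> A ` fg_Con \<Sigma> A" by (simp add: reticulation_def)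
    show "rad_class \<Sigma> A \<alpha> = rad_class \<Sigma> A \<beta>"
      if "\<alpha> \<in> fg_Con \<Sigma> A" "\<beta> \<in> fg_Con \<Sigma> A" "rad \<alpha> \<subseteq> rad \<beta>" "rad \<beta> \<subseteq> rad \<alpha>" for \<alpha> \<beta>
      by (rule rad_class_eqI[OF fg_Con_subset[OF that(1)] fg_Con_subset[OF that(2)] that(3,4)])
  qed (simp_all add: le quotient_lattice_le_iff[OF alg] fg_Con_subset radical_commutator)
qed

section \<open>Complemented congruences and their classes\<close>

text \<open>As \<nabla> is compact, finitely many pairs of \<alpha> \<union> \<beta> generate it.
  Those in \<alpha> generate some \<gamma> \<subseteq> \<alpha> with \<gamma> \<or> \<beta> =
  \<nabla>, and \<alpha> = [\<gamma> \<or> \<beta>, \<alpha>] \<subseteq> [\<gamma>, \<alpha>] \<or>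
  [\<beta>, \<alpha>] \<subseteq> \<gamma>.\<close>

lemma complements_fg:
  assumes "Con.complements \<alpha> \<beta>"
  shows "\<alpha> \<in> fg_Con \<Sigma> A"
proof -
  have ab: "\<alpha> \<in> Con \<Sigma> A" "\<beta> \<in> Con \<Sigma> A" "Nabla A \<subseteq> jn \<alpha> \<beta>" "cm \<alpha> \<beta> \<subseteq> Delta A"
    using assms by (auto simp: Con.complements_def)
  obtain Z where Z: "finite Z" "Nabla A = Cg \<Sigma> A Z"
    using Nabla_fg by (auto simp: fg_Con_def)
  have n: "\<alpha> \<union> \<beta> \<subseteq> Nabla A" using ab Con_subset_Nabla by blast
  have "Z \<subseteq> jn \<alpha> \<beta>" using ab(3) Z(2) Cg_superset[of Z \<Sigma> A] by blast
  then obtain Y where Y: "finite Y" "Y \<subseteq> \<alpha> \<union> \<beta>" "Z \<subseteq> Cg \<Sigma> A Y"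
    using finite_subset_Cg[OF alg n Z(1)] by blast
  define \<gamma> where "\<gamma> = Cg \<Sigma> A (Y \<inter> \<alpha>)"
  have \<gamma>: "\<gamma> \<in> Con \<Sigma> A" "\<gamma> \<in> fg_Con \<Sigma> A" "\<gamma> \<subseteq> \<alpha>" "Y \<inter> \<alpha> \<subseteq> \<gamma>"
    unfolding \<gamma>_def using Y(1) n Cg_least[OF ab(1), of "Y \<inter> \<alpha>"] Cg_superset[of "Y \<inter> \<alpha>" \<Sigma> A]
    by (auto simp: fg_Con_def intro!: Cg_in_Con[OF alg])
  note j = jn_in_Con[OF \<gamma>(1) ab(2)]
  have "Y \<subseteq> jn \<gamma> \<beta>" using Y(2) \<gamma>(4) jn_upper[of \<gamma> \<beta>] jn_upper(2)[of \<beta> \<gamma>] by blast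
  then have "Z \<subseteq> jn \<gamma> \<beta>" using Y(3) Cg_least[OF j] by blast
  then have "Nabla A \<subseteq> jn \<gamma> \<beta>" using Cg_least[OF j] Z(2) by simp
  then have "\<alpha> \<subseteq> cm (jn \<gamma> \<beta>) \<alpha>"
    using comm_Nabla1[OF ab(1)] commutator_mono[of "Nabla A" "jn \<gamma> \<beta>" \<alpha> \<alpha> \<Sigma> A] by auto
  also have "\<dots> \<subseteq> jn (cm \<gamma> \<alpha>) (cm \<beta> \<alpha>)" by (rule comm_join1[OF \<gamma>(1) ab(2,1)])
  also have "\<dots> \<subseteq> \<gamma>"
    using cm_subset[OF \<gamma>(1) ab(1)] ab(4) comm[OF ab(1,2)] Delta_subset_Con[OF \<gamma>(1)]
    by (intro jn_least[OF \<gamma>(1)]) auto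
  finally show ?thesis using \<gamma> by (metis subset_antisym)
qed

lemma Con_complements_imp_Ret:
  assumes "Con.complements \<alpha> \<beta>" shows "Ret.complements \<alpha> \<beta>"
  using complements_fg[OF assms] complements_fg[OF Con.complements_sym[OF assms]] assms
  by (auto simp: Con.complements_def Ret.complements_def radical_mono)

lemma Ret_complements_imp_Quot: "Ret.complements \<alpha> \<beta> \<Longrightarrow> Quot.complements \<alpha> \<beta>"
  by (auto simp: Quot.complements_def Ret.complements_def fg_Con_subset)

lemma compl_subset:
  "Con.compl_elements \<subseteq> Ret.compl_elements" "Ret.compl_elements \<subseteq> Quot.compl_elements"
  unfolding Con.compl_elements_def Ret.compl_elements_def Quot.compl_elements_def
  using Con_complements_imp_Ret Ret_complements_imp_Quot by blast+

text \<open>Replacing \<alpha> by \<beta> in \<alpha> \<or> \<alpha>' = \<nabla> does not change the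
  radical, so \<beta> \<or> \<alpha>' = \<nabla> as well. Expanding \<alpha> =
  [\<alpha>, \<beta> \<or> \<alpha>'] then leaves only [\<alpha>, \<beta>]. Used in both directions,
  this yields injectivity.\<close>

lemma complements_le_of_radical:
  assumes "Con.complements \<alpha> \<alpha>'" "\<beta> \<in> Con \<Sigma> A" "rad \<beta> = rad \<alpha>"
  shows "\<alpha> \<subseteq> \<beta>"
proof -
  have a: "\<alpha> \<in> Con \<Sigma> A" "\<alpha>' \<in> Con \<Sigma> A" "Nabla A \<subseteq> jn \<alpha> \<alpha>'" "cm \<alpha> \<alpha>' \<subseteq> Delta A"
    using assms(1) by (auto simp: Con.complements_def)
  note j = jn_in_Con[OF assms(2) a(2)]
  have "rad (Nabla A) \<subseteq> rad (jn \<alpha> \<alpha>')" by (rule radical_mono[OF a(3)])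
  also have "\<dots> \<subseteq> rad (jn \<beta> \<alpha>')"
    by (rule Quot.J_mono) (use a assms in auto)
  finally have "Nabla A \<subseteq> rad (jn \<beta> \<alpha>')"
    using radical_increasing[OF Nabla_Con] by blast
  then have n: "jn \<beta> \<alpha>' = Nabla A" by (rule radical_eq_Nabla[OF j])
  have "\<alpha> = cm \<alpha> (jn \<beta> \<alpha>')" unfolding n using comm_Nabla2[OF a(1)] by simp
  also have "\<dots> \<subseteq> jn (cm \<alpha> \<beta>) (cm \<alpha> \<alpha>')" by (rule comm_join2[OF a(1) assms(2) a(2)])
  also have "\<dots> \<subseteq> \<beta>"
    using cm_subset[OF a(1) assms(2)] a(4) Delta_subset_Con[OF assms(2)]
    by (intro jn_least[OF assms(2)]) auto
  finally show ?thesis .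
qed

lemma inj_on_rad_class: "inj_on (rad_class \<Sigma> A) Con.compl_elements"
proof (rule inj_onI)
  fix \<alpha> \<beta> assume ab: "\<alpha> \<in> Con.compl_elements" "\<beta> \<in> Con.compl_elements" "rad_class \<Sigma> A \<alpha> = rad_class \<Sigma> A \<beta>"
  note con = ab(1,2)[THEN Con.compl_elements_subset]
  have "rad \<alpha> = rad \<beta>" using Quot.h_eq_iff[OF con] ab(3) by blast
  then show "\<alpha> = \<beta>"
    using ab(1,2) con complements_le_of_radical[of \<alpha> _ \<beta>] complements_le_of_radical[of \<beta> _ \<alpha>]
    unfolding Con.compl_elements_def by blast
qed

text \<open>On both sides joins and meets of complemented elements are represented by
  \<open>jn\<close> and \<open>cm\<close>, so they are preserved by construction.\<close>

lemma boolean_morphism_rad_class: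
  "boolean_morphism (complemented_poset (Con_lattice \<Sigma> A)) (complemented_poset (reticulation \<Sigma> A))
    (rad_class \<Sigma> A)"
proof -
  have "lattice Con.C" "lattice Ret.C"
    using Con.boolean_algebra_C Ret.boolean_algebra_C
    by (auto simp: boolean_algebra_def bounded_lattice_def)
  then show ?thesis
    unfolding boolean_morphism_def join_pres_def meet_pres_def
    using Con.boolean_algebra_C Ret.boolean_algebra_C Con.carrier_C Ret.carrier_C compl_subset(1)
    by (auto simp: Con.C_ops Ret.C_ops subset_iff)
qed

text \<open>The derived series of a compact congruence is a multiplicative system, so it reaches the
  least congruence as soon as the congruence lies in all primes.\<close>

definition derived :: "nat \<Rightarrow> 'a rel \<Rightarrow> 'a rel" where
  "derived n \<gamma> = ((\<lambda>\<delta>. cm \<delta> \<delta>) ^^ n) \<gamma>"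

lemma derived_simps [simp]: "derived 0 \<gamma> = \<gamma>" "derived (Suc n) \<gamma> = cm (derived n \<gamma>) (derived n \<gamma>)"
  by (simp_all add: derived_def)

lemma derived_in_Con: "\<gamma> \<in> Con \<Sigma> A \<Longrightarrow> derived n \<gamma> \<in> Con \<Sigma> A"
  by (induction n) (auto intro: cm_in_Con)

lemma derived_fg: "\<gamma> \<in> fg_Con \<Sigma> A \<Longrightarrow> derived n \<gamma> \<in> fg_Con \<Sigma> A"
  by (induction n) (auto intro: comm_fg)

lemma derived_antimono: "\<gamma> \<in> Con \<Sigma> A \<Longrightarrow> m \<le> n \<Longrightarrow> derived n \<gamma> \<subseteq> derived m \<gamma>"
  using lift_Suc_antimono_le[of "\<lambda>n. derived n \<gamma>" m n]
    cm_subset[OF derived_in_Con derived_in_Con, of \<gamma> \<gamma>] by auto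

lemma radical_derived: "\<gamma> \<in> Con \<Sigma> A \<Longrightarrow> rad (derived n \<gamma>) = rad \<gamma>"
  by (induction n) (auto simp: radical_commutator derived_in_Con)

lemma derived_eventually_Delta:
  assumes \<gamma>: "\<gamma> \<in> fg_Con \<Sigma> A" "rad \<gamma> \<subseteq> rad (Delta A)"
  shows "\<exists>n. derived n \<gamma> \<subseteq> Delta A"
proof (rule ccontr)
  assume no: "\<nexists>n. derived n \<gamma> \<subseteq> Delta A"
  note con = fg_Con_subset[OF \<gamma>(1)]
  have mult: "\<exists>\<kappa>\<in>range (\<lambda>n. derived n \<gamma>). \<kappa> \<subseteq> cm \<delta> \<delta>'"
    if "\<delta> \<in> range (\<lambda>n. derived n \<gamma>)" "\<delta>' \<in> range (\<lambda>n. derived n \<gamma>)" for \<delta> \<delta>'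
  proof -
    obtain m n where mn: "\<delta> = derived m \<gamma>" "\<delta>' = derived n \<gamma>" using \<open>\<delta> \<in> _\<close> \<open>\<delta>' \<in> _\<close> by blast
    \<comment> \<open>The member with index \<open>max m n\<close> lies below both \<delta> and
      \<delta>'; \<open>Suc\<close> takes its commutator with itself.\<close>
    have "derived (Suc (max m n)) \<gamma> \<subseteq> cm \<delta> \<delta>'"
      unfolding mn derived_simps by (intro commutator_mono derived_antimono con) auto
    then show ?thesis by blast
  qed
  obtain \<phi> where \<phi>: "\<phi> \<in> Spec \<Sigma> A" "\<forall>\<kappa>\<in>range (\<lambda>n. derived n \<gamma>). \<not> \<kappa> \<subseteq> \<phi>"
    using prime_avoiding[OF _ _ mult Delta_Con] derived_fg[OF \<gamma>(1)] no by blast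
  then have "\<not> derived 0 \<gamma> \<subseteq> \<phi>" by blast
  moreover have "Delta A \<subseteq> \<phi>" using \<phi>(1) Delta_subset_Con by (auto simp: Spec_def)
  then have "rad (Delta A) \<subseteq> \<phi>" using \<phi>(1) by (auto simp: radical_def)
  moreover have "\<gamma> \<subseteq> rad (Delta A)" using radical_increasing[OF con] \<gamma>(2) by blast
  ultimately show False by auto
qed

text \<open>Associativity and commutativity permit the regrouping [[a, a], [b, b]] = [[a, b],
  [a, b]] at each stage of the series.\<close>

lemma derived_commutator:
  assumes "commutator_associative \<Sigma> A" "\<alpha> \<in> Con \<Sigma> A" "\<beta> \<in> Con \<Sigma> A"
  shows "cm (derived n \<alpha>) (derived n \<beta>) = derived n (cm \<alpha> \<beta>)"
proof (induction n)
  case (Suc n)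
  have assoc: "cm (cm x y) z = cm x (cm y z)"
    if "x \<in> Con \<Sigma> A" "y \<in> Con \<Sigma> A" "z \<in> Con \<Sigma> A" for x y z
    using assms(1) that by (simp add: commutator_associative_def)
  define a where "a = derived n \<alpha>"
  define b where "b = derived n \<beta>"
  have ab: "a \<in> Con \<Sigma> A" "b \<in> Con \<Sigma> A" using assms derived_in_Con by (auto simp: a_def b_def)
  have "cm (cm a a) (cm b b) = cm a (cm (cm a b) b)"
    using ab by (simp add: assoc cm_in_Con)
  also have "\<dots> = cm a (cm (cm b a) b)" using comm[OF ab] by simp
  also have "\<dots> = cm (cm a b) (cm a b)" using ab by (simp add: assoc cm_in_Con)
  finally show ?case using Suc by (simp add: a_def b_def)
qed simp

section \<open>Lifting complements to congruences\<close>

lemma rad_class_image_associative: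
  assumes "commutator_associative \<Sigma> A"
  shows "rad_class \<Sigma> A ` Con.compl_elements = rad_class \<Sigma> A ` Ret.compl_elements"
proof (rule subset_antisym[OF image_mono[OF compl_subset(1)]], rule subsetI)
  fix x assume "x \<in> rad_class \<Sigma> A ` Ret.compl_elements"
  then obtain \<alpha> \<beta> where x: "x = rad_class \<Sigma> A \<alpha>" and "Ret.complements \<alpha> \<beta>"
    by (auto simp: Ret.compl_elements_def)
  then have fg: "\<alpha> \<in> fg_Con \<Sigma> A" "\<beta> \<in> fg_Con \<Sigma> A" and top: "rad (Nabla A) \<subseteq> rad (jn \<alpha> \<beta>)"
    and bot: "rad (cm \<alpha> \<beta>) \<subseteq> rad (Delta A)"
    by (auto simp: Ret.complements_def)
  note con = fg[THEN fg_Con_subset]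
  \<comment> \<open>The n-th derived congruences of \<alpha> and \<beta> represent the same classes
    as \<alpha> and \<beta>, but their commutator is \<Delta> itself and not merely below
    \<rho>(\<Delta>).\<close>
  obtain n where n: "derived n (cm \<alpha> \<beta>) \<subseteq> Delta A"
    using derived_eventually_Delta[OF comm_fg[OF fg] bot] by blast
  note d = derived_in_Con[OF con(1), of n] derived_in_Con[OF con(2), of n]
  have "rad (jn \<alpha> \<beta>) \<subseteq> rad (jn (derived n \<alpha>) (derived n \<beta>))"
    by (rule Quot.J_mono) (use con d in \<open>auto simp: radical_derived\<close>)
  then have "Nabla A \<subseteq> rad (jn (derived n \<alpha>) (derived n \<beta>))"
    using top radical_increasing[OF Nabla_Con] by blast
  then have "Con.complements (derived n \<alpha>) (derived n \<beta>)"
    using radical_eq_Nabla[OF jn_in_Con[OF d]] d n derived_commutator[OF assms con]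
    by (simp add: Con.complements_def)
  then have "derived n \<alpha> \<in> Con.compl_elements" using Con.complements_in by blast
  moreover have "x = rad_class \<Sigma> A (derived n \<alpha>)"
    using x con d by (simp add: rad_class_eq radical_derived)
  ultimately show "x \<in> rad_class \<Sigma> A ` Con.compl_elements" by blast
qed

text \<open>With \<rho>(\<Delta>) = \<Delta>, complementing modulo radicals is complementing
  outright: the commutator is \<Delta>, and a join with full radical is \<nabla>. Compactness does
  not enter, so this covers the whole quotient.\<close>

lemma Quot_compl_elements_semiprime:
  assumes "semiprime \<Sigma> A"
  shows "Quot.compl_elements = Con.compl_elements"
proof (intro subset_antisym subsetI)
  fix \<alpha> assume "\<alpha> \<in> Quot.compl_elements"
  then obtain \<beta> where "Quot.complements \<alpha> \<beta>" by (auto simp: Quot.compl_elements_def)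
  then have con: "\<alpha> \<in> Con \<Sigma> A" "\<beta> \<in> Con \<Sigma> A" and top: "rad (Nabla A) \<subseteq> rad (jn \<alpha> \<beta>)"
    and bot: "rad (cm \<alpha> \<beta>) \<subseteq> rad (Delta A)"
    by (auto simp: Quot.complements_def)
  have "Nabla A \<subseteq> rad (jn \<alpha> \<beta>)" using top radical_increasing[OF Nabla_Con] by blast
  then have "Nabla A \<subseteq> jn \<alpha> \<beta>" using radical_eq_Nabla[OF jn_in_Con[OF con]] by simp
  moreover have "cm \<alpha> \<beta> \<subseteq> Delta A"
    using bot radical_increasing[OF cm_in_Con[OF con]] assms by (auto simp: semiprime_def)
  ultimately have "Con.complements \<alpha> \<beta>" using con by (simp add: Con.complements_def)
  then show "\<alpha> \<in> Con.compl_elements" using Con.complements_in by blast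
qed (use compl_subset in blast)

lemmas complemented_Con = Con.complemented_L[unfolded image_ident]

lemma boolean_isomorphism_rad_class:
  assumes "rad_class \<Sigma> A ` Con.compl_elements = rad_class \<Sigma> A ` Ret.compl_elements"
  shows "boolean_isomorphism (complemented_poset (Con_lattice \<Sigma> A))
    (complemented_poset (reticulation \<Sigma> A)) (rad_class \<Sigma> A)"
  unfolding boolean_isomorphism_def bij_betw_def Con.carrier_C Ret.carrier_C image_ident
  using boolean_morphism_rad_class inj_on_rad_class assms by blast

end

theorem proposition8p12:
  fixes \<Sigma> :: "'f signature" and E :: "'f identities" and A :: "('f, 'a) algebra"
  assumes "wf_identities \<Sigma> E"
    and "congruence_modular TYPE(('f, 'a) universe) \<Sigma> E"
    and "semi_degenerate TYPE(('f, 'a) universe) \<Sigma> E"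
    and "A \<in> variety \<Sigma> E"
    and "\<forall>\<alpha>\<in>fg_Con \<Sigma> A. \<forall>\<beta>\<in>fg_Con \<Sigma> A. commutator \<Sigma> A \<alpha> \<beta> \<in> fg_Con \<Sigma> A"
  shows "(boolean_morphism (complemented_poset (Con_lattice \<Sigma> A))
            (complemented_poset (reticulation \<Sigma> A)) (rad_class \<Sigma> A) \<and>
          inj_on (rad_class \<Sigma> A) (complemented (Con_lattice \<Sigma> A))) \<and>
         (commutator_associative \<Sigma> A \<longrightarrow>
            rad_class \<Sigma> A ` complemented (Con_lattice \<Sigma> A) = complemented (reticulation \<Sigma> A) \<and>
            complemented (reticulation \<Sigma> A)
              = {rad_class \<Sigma> A \<alpha> | \<alpha>. \<alpha> \<in> complemented (Con_lattice \<Sigma> A)} \<and>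
            {rad_class \<Sigma> A \<alpha> | \<alpha>. \<alpha> \<in> complemented (Con_lattice \<Sigma> A)}
              \<subseteq> complemented (quotient_lattice \<Sigma> A) \<and>
            boolean_isomorphism (complemented_poset (Con_lattice \<Sigma> A))
              (complemented_poset (reticulation \<Sigma> A)) (rad_class \<Sigma> A)) \<and>
         (semiprime \<Sigma> A \<longrightarrow>
            rad_class \<Sigma> A ` complemented (Con_lattice \<Sigma> A) = complemented (reticulation \<Sigma> A) \<and>
            complemented (reticulation \<Sigma> A)
              = {rad_class \<Sigma> A \<alpha> | \<alpha>. \<alpha> \<in> complemented (Con_lattice \<Sigma> A)} \<and>
            {rad_class \<Sigma> A \<alpha> | \<alpha>. \<alpha> \<in> complemented (Con_lattice \<Sigma> A)}
              = complemented (quotient_lattice \<Sigma> A) \<and>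
            boolean_isomorphism (complemented_poset (Con_lattice \<Sigma> A))
              (complemented_poset (reticulation \<Sigma> A)) (rad_class \<Sigma> A))"
proof -
  interpret commutator_algebra \<Sigma> A
  proof
    show "is_algebra \<Sigma> A" using assms(4) by (simp add: variety_def)
  qed (use assms(5) commutator_commute[OF assms(2,1,4)] commutator_join[OF assms(2,1,4)]
      commutator_Nabla[OF assms(3,1,4)] Nabla_finitely_generated[OF assms(3,1,4)] in blast)+
  note simps = complemented_Con Ret.complemented_L Quot.complemented_L
  have set_eq: "{rad_class \<Sigma> A \<alpha> |\<alpha>. \<alpha> \<in> Con.compl_elements} = rad_class \<Sigma> A ` Con.compl_elements"
    by blast
  have sub: "rad_class \<Sigma> A ` Con.compl_elements \<subseteq> rad_class \<Sigma> A ` Quot.compl_elements"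
    using compl_subset by blast
  \<comment> \<open>The complemented elements of the reticulation are squeezed between those of the
    congruence lattice and those of the quotient, which coincide here.\<close>
  have sp: "rad_class \<Sigma> A ` Con.compl_elements = rad_class \<Sigma> A ` Ret.compl_elements"
    if "semiprime \<Sigma> A"
    using compl_subset Quot_compl_elements_semiprime[OF that] by blast
  show ?thesis
    unfolding simps set_eq
    using boolean_morphism_rad_class inj_on_rad_class rad_class_image_associative sub sp
      boolean_isomorphism_rad_class Quot_compl_elements_semiprime
    by (intro conjI impI) simp_all
qed

end
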